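(* Let $L=L_{-1}\oplus L_0\oplus L_1$ be a $3$-graded Lie algebra over $k$. (i) For every Jordan pair $P=(P_-,P_+)$ and every Jordan pair homomorphism $\gamma=(\gamma_-,\gamma_+):P\to(L_{-1},L_1)$ there is a unique graded Lie algebra homomorphism $\widehat\gamma:\widehat{\mathrm{TKK}}(P)\to L$ extending $\gamma$, that is, $\widehat\gamma_{\pm1}=\gamma_\pm$. It is defined by $$\widehat\gamma\Big(a+\sum_i\langle c_i,d_i\rangle+b\Big)=\gamma_-(a)+\sum_i[\gamma_-(c_i),\gamma_+(d_i)]+\gamma_+(b)$$ for $a,c_i\in P_-$ and $b,d_i\in P_+$. (ii) If $L$ has an anti-graded involution $\varepsilon$, then for every Jordan triple system $T$ and every Jordan triple system homomorphism $\gamma:T\to\mathcal F_{\mathcal T}(L,\varepsilon)$ there is a unique involutary Lie algebra homomorphism $\widehat\gamma:(\widehat{\mathrm{TKK}}((T,T)),\widehat\kappa)\to(L,\varepsilon)$ extending $\gamma$ (i.e. $\widehat\gamma(a_+)=\gamma(a)$ for $a\in T$), where $\widehat\kappa$ is the canonical anti-graded involution on $\widehat{\mathrm{TKK}}((T,T))$. (iii) Furthermore, if $(L,\mathfrak s)$ is an $\mathrm{A}_1$-graded Lie algebra, then for every unital Jordan algebra $J$ and every unital Jordan algebra homomorphism $\gamma:J\to\mathcal F_{\mathcal{JA}}(L,\mathfrak s)$ there is a unique $\mathrm{A}_1$-graded morphism $\widehat\gamma:(\widehat{\mathrm{TKK}}((J,J)),\widehat{\mathfrak s})\to(L,\mathfrak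 s)$ extending $\gamma$ (i.e. $\widehat\gamma(a_+)=\gamma(a)$ for $a\in J$).
   Context: $k$ is a unital commutative ring with no $2$- or $3$-torsion; all modules, algebras and tensor products are over $k$. A subscript $\sigma$ denotes an element of $\{-,+\}$. Jordan pair: a pair of $k$-modules $P=(P_-,P_+)$ with trilinear maps $\{\,,\,,\,\}_\sigma:P_\sigma\times P_{-\sigma}\times P_\sigma\to P_\sigma$ such that, with $V_{a,b}c=\{a,b,c\}_\sigma$, $\{a,b,c\}=\{c,b,a\}$ and $[V_{a,b},V_{c,d}]=V_{V_{a,b}c,d}-V_{c,V_{b,a}d}$ for $a,c\in P_\sigma$, $b,d\in P_{-\sigma}$. A homomorphism $\gamma:P\to Q$ is a pair of linear maps $\gamma_\sigma:P_\sigma\to Q_\sigma$ with $\gamma_\sigma\{a,b,c\}=\{\gamma_\sigma a,\gamma_{-\sigma}b,\gamma_\sigma c\}$. Jordan triple system: a $k$-module $T$ with a trilinear product satisfying the same two identities for all elements of $T$; homomorphisms preserve the product; its Jordan pair is $(T,T)$ with both products equal to that of $T$. Unital Jordan algebra $J$: bilinear product with $ab=ba$, $(a^2b)a=a^2(ba)$, identity $1$; homomorphisms are unital. $J$ is a triple system under $\{a,b,c\}=(ab)c+a(bc)-b(ca)$ and its Jordan pair is $(J,J)$. For $x$ in $T$ or $J$, $x_\pm$ denotes its copy in the $\pm$ component; $2$ means $2\cdot 1\in J$. Construction of $\widehat{\mathrm{TKK}}(P)$. For $a\in P_-$, $b\in P_+$ put $\nu(a,b)=(V_{a,b},-V_{b,a})\in\mathfrak{gl}(P_-)\oplus\mathfrak{gl}(P_+)$.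 Such operators $X$ act on $P_-\otimes P_+$ by $X(a\otimes b)=Xa\otimes b+a\otimes Xb$. Let $\lambda(a\otimes b)=\nu(a,b)$ extended linearly, $A(P_-\otimes P_+)=\mathrm{span}\{\lambda(m)m:m\in P_-\otimes P_+\}$, and $\langle P_-,P_+\rangle=(P_-\otimes P_+)/A(P_-\otimes P_+)$ with $\langle a,b\rangle$ the coset of $a\otimes b$. It is a Lie algebra under $[\langle a,b\rangle,\langle c,d\rangle]=\langle\{a,b,c\},d\rangle-\langle c,\{b,a,d\}\rangle$, and acts on $P_\pm$ by $\langle a,b\rangle c=\{a,b,c\}$ ($c\in P_-$), $\langle a,b\rangle d=-\{b,a,d\}$ ($d\in P_+$). $\widehat{\mathrm{TKK}}(P)=P_-\oplus\langle P_-,P_+\rangle\oplus P_+$ (degrees $-1,0,1$) is the $3$-graded Lie algebra with bracket $[a+X+b,c+Y+d]=(Xc-Ya)+([X,Y]+\langle a,d\rangle-\langle c,b\rangle)+(Xd-Yb)$. A $3$-graded Lie algebra is $L=L_{-1}\oplus L_0\oplus L_1$ with $[L_i,L_j]\subseteq L_{i+j}$ ($L_i=0$ for $|i|>1$). The pair $(L_{-1},L_1)$ is a Jordan pair with $\{a,b,c\}_\sigma=[[a,b],c]$. A graded homomorphism $\alpha:L\to K$ satisfies $\alpha(L_i)\subseteq K_i$, and $\alpha_i=\alpha|_{L_i}$. An anti-graded involution of $L$ is a Lie homomorphism $\varepsilon:L\to L$ with $\varepsilon^2=\mathrm{id}$, $\varepsilon(L_i)\subseteq L_{-i}$; a graded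 homomorphism $\alpha:(L,\varepsilon_L)\to(K,\varepsilon_K)$ is involutary if $\alpha\varepsilon_L=\varepsilon_K\alpha$. $\mathcal F_{\mathcal T}(L,\varepsilon)$ is the Jordan triple system $L_1$ with $\{a,b,c\}=[[a,\varepsilon(b)],c]$. The canonical anti-graded involution of $\widehat{\mathrm{TKK}}((T,T))$ is $\widehat\kappa(a_-+\langle c,d\rangle+b_+)=b_--\langle d,c\rangle+a_+$. An $\mathfrak{sl}_2$-triple is an ordered triple $\langle h,e,f\rangle$ with $[e,f]=h$, $[h,e]=2e$, $[h,f]=-2f$. An $\mathrm{A}_1$-graded Lie algebra is a pair $(L,\mathfrak s)$, $\mathfrak s=\langle h,e,f\rangle$ an $\mathfrak{sl}_2$-triple in $L$, with $L=L_{-1}\oplus L_0\oplus L_1$ for $L_i=\{x:[h,x]=2ix\}$ and $L_0=[L_{-1},L_1]$; it is $3$-graded by the $L_i$. An $\mathrm{A}_1$-graded morphism is a Lie homomorphism sending $\mathfrak{sl}_2$-triple to $\mathfrak{sl}_2$-triple elementwise. $\mathcal F_{\mathcal{JA}}(L,\mathfrak s)$ is the unital Jordan algebra $L_1$ with product $ab=[[a,f],b]$ and identity $\tfrac12e$. $\widehat{\mathrm{TKK}}((J,J))$ is $\mathrm{A}_1$-graded with $\widehat{\mathfrak s}=\langle-\langle1,2\rangle,2_+,1_-\rangle$. *)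

theory Defs
  imports "HOL-Algebra.Module" "HOL-Algebra.AbelCoset"
begin

section \<open>Linear and multilinear maps\<close>

definition module_hom ::
    "('k, 'r) ring_scheme \<Rightarrow> ('k, 'm, 'x) module_scheme \<Rightarrow> ('k, 'n, 'y) module_scheme \<Rightarrow> ('m \<Rightarrow> 'n) set" where
  "module_hom R M N = {f \<in> carrier M \<rightarrow> carrier N.
     (\<forall>x\<in>carrier M. \<forall>y\<in>carrier M. f (x \<oplus>\<^bsub>M\<^esub> y) = f x \<oplus>\<^bsub>N\<^esub> f y) \<and>
     (\<forall>r\<in>carrier R. \<forall>x\<in>carrier M. f (r \<odot>\<^bsub>M\<^esub> x) = r \<odot>\<^bsub>N\<^esub> f x)}"

definition bilinear_map ::
    "('k, 'r) ring_scheme \<Rightarrow> ('k, 'm, 'x) module_scheme \<Rightarrow> ('k, 'n, 'y) module_scheme \<Rightarrow>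
     ('k, 'q, 'z) module_scheme \<Rightarrow> ('m \<Rightarrow> 'n \<Rightarrow> 'q) \<Rightarrow> bool" where
  "bilinear_map R M N Q B \<longleftrightarrow>
     (\<forall>x\<in>carrier M. (\<lambda>y. B x y) \<in> module_hom R N Q) \<and>
     (\<forall>y\<in>carrier N. (\<lambda>x. B x y) \<in> module_hom R M Q)"

definition trilinear_map ::
    "('k, 'r) ring_scheme \<Rightarrow> ('k, 'm, 'x) module_scheme \<Rightarrow> ('k, 'n, 'y) module_scheme \<Rightarrow>
     ('k, 'o, 'w) module_scheme \<Rightarrow> ('k, 'q, 'z) module_scheme \<Rightarrow> ('m \<Rightarrow> 'n \<Rightarrow> 'o \<Rightarrow> 'q) \<Rightarrow> bool" where
  "trilinear_map R M N K Q t \<longleftrightarrow>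
     (\<forall>x\<in>carrier M. \<forall>y\<in>carrier N. (\<lambda>z. t x y z) \<in> module_hom R K Q) \<and>
     (\<forall>x\<in>carrier M. \<forall>z\<in>carrier K. (\<lambda>y. t x y z) \<in> module_hom R N Q) \<and>
     (\<forall>y\<in>carrier N. \<forall>z\<in>carrier K. (\<lambda>x. t x y z) \<in> module_hom R M Q)"


section \<open>Constructions with modules\<close>

text \<open>
  The type of module records extends that of ring records; the multiplicative fields carry no
  meaning for a mere module and are left unspecified in the constructions below.
\<close>

definition restrict_module :: "('k, 'm, 'x) module_scheme \<Rightarrow> 'm set \<Rightarrow> ('k, 'm) module" where
  "restrict_module M S = module.truncate (M\<lparr>carrier := S\<rparr>)"

definition module_span ::
    "('k, 'r) ring_scheme \<Rightarrow> ('k, 'm, 'x) module_scheme \<Rightarrow> 'm set \<Rightarrow> 'm set" where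
  "module_span R M S = \<Inter>{N. submodule N R M \<and> S \<subseteq> N}"

definition quotient_module :: "('k, 'm, 'x) module_scheme \<Rightarrow> 'm set \<Rightarrow> ('k, 'm set) module" where
  "quotient_module M N =
     \<lparr>carrier = a_rcosets\<^bsub>M\<^esub> N, mult = undefined, one = undefined,
      zero = N, add = set_add M,
      smult = (\<lambda>r C. \<Union>x\<in>C. N +>\<^bsub>M\<^esub> (r \<odot>\<^bsub>M\<^esub> x))\<rparr>"

text \<open>
  Maps on a quotient are defined through a representative of each coset; wherever this is used
  for a Jordan pair, the result does not depend on the choice.
\<close>

definition coset_rep :: "'m set \<Rightarrow> 'm" where
  "coset_rep C = (SOME x. x \<in> C)"

definition direct_sum_module ::
    "('k, 'm, 'x) module_scheme \<Rightarrow> ('k, 'n, 'y) module_scheme \<Rightarrow> ('k, 'm \<times> 'n) module" where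
  "direct_sum_module M N =
     \<lparr>carrier = carrier M \<times> carrier N, mult = undefined, one = undefined,
      zero = (\<zero>\<^bsub>M\<^esub>, \<zero>\<^bsub>N\<^esub>),
      add = (\<lambda>(a, b) (c, d). (a \<oplus>\<^bsub>M\<^esub> c, b \<oplus>\<^bsub>N\<^esub> d)),
      smult = (\<lambda>r (a, b). (r \<odot>\<^bsub>M\<^esub> a, r \<odot>\<^bsub>N\<^esub> b))\<rparr>"

definition gl_module ::
    "('k, 'r) ring_scheme \<Rightarrow> ('k, 'm, 'x) module_scheme \<Rightarrow> ('k, 'm \<Rightarrow> 'm) module" where
  "gl_module R M =
     \<lparr>carrier = module_hom R M M \<inter> extensional (carrier M), mult = undefined, one = undefined,
      zero = (\<lambda>x\<in>carrier M. \<zero>\<^bsub>M\<^esub>),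
      add = (\<lambda>f g. \<lambda>x\<in>carrier M. f x \<oplus>\<^bsub>M\<^esub> g x),
      smult = (\<lambda>r f. \<lambda>x\<in>carrier M. r \<odot>\<^bsub>M\<^esub> f x)\<rparr>"

definition free_module :: "('k, 'r) ring_scheme \<Rightarrow> 'b set \<Rightarrow> ('k, 'b \<Rightarrow> 'k) module" where
  "free_module R B =
     \<lparr>carrier = {u \<in> B \<rightarrow>\<^sub>E carrier R. finite {p \<in> B. u p \<noteq> \<zero>\<^bsub>R\<^esub>}},
      mult = undefined, one = undefined,
      zero = (\<lambda>p\<in>B. \<zero>\<^bsub>R\<^esub>),
      add = (\<lambda>u v. \<lambda>p\<in>B. u p \<oplus>\<^bsub>R\<^esub> v p),
      smult = (\<lambda>r u. \<lambda>p\<in>B. r \<otimes>\<^bsub>R\<^esub> u p)\<rparr>"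

definition free_gen :: "('k, 'r) ring_scheme \<Rightarrow> 'b set \<Rightarrow> 'b \<Rightarrow> 'b \<Rightarrow> 'k" where
  "free_gen R B p = (\<lambda>q\<in>B. if q = p then \<one>\<^bsub>R\<^esub> else \<zero>\<^bsub>R\<^esub>)"


section \<open>Tensor products\<close>

text \<open>
  The tensor product is the free module on pairs modulo the bilinearity relations; its elements
  are therefore cosets of finitely supported functions.
\<close>

definition tensor_free ::
    "('k, 'r) ring_scheme \<Rightarrow> ('k, 'm, 'x) module_scheme \<Rightarrow> ('k, 'n, 'y) module_scheme \<Rightarrow>
     ('k, 'm \<times> 'n \<Rightarrow> 'k) module" where
  "tensor_free R M N = free_module R (carrier M \<times> carrier N)"

definition tensor_rels ::
    "('k, 'r) ring_scheme \<Rightarrow> ('k, 'm, 'x) module_scheme \<Rightarrow> ('k, 'n, 'y) module_scheme \<Rightarrow>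
     ('m \<times> 'n \<Rightarrow> 'k) set" where
  "tensor_rels R M N =
     (let F = tensor_free R M N; g = free_gen R (carrier M \<times> carrier N) in
       {g (x \<oplus>\<^bsub>M\<^esub> x', y) \<ominus>\<^bsub>F\<^esub> (g (x, y) \<oplus>\<^bsub>F\<^esub> g (x', y)) | x x' y.
          x \<in> carrier M \<and> x' \<in> carrier M \<and> y \<in> carrier N} \<union>
       {g (x, y \<oplus>\<^bsub>N\<^esub> y') \<ominus>\<^bsub>F\<^esub> (g (x, y) \<oplus>\<^bsub>F\<^esub> g (x, y')) | x y y'.
          x \<in> carrier M \<and> y \<in> carrier N \<and> y' \<in> carrier N} \<union>
       {g (r \<odot>\<^bsub>M\<^esub> x, y) \<ominus>\<^bsub>F\<^esub> r \<odot>\<^bsub>F\<^esub> g (x, y) | r x y.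
          r \<in> carrier R \<and> x \<in> carrier M \<and> y \<in> carrier N} \<union>
       {g (x, r \<odot>\<^bsub>N\<^esub> y) \<ominus>\<^bsub>F\<^esub> r \<odot>\<^bsub>F\<^esub> g (x, y) | r x y.
          r \<in> carrier R \<and> x \<in> carrier M \<and> y \<in> carrier N})"

definition tensor_null ::
    "('k, 'r) ring_scheme \<Rightarrow> ('k, 'm, 'x) module_scheme \<Rightarrow> ('k, 'n, 'y) module_scheme \<Rightarrow>
     ('m \<times> 'n \<Rightarrow> 'k) set" where
  "tensor_null R M N = module_span R (tensor_free R M N) (tensor_rels R M N)"

definition tensor_product ::
    "('k, 'r) ring_scheme \<Rightarrow> ('k, 'm, 'x) module_scheme \<Rightarrow> ('k, 'n, 'y) module_scheme \<Rightarrow>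
     ('k, ('m \<times> 'n \<Rightarrow> 'k) set) module" where
  "tensor_product R M N = quotient_module (tensor_free R M N) (tensor_null R M N)"

definition pure_tensor ::
    "('k, 'r) ring_scheme \<Rightarrow> ('k, 'm, 'x) module_scheme \<Rightarrow> ('k, 'n, 'y) module_scheme \<Rightarrow>
     'm \<Rightarrow> 'n \<Rightarrow> ('m \<times> 'n \<Rightarrow> 'k) set" where
  "pure_tensor R M N x y =
     tensor_null R M N +>\<^bsub>tensor_free R M N\<^esub> free_gen R (carrier M \<times> carrier N) (x, y)"

text \<open>
  The linear extension of a bilinear map \<^term>\<open>B\<close> with values in \<^term>\<open>Q\<close>: the finite
  combination of values of \<^term>\<open>B\<close> given by a representing finitely supported function.
\<close>

definition tensor_lift ::
    "('k, 'r) ring_scheme \<Rightarrow> ('k, 'm, 'x) module_scheme \<Rightarrow> ('k, 'n, 'y) module_scheme \<Rightarrow>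
     ('k, 'q, 'z) module_scheme \<Rightarrow> ('m \<Rightarrow> 'n \<Rightarrow> 'q) \<Rightarrow> ('m \<times> 'n \<Rightarrow> 'k) set \<Rightarrow> 'q" where
  "tensor_lift R M N Q B t =
     (let u = coset_rep t in
       \<Oplus>\<^bsub>Q\<^esub>p\<in>{p \<in> carrier M \<times> carrier N. u p \<noteq> \<zero>\<^bsub>R\<^esub>}. u p \<odot>\<^bsub>Q\<^esub> B (fst p) (snd p))"


section \<open>Jordan pairs, triple systems and algebras\<close>

record ('k, 'm, 'p) jordan_pair =
  neg :: "('k, 'm) module"
  pos :: "('k, 'p) module"
  tri_neg :: "'m \<Rightarrow> 'p \<Rightarrow> 'm \<Rightarrow> 'm"
  tri_pos :: "'p \<Rightarrow> 'm \<Rightarrow> 'p \<Rightarrow> 'p"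

text \<open>
  The axioms for one sign: \<^term>\<open>t\<close> is the product on \<^term>\<open>M\<close> and \<^term>\<open>t'\<close> the one on \<^term>\<open>N\<close>.
  The last clause is the commutator identity for the operators $V$, evaluated at \<^term>\<open>x\<close>.
\<close>

definition jordan_axioms ::
    "('k, 'r) ring_scheme \<Rightarrow> ('k, 'm, 'x) module_scheme \<Rightarrow> ('k, 'n, 'y) module_scheme \<Rightarrow>
     ('m \<Rightarrow> 'n \<Rightarrow> 'm \<Rightarrow> 'm) \<Rightarrow> ('n \<Rightarrow> 'm \<Rightarrow> 'n \<Rightarrow> 'n) \<Rightarrow> bool" where
  "jordan_axioms R M N t t' \<longleftrightarrow>
     trilinear_map R M N M M t \<and>
     (\<forall>a\<in>carrier M. \<forall>b\<in>carrier N. \<forall>c\<in>carrier M. t a b c = t c b a) \<and>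
     (\<forall>a\<in>carrier M. \<forall>b\<in>carrier N. \<forall>c\<in>carrier M. \<forall>d\<in>carrier N. \<forall>x\<in>carrier M.
        t a b (t c d x) \<ominus>\<^bsub>M\<^esub> t c d (t a b x) = t (t a b c) d x \<ominus>\<^bsub>M\<^esub> t c (t' b a d) x)"

definition jordan_pair ::
    "('k, 'r) ring_scheme \<Rightarrow> ('k, 'm, 'p, 'x) jordan_pair_scheme \<Rightarrow> bool" where
  "jordan_pair R P \<longleftrightarrow> module R (neg P) \<and> module R (pos P) \<and>
     jordan_axioms R (neg P) (pos P) (tri_neg P) (tri_pos P) \<and>
     jordan_axioms R (pos P) (neg P) (tri_pos P) (tri_neg P)"

definition jordan_pair_hom ::
    "('k, 'r) ring_scheme \<Rightarrow> ('k, 'm, 'p, 'x) jordan_pair_scheme \<Rightarrow>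
     ('k, 'm2, 'p2, 'y) jordan_pair_scheme \<Rightarrow> (('m \<Rightarrow> 'm2) \<times> ('p \<Rightarrow> 'p2)) set" where
  "jordan_pair_hom R P Q = {(gm, gp).
     gm \<in> module_hom R (neg P) (neg Q) \<and> gp \<in> module_hom R (pos P) (pos Q) \<and>
     (\<forall>a\<in>carrier (neg P). \<forall>b\<in>carrier (pos P). \<forall>c\<in>carrier (neg P).
        gm (tri_neg P a b c) = tri_neg Q (gm a) (gp b) (gm c)) \<and>
     (\<forall>a\<in>carrier (pos P). \<forall>b\<in>carrier (neg P). \<forall>c\<in>carrier (pos P).
        gp (tri_pos P a b c) = tri_pos Q (gp a) (gm b) (gp c))}"

record ('k, 't) jordan_triple = "('k, 't) module" +
  triple :: "'t \<Rightarrow> 't \<Rightarrow> 't \<Rightarrow> 't"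

definition jordan_triple_system ::
    "('k, 'r) ring_scheme \<Rightarrow> ('k, 't, 'x) jordan_triple_scheme \<Rightarrow> bool" where
  "jordan_triple_system R T \<longleftrightarrow> module R T \<and> jordan_axioms R T T (triple T) (triple T)"

definition jordan_triple_hom ::
    "('k, 'r) ring_scheme \<Rightarrow> ('k, 's, 'x) jordan_triple_scheme \<Rightarrow>
     ('k, 't, 'y) jordan_triple_scheme \<Rightarrow> ('s \<Rightarrow> 't) set" where
  "jordan_triple_hom R S T = {g \<in> module_hom R S T.
     \<forall>a\<in>carrier S. \<forall>b\<in>carrier S. \<forall>c\<in>carrier S. g (triple S a b c) = triple T (g a) (g b) (g c)}"

definition pair_of_triple :: "('k, 't, 'x) jordan_triple_scheme \<Rightarrow> ('k, 't, 't) jordan_pair" where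
  "pair_of_triple T =
     \<lparr>neg = module.truncate T, pos = module.truncate T, tri_neg = triple T, tri_pos = triple T\<rparr>"

text \<open>
  The product and the identity of a Jordan algebra are the fields \<^const>\<open>mult\<close> and \<^const>\<open>one\<close>
  of a module record.
\<close>

definition unital_jordan_algebra ::
    "('k, 'r) ring_scheme \<Rightarrow> ('k, 'j, 'x) module_scheme \<Rightarrow> bool" where
  "unital_jordan_algebra R J \<longleftrightarrow> module R J \<and> bilinear_map R J J J (mult J) \<and>
     (\<forall>a\<in>carrier J. \<forall>b\<in>carrier J. a \<otimes>\<^bsub>J\<^esub> b = b \<otimes>\<^bsub>J\<^esub> a) \<and>
     (\<forall>a\<in>carrier J. \<forall>b\<in>carrier J.
        ((a \<otimes>\<^bsub>J\<^esub> a) \<otimes>\<^bsub>J\<^esub> b) \<otimes>\<^bsub>J\<^esub> a = (a \<otimes>\<^bsub>J\<^esub> a) \<otimes>\<^bsub>J\<^esub> (b \<otimes>\<^bsub>J\<^esub> a)) \<and>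
     \<one>\<^bsub>J\<^esub> \<in> carrier J \<and> (\<forall>a\<in>carrier J. \<one>\<^bsub>J\<^esub> \<otimes>\<^bsub>J\<^esub> a = a)"

definition unital_jordan_algebra_hom ::
    "('k, 'r) ring_scheme \<Rightarrow> ('k, 'i, 'x) module_scheme \<Rightarrow> ('k, 'j, 'y) module_scheme \<Rightarrow> ('i \<Rightarrow> 'j) set" where
  "unital_jordan_algebra_hom R I J = {g \<in> module_hom R I J.
     (\<forall>a\<in>carrier I. \<forall>b\<in>carrier I. g (a \<otimes>\<^bsub>I\<^esub> b) = g a \<otimes>\<^bsub>J\<^esub> g b) \<and> g \<one>\<^bsub>I\<^esub> = \<one>\<^bsub>J\<^esub>}"

definition triple_of_algebra :: "('k, 'j, 'x) module_scheme \<Rightarrow> ('k, 'j) jordan_triple" where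
  "triple_of_algebra J =
     \<lparr>carrier = carrier J, mult = mult J, one = one J, zero = zero J, add = add J, smult = smult J,
      triple = (\<lambda>a b c. ((a \<otimes>\<^bsub>J\<^esub> b) \<otimes>\<^bsub>J\<^esub> c \<oplus>\<^bsub>J\<^esub> a \<otimes>\<^bsub>J\<^esub> (b \<otimes>\<^bsub>J\<^esub> c)) \<ominus>\<^bsub>J\<^esub> b \<otimes>\<^bsub>J\<^esub> (c \<otimes>\<^bsub>J\<^esub> a))\<rparr>"

definition pair_of_algebra :: "('k, 'j, 'x) module_scheme \<Rightarrow> ('k, 'j, 'j) jordan_pair" where
  "pair_of_algebra J = pair_of_triple (triple_of_algebra J)"


section \<open>Graded Lie algebras\<close>

record ('k, 'l) lie_algebra = "('k, 'l) module" +
  lie_bracket :: "'l \<Rightarrow> 'l \<Rightarrow> 'l"  (\<open>\<lblot>_, _\<rblot>\<index>\<close>)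

definition lie_algebra ::
    "('k, 'r) ring_scheme \<Rightarrow> ('k, 'l, 'x) lie_algebra_scheme \<Rightarrow> bool" where
  "lie_algebra R L \<longleftrightarrow> module R L \<and> bilinear_map R L L L (lie_bracket L) \<and>
     (\<forall>x\<in>carrier L. \<lblot>x, x\<rblot>\<^bsub>L\<^esub> = \<zero>\<^bsub>L\<^esub>) \<and>
     (\<forall>x\<in>carrier L. \<forall>y\<in>carrier L. \<forall>z\<in>carrier L.
        \<lblot>x, \<lblot>y, z\<rblot>\<^bsub>L\<^esub>\<rblot>\<^bsub>L\<^esub> \<oplus>\<^bsub>L\<^esub> \<lblot>y, \<lblot>z, x\<rblot>\<^bsub>L\<^esub>\<rblot>\<^bsub>L\<^esub> \<oplus>\<^bsub>L\<^esub> \<lblot>z, \<lblot>x, y\<rblot>\<^bsub>L\<^esub>\<rblot>\<^bsub>L\<^esub> = \<zero>\<^bsub>L\<^esub>)"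

definition lie_hom ::
    "('k, 'r) ring_scheme \<Rightarrow> ('k, 'l, 'x) lie_algebra_scheme \<Rightarrow> ('k, 'n, 'y) lie_algebra_scheme \<Rightarrow>
     ('l \<Rightarrow> 'n) set" where
  "lie_hom R L K = {f \<in> module_hom R L K.
     \<forall>x\<in>carrier L. \<forall>y\<in>carrier L. f \<lblot>x, y\<rblot>\<^bsub>L\<^esub> = \<lblot>f x, f y\<rblot>\<^bsub>K\<^esub>}"

definition three_graded ::
    "('k, 'r) ring_scheme \<Rightarrow> ('k, 'l, 'x) lie_algebra_scheme \<Rightarrow> (int \<Rightarrow> 'l set) \<Rightarrow> bool" where
  "three_graded R L G \<longleftrightarrow> lie_algebra R L \<and>
     (\<forall>i. submodule (G i) R L) \<and>
     (\<forall>i. \<bar>i\<bar> > 1 \<longrightarrow> G i = {\<zero>\<^bsub>L\<^esub>}) \<and>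
     bij_betw (\<lambda>(a, x, b). a \<oplus>\<^bsub>L\<^esub> x \<oplus>\<^bsub>L\<^esub> b) (G (-1) \<times> G 0 \<times> G 1) (carrier L) \<and>
     (\<forall>i j. \<forall>x\<in>G i. \<forall>y\<in>G j. \<lblot>x, y\<rblot>\<^bsub>L\<^esub> \<in> G (i + j))"

definition graded_lie_hom ::
    "('k, 'r) ring_scheme \<Rightarrow> ('k, 'l, 'x) lie_algebra_scheme \<Rightarrow> (int \<Rightarrow> 'l set) \<Rightarrow>
     ('k, 'n, 'y) lie_algebra_scheme \<Rightarrow> (int \<Rightarrow> 'n set) \<Rightarrow> ('l \<Rightarrow> 'n) set" where
  "graded_lie_hom R L G K H = {f \<in> lie_hom R L K. \<forall>i. f ` G i \<subseteq> H i}"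

definition lie_jordan_pair ::
    "('k, 'l, 'x) lie_algebra_scheme \<Rightarrow> (int \<Rightarrow> 'l set) \<Rightarrow> ('k, 'l, 'l) jordan_pair" where
  "lie_jordan_pair L G =
     \<lparr>neg = restrict_module L (G (-1)), pos = restrict_module L (G 1),
      tri_neg = (\<lambda>a b c. \<lblot>\<lblot>a, b\<rblot>\<^bsub>L\<^esub>, c\<rblot>\<^bsub>L\<^esub>), tri_pos = (\<lambda>a b c. \<lblot>\<lblot>a, b\<rblot>\<^bsub>L\<^esub>, c\<rblot>\<^bsub>L\<^esub>)\<rparr>"

definition anti_graded_involution ::
    "('k, 'r) ring_scheme \<Rightarrow> ('k, 'l, 'x) lie_algebra_scheme \<Rightarrow> (int \<Rightarrow> 'l set) \<Rightarrow> ('l \<Rightarrow> 'l) \<Rightarrow> bool" where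
  "anti_graded_involution R L G \<epsilon> \<longleftrightarrow>
     \<epsilon> \<in> lie_hom R L L \<and> (\<forall>x\<in>carrier L. \<epsilon> (\<epsilon> x) = x) \<and> (\<forall>i. \<epsilon> ` G i \<subseteq> G (- i))"

definition involutary_hom ::
    "('k, 'r) ring_scheme \<Rightarrow> ('k, 'l, 'x) lie_algebra_scheme \<Rightarrow> (int \<Rightarrow> 'l set) \<Rightarrow> ('l \<Rightarrow> 'l) \<Rightarrow>
     ('k, 'n, 'y) lie_algebra_scheme \<Rightarrow> (int \<Rightarrow> 'n set) \<Rightarrow> ('n \<Rightarrow> 'n) \<Rightarrow> ('l \<Rightarrow> 'n) set" where
  "involutary_hom R L G \<epsilon> K H \<delta> =
     {f \<in> graded_lie_hom R L G K H. \<forall>x\<in>carrier L. f (\<epsilon> x) = \<delta> (f x)}"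

definition lie_triple ::
    "('k, 'l, 'x) lie_algebra_scheme \<Rightarrow> (int \<Rightarrow> 'l set) \<Rightarrow> ('l \<Rightarrow> 'l) \<Rightarrow> ('k, 'l) jordan_triple" where
  "lie_triple L G \<epsilon> =
     \<lparr>carrier = G 1, mult = undefined, one = undefined,
      zero = zero L, add = add L, smult = smult L,
      triple = (\<lambda>a b c. \<lblot>\<lblot>a, \<epsilon> b\<rblot>\<^bsub>L\<^esub>, c\<rblot>\<^bsub>L\<^esub>)\<rparr>"


section \<open>Lie algebras graded by the root system A1\<close>

type_synonym 'l sl2 = "'l \<times> 'l \<times> 'l"  \<comment> \<open>in the order $h$, $e$, $f$\<close>

definition sl2_triple :: "('k, 'l, 'x) lie_algebra_scheme \<Rightarrow> 'l sl2 \<Rightarrow> bool" where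
  "sl2_triple L = (\<lambda>(h, e, f). h \<in> carrier L \<and> e \<in> carrier L \<and> f \<in> carrier L \<and>
     \<lblot>e, f\<rblot>\<^bsub>L\<^esub> = h \<and> \<lblot>h, e\<rblot>\<^bsub>L\<^esub> = [(2::int)] \<cdot>\<^bsub>L\<^esub> e \<and> \<lblot>h, f\<rblot>\<^bsub>L\<^esub> = [(-2::int)] \<cdot>\<^bsub>L\<^esub> f)"

definition A1_grading :: "('k, 'l, 'x) lie_algebra_scheme \<Rightarrow> 'l sl2 \<Rightarrow> int \<Rightarrow> 'l set" where
  "A1_grading L = (\<lambda>(h, e, f) i.
     if \<bar>i\<bar> \<le> 1 then {x \<in> carrier L. \<lblot>h, x\<rblot>\<^bsub>L\<^esub> = [(2 * i)] \<cdot>\<^bsub>L\<^esub> x} else {\<zero>\<^bsub>L\<^esub>})"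

definition A1_graded ::
    "('k, 'r) ring_scheme \<Rightarrow> ('k, 'l, 'x) lie_algebra_scheme \<Rightarrow> 'l sl2 \<Rightarrow> bool" where
  "A1_graded R L s \<longleftrightarrow> sl2_triple L s \<and> three_graded R L (A1_grading L s) \<and>
     A1_grading L s 0 =
       module_span R L {\<lblot>x, y\<rblot>\<^bsub>L\<^esub> | x y. x \<in> A1_grading L s (-1) \<and> y \<in> A1_grading L s 1}"

definition A1_morphism ::
    "('k, 'r) ring_scheme \<Rightarrow> ('k, 'l, 'x) lie_algebra_scheme \<Rightarrow> 'l sl2 \<Rightarrow>
     ('k, 'n, 'y) lie_algebra_scheme \<Rightarrow> 'n sl2 \<Rightarrow> ('l \<Rightarrow> 'n) set" where
  "A1_morphism R L s K s' = {\<phi> \<in> lie_hom R L K.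
     (case s of (h, e, f) \<Rightarrow> (\<phi> h, \<phi> e, \<phi> f)) = s'}"

text \<open>
  An A1-graded Lie algebra has no 2-torsion (a 2-torsion element of one graded component lies in
  another one as well), so half of an element is unique whenever it exists.
\<close>

definition half :: "('k, 'l, 'x) module_scheme \<Rightarrow> 'l \<Rightarrow> 'l" where
  "half L x = (THE u. u \<in> carrier L \<and> u \<oplus>\<^bsub>L\<^esub> u = x)"

definition lie_jordan_algebra ::
    "('k, 'l, 'x) lie_algebra_scheme \<Rightarrow> 'l sl2 \<Rightarrow> ('k, 'l) module" where
  "lie_jordan_algebra L s = (case s of (h, e, f) \<Rightarrow>
     \<lparr>carrier = A1_grading L s 1, mult = (\<lambda>a b. \<lblot>\<lblot>a, f\<rblot>\<^bsub>L\<^esub>, b\<rblot>\<^bsub>L\<^esub>), one = half L e,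
      zero = zero L, add = add L, smult = smult L\<rparr>)"


section \<open>The universal Tits-Kantor-Koecher algebra of a Jordan pair\<close>

definition pair_tensor ::
    "('k, 'r) ring_scheme \<Rightarrow> ('k, 'm, 'p, 'x) jordan_pair_scheme \<Rightarrow> ('k, ('m \<times> 'p \<Rightarrow> 'k) set) module" where
  "pair_tensor R P = tensor_product R (neg P) (pos P)"

definition gl_pair ::
    "('k, 'r) ring_scheme \<Rightarrow> ('k, 'm, 'p, 'x) jordan_pair_scheme \<Rightarrow> ('k, ('m \<Rightarrow> 'm) \<times> ('p \<Rightarrow> 'p)) module" where
  "gl_pair R P = direct_sum_module (gl_module R (neg P)) (gl_module R (pos P))"

definition tkk_nu ::
    "('k, 'm, 'p, 'x) jordan_pair_scheme \<Rightarrow> 'm \<Rightarrow> 'p \<Rightarrow> ('m \<Rightarrow> 'm) \<times> ('p \<Rightarrow> 'p)" where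
  "tkk_nu P a b = (\<lambda>c\<in>carrier (neg P). tri_neg P a b c,
                   \<lambda>d\<in>carrier (pos P). \<ominus>\<^bsub>pos P\<^esub> tri_pos P b a d)"

definition tkk_lambda ::
    "('k, 'r) ring_scheme \<Rightarrow> ('k, 'm, 'p, 'x) jordan_pair_scheme \<Rightarrow>
     ('m \<times> 'p \<Rightarrow> 'k) set \<Rightarrow> ('m \<Rightarrow> 'm) \<times> ('p \<Rightarrow> 'p)" where
  "tkk_lambda R P = tensor_lift R (neg P) (pos P) (gl_pair R P) (tkk_nu P)"

definition tensor_act ::
    "('k, 'r) ring_scheme \<Rightarrow> ('k, 'm, 'p, 'x) jordan_pair_scheme \<Rightarrow> ('m \<Rightarrow> 'm) \<times> ('p \<Rightarrow> 'p) \<Rightarrow>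
     ('m \<times> 'p \<Rightarrow> 'k) set \<Rightarrow> ('m \<times> 'p \<Rightarrow> 'k) set" where
  "tensor_act R P X =
     tensor_lift R (neg P) (pos P) (pair_tensor R P)
       (\<lambda>a b. pure_tensor R (neg P) (pos P) (fst X a) b \<oplus>\<^bsub>pair_tensor R P\<^esub>
              pure_tensor R (neg P) (pos P) a (snd X b))"

definition tkk_A ::
    "('k, 'r) ring_scheme \<Rightarrow> ('k, 'm, 'p, 'x) jordan_pair_scheme \<Rightarrow> ('m \<times> 'p \<Rightarrow> 'k) set set" where
  "tkk_A R P = module_span R (pair_tensor R P)
     {tensor_act R P (tkk_lambda R P m) m | m. m \<in> carrier (pair_tensor R P)}"

definition tkk_zero_part ::
    "('k, 'r) ring_scheme \<Rightarrow> ('k, 'm, 'p, 'x) jordan_pair_scheme \<Rightarrow>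
     ('k, ('m \<times> 'p \<Rightarrow> 'k) set set) module" where
  "tkk_zero_part R P = quotient_module (pair_tensor R P) (tkk_A R P)"

definition tkk_angle ::
    "('k, 'r) ring_scheme \<Rightarrow> ('k, 'm, 'p, 'x) jordan_pair_scheme \<Rightarrow>
     'm \<Rightarrow> 'p \<Rightarrow> ('m \<times> 'p \<Rightarrow> 'k) set set" where
  "tkk_angle R P a b = tkk_A R P +>\<^bsub>pair_tensor R P\<^esub> pure_tensor R (neg P) (pos P) a b"

text \<open>
  The bracket of the cosets of $m$ and $n$ is the coset of $\lambda(m)n$. This is the bilinear
  extension of $[\langle a,b\rangle,\langle c,d\rangle] =
  \langle\{a,b,c\},d\rangle - \langle c,\{b,a,d\}\rangle$. Likewise the coset of $m$ acts on both
  modules of the pair by $\lambda(m)$.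
\<close>

definition tkk_zero_bracket ::
    "('k, 'r) ring_scheme \<Rightarrow> ('k, 'm, 'p, 'x) jordan_pair_scheme \<Rightarrow>
     ('m \<times> 'p \<Rightarrow> 'k) set set \<Rightarrow> ('m \<times> 'p \<Rightarrow> 'k) set set \<Rightarrow> ('m \<times> 'p \<Rightarrow> 'k) set set" where
  "tkk_zero_bracket R P X Y =
     tkk_A R P +>\<^bsub>pair_tensor R P\<^esub> tensor_act R P (tkk_lambda R P (coset_rep X)) (coset_rep Y)"

definition act_neg ::
    "('k, 'r) ring_scheme \<Rightarrow> ('k, 'm, 'p, 'x) jordan_pair_scheme \<Rightarrow>
     ('m \<times> 'p \<Rightarrow> 'k) set set \<Rightarrow> 'm \<Rightarrow> 'm" where
  "act_neg R P X = fst (tkk_lambda R P (coset_rep X))"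

definition act_pos ::
    "('k, 'r) ring_scheme \<Rightarrow> ('k, 'm, 'p, 'x) jordan_pair_scheme \<Rightarrow>
     ('m \<times> 'p \<Rightarrow> 'k) set set \<Rightarrow> 'p \<Rightarrow> 'p" where
  "act_pos R P X = snd (tkk_lambda R P (coset_rep X))"

type_synonym ('k, 'm, 'p) tkk = "'m \<times> ('m \<times> 'p \<Rightarrow> 'k) set set \<times> 'p"

definition TKK ::
    "('k, 'r) ring_scheme \<Rightarrow> ('k, 'm, 'p, 'x) jordan_pair_scheme \<Rightarrow>
     ('k, ('k, 'm, 'p) tkk) lie_algebra" where
  "TKK R P = (let Z = tkk_zero_part R P; D = direct_sum_module (neg P) (direct_sum_module Z (pos P)) in
     \<lparr>carrier = carrier D, mult = undefined, one = undefined,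
      zero = zero D, add = add D, smult = smult D,
      lie_bracket = (\<lambda>(a, X, b) (c, Y, d).
        (act_neg R P X c \<ominus>\<^bsub>neg P\<^esub> act_neg R P Y a,
         (tkk_zero_bracket R P X Y \<oplus>\<^bsub>Z\<^esub> tkk_angle R P a d) \<ominus>\<^bsub>Z\<^esub> tkk_angle R P c b,
         act_pos R P X d \<ominus>\<^bsub>pos P\<^esub> act_pos R P Y b))\<rparr>)"

definition in_neg ::
    "('k, 'r) ring_scheme \<Rightarrow> ('k, 'm, 'p, 'x) jordan_pair_scheme \<Rightarrow> 'm \<Rightarrow> ('k, 'm, 'p) tkk" where
  "in_neg R P a = (a, \<zero>\<^bsub>tkk_zero_part R P\<^esub>, \<zero>\<^bsub>pos P\<^esub>)"

definition in_zero ::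
    "('k, 'm, 'p, 'x) jordan_pair_scheme \<Rightarrow> ('m \<times> 'p \<Rightarrow> 'k) set set \<Rightarrow> ('k, 'm, 'p) tkk" where
  "in_zero P X = (\<zero>\<^bsub>neg P\<^esub>, X, \<zero>\<^bsub>pos P\<^esub>)"

definition in_pos ::
    "('k, 'r) ring_scheme \<Rightarrow> ('k, 'm, 'p, 'x) jordan_pair_scheme \<Rightarrow> 'p \<Rightarrow> ('k, 'm, 'p) tkk" where
  "in_pos R P b = (\<zero>\<^bsub>neg P\<^esub>, \<zero>\<^bsub>tkk_zero_part R P\<^esub>, b)"

definition TKK_grading ::
    "('k, 'r) ring_scheme \<Rightarrow> ('k, 'm, 'p, 'x) jordan_pair_scheme \<Rightarrow> int \<Rightarrow> ('k, 'm, 'p) tkk set" where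
  "TKK_grading R P i =
     (if i = -1 then in_neg R P ` carrier (neg P)
      else if i = 0 then in_zero P ` carrier (tkk_zero_part R P)
      else if i = 1 then in_pos R P ` carrier (pos P)
      else {\<zero>\<^bsub>TKK R P\<^esub>})"

definition TKK_involution ::
    "('k, 'r) ring_scheme \<Rightarrow> ('k, 't, 'x) jordan_triple_scheme \<Rightarrow> ('k, 't, 't) tkk \<Rightarrow> ('k, 't, 't) tkk" where
  "TKK_involution R T = (let P = pair_of_triple T; Z = tkk_zero_part R P in
     (\<lambda>(a, X, b). (b, tensor_lift R T T Z (\<lambda>c d. \<ominus>\<^bsub>Z\<^esub> tkk_angle R P d c) (coset_rep X), a)))"

definition TKK_sl2 ::
    "('k, 'r) ring_scheme \<Rightarrow> ('k, 'j, 'x) module_scheme \<Rightarrow> ('k, 'j, 'j) tkk sl2" where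
  "TKK_sl2 R J = (let P = pair_of_algebra J; two = \<one>\<^bsub>J\<^esub> \<oplus>\<^bsub>J\<^esub> \<one>\<^bsub>J\<^esub> in
     (\<ominus>\<^bsub>TKK R P\<^esub> in_zero P (tkk_angle R P \<one>\<^bsub>J\<^esub> two), in_pos R P two, in_neg R P \<one>\<^bsub>J\<^esub>))"

end

theory Submission
  imports Defs
begin

text \<open>
  Let $(\gamma_-,\gamma_+)$ be a homomorphism from $P$ to $(L_{-1},L_1)$. A homomorphism $g$ that
  extends it must send $\langle c,d\rangle = [c,d]$ to $[\gamma_-c,\gamma_+d]$, and these elements
  span the part of degree zero, so there is at most one. For existence let \<open>pairing\<close> be the
  linear map on $P_-\otimes P_+$ with $c\otimes d\mapsto[\gamma_-c,\gamma_+d]$. The homomorphism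
  property of $\gamma$ says that $\lambda(m)$ corresponds under $\gamma$ to the derivation
  $\mathrm{ad}(\mathrm{pairing}\,m)$ of $L$ (\<open>pairing_acts\<close>). Hence
  $\mathrm{pairing}(\lambda(m)n)=[\mathrm{pairing}\,m,\mathrm{pairing}\,n]$ (\<open>pairing_act\<close>).
  For $n=m$ the right side is zero, so \<open>pairing\<close> kills $A(P_-\otimes P_+)$ and descends to
  $\langle P_-,P_+\rangle$; for general $n$ the equation is compatibility with the bracket of degree
  zero. The remaining brackets are matched in the same way (\<open>extension_bracket\<close>).

  For a triple system, $a_-=\widehat\kappa(a_+)$ forces $\gamma_-=\varepsilon\gamma$, and
  $(\varepsilon\gamma,\gamma)$ is a homomorphism of Jordan pairs. That $\widehat\kappa$ is well
  defined on cosets holds because the flip $c\otimes d\mapsto-d\otimes c$ exchanges the two components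
  of $\lambda$ and so maps the generators $\lambda(m)m$ of $A$ to generators of the same kind
  (\<open>tensor_flip_A\<close>). The extension then commutes with the involutions since it does so on the
  elements $\langle c,d\rangle$.

  For a Jordan algebra, $b=\{1,b,1\}$ forces $\gamma_-(b)=[[f,\gamma b],f]$. That this $\gamma_-$ and
  $\gamma$ form a homomorphism of pairs is a computation with the $\mathfrak{sl}_2$-triple: in terms of
  the product $ab=[[a,f],b]$ of $L_1$ and of $a'=[[f,a],f]$ one has $[[a,f],b']=-(ab)'$
  (\<open>H_lower\<close>), and $[a,b']$ acts on $L_1$ through multiplications by $a$, $b$ and $ba$
  (\<open>bracket_lower\<close>). The first of these rests on \<open>F2_alternating\<close>, where a possible
  defect is annihilated by $e$ and therefore by $2$, and $L$ has no 2-torsion.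

  One point needs care. The bracket of TKK is computed from chosen representatives of cosets, and
  $\lambda$ vanishes on $A$ only because of the commutator identity. In $(J,J)$ this identity can fail
  if $J$ has 2-torsion. The uniqueness argument therefore works with the images in $L$: terms that
  come from the representative of the zero coset are brackets with zero there (\<open>g_angle\<close>),
  and the values of $\lambda(n)1$ for $n\in A$ are killed because the bilinear map
  $(m,n)\mapsto\lambda(\lambda(m)n)1$ becomes alternating in $L$, by the linearized Jordan identity
  (\<open>symmetrized_jordan\<close>, \<open>at_one_A\<close>, \<open>neg_from_one\<close>).
\<close>

section \<open>Linear maps\<close>

lemma (in abelian_group) minus_eq_zero_iff:
  "x \<in> carrier G \<Longrightarrow> y \<in> carrier G \<Longrightarrow> x \<ominus> y = \<zero> \<longleftrightarrow> x = y"
  by (metis a_inv_closed a_minus_def minus_equality minus_minus r_neg)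

lemma module_homI:
  assumes "\<And>x. x \<in> carrier M \<Longrightarrow> f x \<in> carrier N"
    and "\<And>x y. x \<in> carrier M \<Longrightarrow> y \<in> carrier M \<Longrightarrow> f (x \<oplus>\<^bsub>M\<^esub> y) = f x \<oplus>\<^bsub>N\<^esub> f y"
    and "\<And>r x. r \<in> carrier R \<Longrightarrow> x \<in> carrier M \<Longrightarrow> f (r \<odot>\<^bsub>M\<^esub> x) = r \<odot>\<^bsub>N\<^esub> f x"
  shows "f \<in> module_hom R M N"
  using assms by (auto simp: module_hom_def)

lemma module_hom_closed: "f \<in> module_hom R M N \<Longrightarrow> x \<in> carrier M \<Longrightarrow> f x \<in> carrier N"
  by (auto simp: module_hom_def)

lemma module_hom_add:
  "f \<in> module_hom R M N \<Longrightarrow> x \<in> carrier M \<Longrightarrow> y \<in> carrier M \<Longrightarrow> f (x \<oplus>\<^bsub>M\<^esub> y) = f x \<oplus>\<^bsub>N\<^esub> f y"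
  by (auto simp: module_hom_def)

lemma module_hom_smult:
  "f \<in> module_hom R M N \<Longrightarrow> r \<in> carrier R \<Longrightarrow> x \<in> carrier M \<Longrightarrow> f (r \<odot>\<^bsub>M\<^esub> x) = r \<odot>\<^bsub>N\<^esub> f x"
  by (auto simp: module_hom_def)

lemma module_hom_compose:
  "f \<in> module_hom R M N \<Longrightarrow> g \<in> module_hom R N K \<Longrightarrow> (\<lambda>x. g (f x)) \<in> module_hom R M K"
  by (auto simp: module_hom_def Pi_iff)

locale linear_map = M: module R M + N: module R N
  for R :: "('k, 'r) ring_scheme" and M :: "('k, 'm, 'x) module_scheme"
    and N :: "('k, 'n, 'y) module_scheme" +
  fixes f
  assumes linear: "f \<in> module_hom R M N"
begin

lemma closed [simp, intro]: "x \<in> carrier M \<Longrightarrow> f x \<in> carrier N"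
  by (rule module_hom_closed[OF linear])

lemma add [simp]: "x \<in> carrier M \<Longrightarrow> y \<in> carrier M \<Longrightarrow> f (x \<oplus>\<^bsub>M\<^esub> y) = f x \<oplus>\<^bsub>N\<^esub> f y"
  by (rule module_hom_add[OF linear])

lemma smult [simp]: "r \<in> carrier R \<Longrightarrow> x \<in> carrier M \<Longrightarrow> f (r \<odot>\<^bsub>M\<^esub> x) = r \<odot>\<^bsub>N\<^esub> f x"
  by (rule module_hom_smult[OF linear])

lemma zero [simp]: "f \<zero>\<^bsub>M\<^esub> = \<zero>\<^bsub>N\<^esub>"
  using smult[of "\<zero>\<^bsub>R\<^esub>" "\<zero>\<^bsub>M\<^esub>"] by simp

lemma neg [simp]: "x \<in> carrier M \<Longrightarrow> f (\<ominus>\<^bsub>M\<^esub> x) = \<ominus>\<^bsub>N\<^esub> f x"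
  by (metis M.M.add.inv_closed M.M.l_neg N.M.minus_equality add closed zero)

lemma minus [simp]: "x \<in> carrier M \<Longrightarrow> y \<in> carrier M \<Longrightarrow> f (x \<ominus>\<^bsub>M\<^esub> y) = f x \<ominus>\<^bsub>N\<^esub> f y"
  by (simp add: a_minus_def)

lemma finsum:
  "finite S \<Longrightarrow> h \<in> S \<rightarrow> carrier M \<Longrightarrow> f (\<Oplus>\<^bsub>M\<^esub>i\<in>S. h i) = (\<Oplus>\<^bsub>N\<^esub>i\<in>S. f (h i))"
proof (induction S rule: finite_induct)
  case (insert i S)
  then have "h \<in> S \<rightarrow> carrier M" "(\<lambda>i. f (h i)) \<in> S \<rightarrow> carrier N" by auto
  with insert show ?case by (simp add: Pi_iff)
qed simp

end

text \<open>
  For moving between records of different types that share the four fields of a module, such as an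
  algebra and its underlying truncated record.
\<close>

lemma module_cong:
  assumes "module R M" "carrier M' = carrier M" "zero M' = zero M" "add M' = add M" "smult M' = smult M"
  shows "module R M'"
proof -
  interpret module R M by fact
  have ag: "abelian_group M'"
  proof (rule abelian_groupI)
    fix x assume "x \<in> carrier M'"
    then have "\<ominus>\<^bsub>M\<^esub> x \<in> carrier M' \<and> \<ominus>\<^bsub>M\<^esub> x \<oplus>\<^bsub>M'\<^esub> x = \<zero>\<^bsub>M'\<^esub>" by (simp add: assms M.l_neg)
    then show "\<exists>y\<in>carrier M'. y \<oplus>\<^bsub>M'\<^esub> x = \<zero>\<^bsub>M'\<^esub>" by blast
  qed (auto simp: assms M.a_ac)
  show ?thesis
    by (rule moduleI) (auto simp: assms ag R.cring_axioms smult_l_distr smult_r_distr smult_assoc1)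
qed

section \<open>Quotient modules and spans\<close>

locale quotient = M: module R M
  for R :: "('k, 'r) ring_scheme" and M :: "('k, 'm, 'x) module_scheme" and N +
  assumes sub: "submodule N R M"
begin

abbreviation Q where "Q \<equiv> quotient_module M N"

sublocale abelian_subgroup N M
proof (rule abelian_subgroupI3)
  show "additive_subgroup N M"
    using sub by (simp add: additive_subgroup_def submodule_def)
qed (rule M.M.abelian_group_axioms)

lemma proj_eq_iff:
  assumes "x \<in> carrier M" "y \<in> carrier M"
  shows "N +>\<^bsub>M\<^esub> x = N +>\<^bsub>M\<^esub> y \<longleftrightarrow> x \<ominus>\<^bsub>M\<^esub> y \<in> N"
proof -
  have "N +>\<^bsub>M\<^esub> x = N +>\<^bsub>M\<^esub> y \<longleftrightarrow> x \<in> N +>\<^bsub>M\<^esub> y"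
    using a_rcos_self[OF assms(1)] a_repr_independence'[OF _ assms(2), of x] by auto
  then show ?thesis using a_rcos_module[OF assms(2,1)]
    by (simp add: a_minus_def)
qed

lemma quotient_carrier: "carrier Q = (\<lambda>x. N +>\<^bsub>M\<^esub> x) ` carrier M"
  by (auto simp: quotient_module_def A_RCOSETS_def')

lemma quotient_add:
  "x \<in> carrier M \<Longrightarrow> y \<in> carrier M \<Longrightarrow> (N +>\<^bsub>M\<^esub> x) \<oplus>\<^bsub>Q\<^esub> (N +>\<^bsub>M\<^esub> y) = N +>\<^bsub>M\<^esub> (x \<oplus>\<^bsub>M\<^esub> y)"
  by (simp add: quotient_module_def a_rcos_sum)

lemma quotient_zero: "\<zero>\<^bsub>Q\<^esub> = N"
  by (simp add: quotient_module_def)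

lemma N_as_coset: "N +>\<^bsub>M\<^esub> \<zero>\<^bsub>M\<^esub> = N"
  by (simp add: a_subset)

lemma quotient_smult:
  assumes "r \<in> carrier R" "x \<in> carrier M"
  shows "r \<odot>\<^bsub>Q\<^esub> (N +>\<^bsub>M\<^esub> x) = N +>\<^bsub>M\<^esub> (r \<odot>\<^bsub>M\<^esub> x)"
proof -
  have const: "N +>\<^bsub>M\<^esub> (r \<odot>\<^bsub>M\<^esub> y) = N +>\<^bsub>M\<^esub> (r \<odot>\<^bsub>M\<^esub> x)" if "y \<in> N +>\<^bsub>M\<^esub> x" for y
  proof -
    have y: "y \<in> carrier M" using that assms(2) a_elemrcos_carrier by blast
    then have "y \<ominus>\<^bsub>M\<^esub> x \<in> N"
      using that a_rcos_module[OF assms(2) y] by (simp add: a_minus_def)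
    then have "r \<odot>\<^bsub>M\<^esub> (y \<ominus>\<^bsub>M\<^esub> x) \<in> N" using sub assms by (simp add: submodule.smult_closed)
    then show ?thesis using y assms
      by (simp add: proj_eq_iff a_minus_def M.smult_r_distr M.smult_r_minus)
  qed
  have "N +>\<^bsub>M\<^esub> x \<noteq> {}" using a_rcos_self[OF assms(2)] by auto
  then have "(\<Union>y\<in>N +>\<^bsub>M\<^esub> x. N +>\<^bsub>M\<^esub> (r \<odot>\<^bsub>M\<^esub> y)) = N +>\<^bsub>M\<^esub> (r \<odot>\<^bsub>M\<^esub> x)"
    by (rule SUP_eq_const) (rule const)
  then show ?thesis by (simp add: quotient_module_def)
qed

lemma quotient_cases:
  assumes "X \<in> carrier Q"
  obtains x where "x \<in> carrier M" "X = N +>\<^bsub>M\<^esub> x"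
  using assms by (auto simp: quotient_carrier)

lemma proj_closed: "x \<in> carrier M \<Longrightarrow> N +>\<^bsub>M\<^esub> x \<in> carrier Q"
  by (simp add: quotient_carrier)

lemma abelian_group_quotient: "abelian_group Q"
proof (rule abelian_groupI)
  fix X Y assume "X \<in> carrier Q" "Y \<in> carrier Q"
  then obtain x y where *: "x \<in> carrier M" "X = N +>\<^bsub>M\<^esub> x" "y \<in> carrier M" "Y = N +>\<^bsub>M\<^esub> y"
    by (metis quotient_cases)
  then show "X \<oplus>\<^bsub>Q\<^esub> Y \<in> carrier Q" by (simp add: quotient_add proj_closed)
  from * show "X \<oplus>\<^bsub>Q\<^esub> Y = Y \<oplus>\<^bsub>Q\<^esub> X" by (simp only: quotient_add M.M.a_comm)
  fix Z assume "Z \<in> carrier Q"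
  then obtain z where "z \<in> carrier M" "Z = N +>\<^bsub>M\<^esub> z" by (rule quotient_cases)
  with * show "X \<oplus>\<^bsub>Q\<^esub> Y \<oplus>\<^bsub>Q\<^esub> Z = X \<oplus>\<^bsub>Q\<^esub> (Y \<oplus>\<^bsub>Q\<^esub> Z)"
    by (simp only: quotient_add M.M.a_assoc M.M.a_closed)
next
  fix X assume "X \<in> carrier Q"
  then obtain x where x: "x \<in> carrier M" "X = N +>\<^bsub>M\<^esub> x" by (rule quotient_cases)
  then have "(N +>\<^bsub>M\<^esub> (\<ominus>\<^bsub>M\<^esub> x)) \<oplus>\<^bsub>Q\<^esub> X = \<zero>\<^bsub>Q\<^esub>"
    by (simp only: quotient_add quotient_zero M.M.l_neg N_as_coset M.M.a_inv_closed)
  with x show "\<exists>Y\<in>carrier Q. Y \<oplus>\<^bsub>Q\<^esub> X = \<zero>\<^bsub>Q\<^esub>"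
    by (meson proj_closed M.M.a_inv_closed)
  from x show "\<zero>\<^bsub>Q\<^esub> \<oplus>\<^bsub>Q\<^esub> X = X"
    using quotient_add[of "\<zero>\<^bsub>M\<^esub>" x] by (simp only: quotient_zero N_as_coset M.M.l_zero M.M.zero_closed)
next
  show "\<zero>\<^bsub>Q\<^esub> \<in> carrier Q"
    using proj_closed[OF M.M.zero_closed] by (simp only: quotient_zero N_as_coset)
qed

lemma module_quotient: "module R Q"
proof (rule moduleI[OF M.R.cring_axioms abelian_group_quotient])
  fix a b X Y assume r: "a \<in> carrier R" "X \<in> carrier Q"
  then obtain x where x: "x \<in> carrier M" "X = N +>\<^bsub>M\<^esub> x" using quotient_cases by blast
  note s = quotient_add quotient_smult M.smult_closed M.R.a_closed
  from r x show "a \<odot>\<^bsub>Q\<^esub> X \<in> carrier Q" by (simp only: s proj_closed)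
  { assume "b \<in> carrier R"
    with r x show "(a \<oplus>\<^bsub>R\<^esub> b) \<odot>\<^bsub>Q\<^esub> X = a \<odot>\<^bsub>Q\<^esub> X \<oplus>\<^bsub>Q\<^esub> b \<odot>\<^bsub>Q\<^esub> X"
      by (simp only: s M.smult_l_distr) }
  { assume "b \<in> carrier R"
    with r x show "(a \<otimes>\<^bsub>R\<^esub> b) \<odot>\<^bsub>Q\<^esub> X = a \<odot>\<^bsub>Q\<^esub> (b \<odot>\<^bsub>Q\<^esub> X)"
      by (simp only: s M.smult_assoc1 M.R.m_closed) }
  assume "Y \<in> carrier Q"
  then obtain y where "y \<in> carrier M" "Y = N +>\<^bsub>M\<^esub> y" by (rule quotient_cases)
  with r x show "a \<odot>\<^bsub>Q\<^esub> (X \<oplus>\<^bsub>Q\<^esub> Y) = a \<odot>\<^bsub>Q\<^esub> X \<oplus>\<^bsub>Q\<^esub> a \<odot>\<^bsub>Q\<^esub> Y"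
    by (simp only: s M.smult_r_distr M.M.a_closed)
next
  fix X assume "X \<in> carrier Q"
  then obtain x where x: "x \<in> carrier M" "X = N +>\<^bsub>M\<^esub> x" by (rule quotient_cases)
  then show "\<one>\<^bsub>R\<^esub> \<odot>\<^bsub>Q\<^esub> X = X" by (simp only: quotient_smult M.R.one_closed M.smult_one)
qed

lemma proj_linear: "(\<lambda>x. N +>\<^bsub>M\<^esub> x) \<in> module_hom R M Q"
  by (rule module_homI) (simp_all only: proj_closed quotient_add quotient_smult)

lemma coset_rep:
  assumes "C \<in> carrier Q"
  shows "coset_rep C \<in> carrier M" "N +>\<^bsub>M\<^esub> coset_rep C = C"
proof -
  obtain x where x: "x \<in> carrier M" "C = N +>\<^bsub>M\<^esub> x" using assms by (auto simp: quotient_carrier)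
  then have "coset_rep C \<in> C" unfolding coset_rep_def using a_rcos_self[OF x(1)] by (intro someI) simp
  with x have rep: "coset_rep C \<in> N +>\<^bsub>M\<^esub> x" by simp
  show "coset_rep C \<in> carrier M" using a_elemrcos_carrier[OF x(1) rep] .
  show "N +>\<^bsub>M\<^esub> coset_rep C = C" using a_repr_independence'[OF rep x(1)] x(2) by simp
qed

lemma coset_rep_proj: "x \<in> carrier M \<Longrightarrow> coset_rep (N +>\<^bsub>M\<^esub> x) \<ominus>\<^bsub>M\<^esub> x \<in> N"
  using coset_rep[of "N +>\<^bsub>M\<^esub> x"] proj_eq_iff[of "coset_rep (N +>\<^bsub>M\<^esub> x)" x]
  by (simp add: proj_closed)

text \<open>
  Two representatives of a coset differ by an element of \<open>N\<close>, so the arbitrary choice made by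
  \<^const>\<open>coset_rep\<close> is harmless for maps that vanish on \<open>N\<close>.
\<close>

lemma quotient_lift:
  assumes "module R K" "h \<in> module_hom R M K" "\<And>x. x \<in> N \<Longrightarrow> h x = \<zero>\<^bsub>K\<^esub>"
  shows "x \<in> carrier M \<Longrightarrow> h (coset_rep (N +>\<^bsub>M\<^esub> x)) = h x"
    and "(\<lambda>C. h (coset_rep C)) \<in> module_hom R Q K"
proof -
  interpret h: linear_map R M K h
    using assms M.module_axioms by (simp add: linear_map_def linear_map_axioms_def)
  show eq: "h (coset_rep (N +>\<^bsub>M\<^esub> x)) = h x" if "x \<in> carrier M" for x
  proof -
    have c: "coset_rep (N +>\<^bsub>M\<^esub> x) \<in> carrier M" using that coset_rep by (simp add: quotient_carrier)
    then have "h (coset_rep (N +>\<^bsub>M\<^esub> x)) \<ominus>\<^bsub>K\<^esub> h x = \<zero>\<^bsub>K\<^esub>"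
      using assms(3)[OF coset_rep_proj[OF that]] that by simp
    then show ?thesis using that c by (simp add: h.N.M.minus_eq_zero_iff)
  qed
  show "(\<lambda>C. h (coset_rep C)) \<in> module_hom R Q K"
  proof (rule module_homI)
    fix X assume "X \<in> carrier Q"
    then obtain x where x: "x \<in> carrier M" "X = N +>\<^bsub>M\<^esub> x" by (rule quotient_cases)
    then show "h (coset_rep X) \<in> carrier K" by (simp only: eq h.closed)
    { fix r assume "r \<in> carrier R"
      with x show "h (coset_rep (r \<odot>\<^bsub>Q\<^esub> X)) = r \<odot>\<^bsub>K\<^esub> h (coset_rep X)"
        by (simp only: quotient_smult eq h.smult M.smult_closed) }
    fix Y assume "Y \<in> carrier Q"
    then obtain y where "y \<in> carrier M" "Y = N +>\<^bsub>M\<^esub> y" by (rule quotient_cases)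
    with x show "h (coset_rep (X \<oplus>\<^bsub>Q\<^esub> Y)) = h (coset_rep X) \<oplus>\<^bsub>K\<^esub> h (coset_rep Y)"
      by (simp only: quotient_add eq h.add M.M.a_closed)
  qed
qed

end

lemma submodule_module_span:
  assumes "module R M" "S \<subseteq> carrier M"
  shows "submodule (module_span R M S) R M"
proof -
  interpret module R M by fact
  have c: "carrier M \<in> {N. submodule N R M \<and> S \<subseteq> N}"
    using assms carrier_is_submodule by simp
  show ?thesis
    unfolding module_span_def
  proof (rule submoduleI)
    show "\<Inter>{N. submodule N R M \<and> S \<subseteq> N} \<subseteq> carrier M" using c by blast
  next
    show "\<zero>\<^bsub>M\<^esub> \<in> \<Inter>{N. submodule N R M \<and> S \<subseteq> N}"
      using subgroup.one_closed submodule.axioms(1) by fastforce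
  qed (auto dest: submoduleE)
qed

lemma module_span_superset: "S \<subseteq> module_span R M S"
  by (auto simp: module_span_def)

lemma module_span_minimal: "submodule N R M \<Longrightarrow> S \<subseteq> N \<Longrightarrow> module_span R M S \<subseteq> N"
  by (auto simp: module_span_def)

lemma (in linear_map) submodule_vimage:
  assumes "submodule N' R N"
  shows "submodule {x \<in> carrier M. f x \<in> N'} R M"
proof (rule M.submoduleI)
  show "\<zero>\<^bsub>M\<^esub> \<in> {x \<in> carrier M. f x \<in> N'}"
    using subgroup.one_closed[OF submodule.axioms(1)[OF assms]] by simp
qed (auto intro: N.submoduleE(3-5)[OF assms])

lemma (in linear_map) submodule_ker: "submodule {x \<in> carrier M. f x = \<zero>\<^bsub>N\<^esub>} R M"
  by (rule M.submoduleI) auto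

lemma (in linear_map) span_killed:
  assumes "S \<subseteq> carrier M" "\<And>x. x \<in> S \<Longrightarrow> f x = \<zero>\<^bsub>N\<^esub>" "x \<in> module_span R M S"
  shows "f x = \<zero>\<^bsub>N\<^esub>"
  using module_span_minimal[OF submodule_ker, of S] assms by blast

section \<open>Free modules\<close>

lemma (in cring) module_free_module: "module R (free_module R B)"
proof -
  have supp_add: "finite {p \<in> B. u p \<oplus> v p \<noteq> \<zero>}"
    if "finite {p \<in> B. u p \<noteq> \<zero>}" "finite {p \<in> B. v p \<noteq> \<zero>}" for u v
    by (rule finite_subset[OF _ finite_UnI[OF that]]) auto
  have supp_smult: "finite {p \<in> B. r \<otimes> u p \<noteq> \<zero>}"
    if "r \<in> carrier R" "finite {p \<in> B. u p \<noteq> \<zero>}" for r u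
    by (rule finite_subset[OF _ that(2)]) (use that(1) in auto)
  have supp_neg: "finite {p \<in> B. \<ominus> u p \<noteq> \<zero>}"
    if "finite {p \<in> B. u p \<noteq> \<zero>}" for u
    by (rule finite_subset[OF _ that]) auto
  show ?thesis
  proof (rule moduleI)
    show "abelian_group (free_module R B)"
    proof (rule abelian_groupI)
      fix u assume u: "u \<in> carrier (free_module R B)"
      then have "(\<lambda>p\<in>B. \<ominus> u p) \<in> carrier (free_module R B)"
        using supp_neg[of u] by (auto simp: free_module_def PiE_iff cong: conj_cong)
      moreover have "(\<lambda>p\<in>B. \<ominus> u p) \<oplus>\<^bsub>free_module R B\<^esub> u = \<zero>\<^bsub>free_module R B\<^esub>"
        using u by (auto simp: free_module_def l_neg PiE_iff intro!: restrict_ext)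
      ultimately show "\<exists>v\<in>carrier (free_module R B). v \<oplus>\<^bsub>free_module R B\<^esub> u = \<zero>\<^bsub>free_module R B\<^esub>"
        by blast
    qed (auto simp: free_module_def PiE_iff supp_add a_ac extensional_def fun_eq_iff cong: conj_cong)
  qed (auto simp: free_module_def PiE_iff supp_add supp_smult l_distr r_distr m_assoc is_cring
        extensional_def fun_eq_iff cong: conj_cong)
qed

lemma (in cring) free_gen_closed: "p \<in> B \<Longrightarrow> free_gen R B p \<in> carrier (free_module R B)"
  by (auto simp: free_module_def free_gen_def cong: conj_cong)

text \<open>Induction over a finite set that contains the support, splitting off one coefficient at a time.\<close>

lemma (in cring) free_module_induct [consumes 1, case_names zero gen add smult]:
  assumes "u \<in> carrier (free_module R B)"
    and zero: "P \<zero>\<^bsub>free_module R B\<^esub>"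
    and gen: "\<And>p. p \<in> B \<Longrightarrow> P (free_gen R B p)"
    and add: "\<And>u v. u \<in> carrier (free_module R B) \<Longrightarrow> v \<in> carrier (free_module R B) \<Longrightarrow>
                P u \<Longrightarrow> P v \<Longrightarrow> P (u \<oplus>\<^bsub>free_module R B\<^esub> v)"
    and smult: "\<And>r u. r \<in> carrier R \<Longrightarrow> u \<in> carrier (free_module R B) \<Longrightarrow>
                P u \<Longrightarrow> P (r \<odot>\<^bsub>free_module R B\<^esub> u)"
  shows "P u"
proof -
  let ?F = "free_module R B"
  interpret F: module R ?F by (rule module_free_module)
  have supported: "P u" if "finite S" "S \<subseteq> B" "u \<in> carrier ?F" "\<And>p. p \<in> B - S \<Longrightarrow> u p = \<zero>" for S u
    using that
  proof (induction S arbitrary: u rule: finite_induct)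
    case empty
    then have "u = \<zero>\<^bsub>?F\<^esub>" by (auto simp: free_module_def PiE_iff extensional_def fun_eq_iff)
    with zero show ?case by simp
  next
    case (insert q S)
    define v where "v = (\<lambda>p\<in>B. if p = q then \<zero> else u p)"
    have q: "q \<in> B" "u q \<in> carrier R" using insert.prems by (auto simp: free_module_def PiE_iff)
    have fin: "finite {p \<in> B. u p \<noteq> \<zero>}" using insert.prems by (simp add: free_module_def)
    have "finite {p \<in> B. v p \<noteq> \<zero>}"
      by (rule finite_subset[OF _ fin]) (auto simp: v_def)
    then have v: "v \<in> carrier ?F"
      using insert.prems by (auto simp: free_module_def PiE_iff v_def)
    have g: "u q \<odot>\<^bsub>?F\<^esub> free_gen R B q \<in> carrier ?F"
      by (intro F.smult_closed q free_gen_closed)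
    have split: "u = v \<oplus>\<^bsub>?F\<^esub> u q \<odot>\<^bsub>?F\<^esub> free_gen R B q"
      using insert.prems(2) q
      by (auto simp: free_module_def PiE_iff extensional_def fun_eq_iff v_def free_gen_def)
    have "P v"
    proof (rule insert.IH)
      show "v p = \<zero>" if "p \<in> B - S" for p
        using that insert.prems(3)[of p] by (auto simp: v_def)
      show "S \<subseteq> B" using insert.prems(1) by simp
      show "v \<in> carrier ?F" by (rule v)
    qed
    then have "P (v \<oplus>\<^bsub>?F\<^esub> u q \<odot>\<^bsub>?F\<^esub> free_gen R B q)"
      by (rule add[OF v g _ smult[OF q(2) free_gen_closed[OF q(1)] gen[OF q(1)]]])
    then show ?case by (simp only: split[symmetric])
  qed
  have "finite {p \<in> B. u p \<noteq> \<zero>}" using assms(1) by (simp add: free_module_def)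
  then show ?thesis by (rule supported) (use assms(1) in auto)
qed

text \<open>
  The linear extension of \<open>h\<close>, in the form in which \<^const>\<open>tensor_lift\<close> evaluates it at
  a representative.
\<close>

definition free_lift ::
    "('k, 'r) ring_scheme \<Rightarrow> 'b set \<Rightarrow> ('k, 'q, 'z) module_scheme \<Rightarrow> ('b \<Rightarrow> 'q) \<Rightarrow> ('b \<Rightarrow> 'k) \<Rightarrow> 'q" where
  "free_lift R B Q h u = (\<Oplus>\<^bsub>Q\<^esub>p\<in>{p \<in> B. u p \<noteq> \<zero>\<^bsub>R\<^esub>}. u p \<odot>\<^bsub>Q\<^esub> h p)"

text \<open>
  The supports of $u$, $v$ and $u+v$ differ; additivity of the extension is visible only after all
  sums are written over one common finite set.
\<close>

lemma (in module) free_lift_superset: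
  assumes "u \<in> carrier (free_module R B)" "h \<in> B \<rightarrow> carrier M"
    and "finite S" "S \<subseteq> B" "{p \<in> B. u p \<noteq> \<zero>} \<subseteq> S"
  shows "free_lift R B M h u = (\<Oplus>\<^bsub>M\<^esub>p\<in>S. u p \<odot>\<^bsub>M\<^esub> h p)"
  unfolding free_lift_def
proof (rule M.add.finprod_mono_neutral_cong_left)
  show "u i \<odot>\<^bsub>M\<^esub> h i = \<zero>\<^bsub>M\<^esub>" if "i \<in> S - {p \<in> B. u p \<noteq> \<zero>}" for i
  proof -
    have "i \<in> B" "u i = \<zero>" using that assms(4) by auto
    moreover have "h i \<in> carrier M" using \<open>i \<in> B\<close> assms(2) by auto
    ultimately show ?thesis by simp
  qed
  show "(\<lambda>p. u p \<odot>\<^bsub>M\<^esub> h p) \<in> S \<rightarrow> carrier M"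
    using assms by (force simp: free_module_def PiE_iff Pi_iff)
qed (use assms in auto)

lemma (in module) free_lift_gen:
  assumes "p \<in> B" "h \<in> B \<rightarrow> carrier M"
  shows "free_lift R B M h (free_gen R B p) = h p"
proof -
  have "h p \<in> carrier M" using assms by auto
  then have "free_lift R B M h (free_gen R B p) = (\<Oplus>\<^bsub>M\<^esub>q\<in>{p}. free_gen R B p q \<odot>\<^bsub>M\<^esub> h q)"
    using assms by (intro free_lift_superset R.free_gen_closed) (auto simp: free_gen_def)
  with \<open>h p \<in> carrier M\<close> show ?thesis using assms by (simp add: free_gen_def)
qed

lemma (in module) free_lift_linear:
  assumes h: "h \<in> B \<rightarrow> carrier M"
  shows "free_lift R B M h \<in> module_hom R (free_module R B) M"
proof (rule module_homI)
  interpret F: module R "free_module R B" by (rule R.module_free_module)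
  have supp: "finite {p \<in> B. u p \<noteq> \<zero>}" "\<And>p. p \<in> B \<Longrightarrow> u p \<in> carrier R"
    if "u \<in> carrier (free_module R B)" for u
    using that by (auto simp: free_module_def)
  have hc: "\<And>p. p \<in> B \<Longrightarrow> h p \<in> carrier M" using h by auto
  fix u assume u: "u \<in> carrier (free_module R B)"
  show "free_lift R B M h u \<in> carrier M"
    unfolding free_lift_def using supp[OF u] hc by (intro M.finsum_closed) auto
  { fix r assume r: "r \<in> carrier R"
    let ?S = "{p \<in> B. u p \<noteq> \<zero>}"
    have "free_lift R B M h (r \<odot>\<^bsub>free_module R B\<^esub> u) =
        (\<Oplus>\<^bsub>M\<^esub>p\<in>?S. (r \<odot>\<^bsub>free_module R B\<^esub> u) p \<odot>\<^bsub>M\<^esub> h p)"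
      using u r h by (intro free_lift_superset F.smult_closed) (auto simp: free_module_def)
    also have "\<dots> = (\<Oplus>\<^bsub>M\<^esub>p\<in>?S. r \<odot>\<^bsub>M\<^esub> (u p \<odot>\<^bsub>M\<^esub> h p))"
      using supp[OF u] r hc
      by (intro M.add.finprod_cong') (auto simp: free_module_def smult_assoc1)
    also have "\<dots> = r \<odot>\<^bsub>M\<^esub> free_lift R B M h u"
      unfolding free_lift_def using supp[OF u] r hc by (intro finsum_smult_ldistr[symmetric]) auto
    finally show "free_lift R B M h (r \<odot>\<^bsub>free_module R B\<^esub> u) = r \<odot>\<^bsub>M\<^esub> free_lift R B M h u" . }
  fix v assume v: "v \<in> carrier (free_module R B)"
  let ?S = "{p \<in> B. u p \<noteq> \<zero>} \<union> {p \<in> B. v p \<noteq> \<zero>}"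
  have "free_lift R B M h (u \<oplus>\<^bsub>free_module R B\<^esub> v) =
      (\<Oplus>\<^bsub>M\<^esub>p\<in>?S. (u \<oplus>\<^bsub>free_module R B\<^esub> v) p \<odot>\<^bsub>M\<^esub> h p)"
    using u v h by (intro free_lift_superset F.M.a_closed) (auto simp: free_module_def)
  also have "\<dots> = (\<Oplus>\<^bsub>M\<^esub>p\<in>?S. u p \<odot>\<^bsub>M\<^esub> h p \<oplus>\<^bsub>M\<^esub> v p \<odot>\<^bsub>M\<^esub> h p)"
    using supp[OF u] supp[OF v] hc
    by (intro M.add.finprod_cong') (auto simp: free_module_def smult_l_distr)
  also have "\<dots> = (\<Oplus>\<^bsub>M\<^esub>p\<in>?S. u p \<odot>\<^bsub>M\<^esub> h p) \<oplus>\<^bsub>M\<^esub> (\<Oplus>\<^bsub>M\<^esub>p\<in>?S. v p \<odot>\<^bsub>M\<^esub> h p)"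
    using supp[OF u] supp[OF v] hc by (intro M.finsum_addf) auto
  also have "\<dots> = free_lift R B M h u \<oplus>\<^bsub>M\<^esub> free_lift R B M h v"
    using u v h supp[OF u] supp[OF v] by (subst (1 2) free_lift_superset[where S = ?S]) auto
  finally show "free_lift R B M h (u \<oplus>\<^bsub>free_module R B\<^esub> v) =
      free_lift R B M h u \<oplus>\<^bsub>M\<^esub> free_lift R B M h v" .
qed

section \<open>Tensor products\<close>

lemma bilinear_mapI:
  assumes "\<And>x y. x \<in> carrier M \<Longrightarrow> y \<in> carrier N \<Longrightarrow> B x y \<in> carrier Q"
    and "\<And>x x' y. x \<in> carrier M \<Longrightarrow> x' \<in> carrier M \<Longrightarrow> y \<in> carrier N \<Longrightarrow>
           B (x \<oplus>\<^bsub>M\<^esub> x') y = B x y \<oplus>\<^bsub>Q\<^esub> B x' y"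
    and "\<And>x y y'. x \<in> carrier M \<Longrightarrow> y \<in> carrier N \<Longrightarrow> y' \<in> carrier N \<Longrightarrow>
           B x (y \<oplus>\<^bsub>N\<^esub> y') = B x y \<oplus>\<^bsub>Q\<^esub> B x y'"
    and "\<And>r x y. r \<in> carrier R \<Longrightarrow> x \<in> carrier M \<Longrightarrow> y \<in> carrier N \<Longrightarrow>
           B (r \<odot>\<^bsub>M\<^esub> x) y = r \<odot>\<^bsub>Q\<^esub> B x y"
    and "\<And>r x y. r \<in> carrier R \<Longrightarrow> x \<in> carrier M \<Longrightarrow> y \<in> carrier N \<Longrightarrow>
           B x (r \<odot>\<^bsub>N\<^esub> y) = r \<odot>\<^bsub>Q\<^esub> B x y"
  shows "bilinear_map R M N Q B"
  using assms by (auto simp: bilinear_map_def module_hom_def)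

lemma bilinear_mapD:
  assumes "bilinear_map R M N Q B"
  shows "x \<in> carrier M \<Longrightarrow> y \<in> carrier N \<Longrightarrow> B x y \<in> carrier Q"
    and "x \<in> carrier M \<Longrightarrow> x' \<in> carrier M \<Longrightarrow> y \<in> carrier N \<Longrightarrow>
           B (x \<oplus>\<^bsub>M\<^esub> x') y = B x y \<oplus>\<^bsub>Q\<^esub> B x' y"
    and "x \<in> carrier M \<Longrightarrow> y \<in> carrier N \<Longrightarrow> y' \<in> carrier N \<Longrightarrow>
           B x (y \<oplus>\<^bsub>N\<^esub> y') = B x y \<oplus>\<^bsub>Q\<^esub> B x y'"
    and "r \<in> carrier R \<Longrightarrow> x \<in> carrier M \<Longrightarrow> y \<in> carrier N \<Longrightarrow> B (r \<odot>\<^bsub>M\<^esub> x) y = r \<odot>\<^bsub>Q\<^esub> B x y"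
    and "r \<in> carrier R \<Longrightarrow> x \<in> carrier M \<Longrightarrow> y \<in> carrier N \<Longrightarrow> B x (r \<odot>\<^bsub>N\<^esub> y) = r \<odot>\<^bsub>Q\<^esub> B x y"
  using assms by (auto simp: bilinear_map_def module_hom_def)

locale tensor = M: module R M + N: module R N
  for R :: "('k, 'r) ring_scheme" and M :: "('k, 'm, 'x) module_scheme"
    and N :: "('k, 'n, 'y) module_scheme"
begin

abbreviation F where "F \<equiv> tensor_free R M N"
abbreviation gen where "gen \<equiv> free_gen R (carrier M \<times> carrier N)"
abbreviation T where "T \<equiv> tensor_product R M N"
abbreviation pure where "pure \<equiv> pure_tensor R M N"

sublocale F: module R F
  unfolding tensor_free_def by (rule M.R.module_free_module)

lemma gen_closed [simp]: "x \<in> carrier M \<Longrightarrow> y \<in> carrier N \<Longrightarrow> gen (x, y) \<in> carrier F"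
  unfolding tensor_free_def by (rule M.R.free_gen_closed) simp

lemma tensor_rels_closed: "tensor_rels R M N \<subseteq> carrier F"
  by (auto simp: tensor_rels_def Let_def simp del: F.M.minus_closed intro!: F.M.minus_closed)

sublocale null: quotient R F "tensor_null R M N"
  using submodule_module_span[OF F.module_axioms tensor_rels_closed]
  by (intro quotient.intro quotient_axioms.intro F.module_axioms) (simp add: tensor_null_def)

lemma rels_null:
  "x \<in> carrier M \<Longrightarrow> x' \<in> carrier M \<Longrightarrow> y \<in> carrier N \<Longrightarrow>
    gen (x \<oplus>\<^bsub>M\<^esub> x', y) \<ominus>\<^bsub>F\<^esub> (gen (x, y) \<oplus>\<^bsub>F\<^esub> gen (x', y)) \<in> tensor_null R M N"
  "x \<in> carrier M \<Longrightarrow> y \<in> carrier N \<Longrightarrow> y' \<in> carrier N \<Longrightarrow>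
    gen (x, y \<oplus>\<^bsub>N\<^esub> y') \<ominus>\<^bsub>F\<^esub> (gen (x, y) \<oplus>\<^bsub>F\<^esub> gen (x, y')) \<in> tensor_null R M N"
  "r \<in> carrier R \<Longrightarrow> x \<in> carrier M \<Longrightarrow> y \<in> carrier N \<Longrightarrow>
    gen (r \<odot>\<^bsub>M\<^esub> x, y) \<ominus>\<^bsub>F\<^esub> r \<odot>\<^bsub>F\<^esub> gen (x, y) \<in> tensor_null R M N"
  "r \<in> carrier R \<Longrightarrow> x \<in> carrier M \<Longrightarrow> y \<in> carrier N \<Longrightarrow>
    gen (x, r \<odot>\<^bsub>N\<^esub> y) \<ominus>\<^bsub>F\<^esub> r \<odot>\<^bsub>F\<^esub> gen (x, y) \<in> tensor_null R M N"
  unfolding tensor_null_def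
  by (rule subsetD[OF module_span_superset]; unfold tensor_rels_def Let_def; blast)+

sublocale T: module R T
  unfolding tensor_product_def by (rule null.module_quotient)

lemma pure_closed [simp]: "x \<in> carrier M \<Longrightarrow> y \<in> carrier N \<Longrightarrow> pure x y \<in> carrier T"
  unfolding tensor_product_def pure_tensor_def by (rule null.proj_closed) simp

lemma pure_bilinear: "bilinear_map R M N T pure"
  by (rule bilinear_mapI)
    (simp_all add: tensor_product_def[of R M N] pure_tensor_def null.quotient_add null.quotient_smult
      null.proj_closed null.proj_eq_iff rels_null)

lemmas pure_simps = bilinear_mapD(2-5)[OF pure_bilinear]

lemma tensor_induct [consumes 1, case_names zero pure add smult]:
  assumes "t \<in> carrier T"
    and zero: "P \<zero>\<^bsub>T\<^esub>"
    and pure: "\<And>x y. x \<in> carrier M \<Longrightarrow> y \<in> carrier N \<Longrightarrow> P (pure x y)"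
    and add: "\<And>s t. s \<in> carrier T \<Longrightarrow> t \<in> carrier T \<Longrightarrow> P s \<Longrightarrow> P t \<Longrightarrow> P (s \<oplus>\<^bsub>T\<^esub> t)"
    and smult: "\<And>r t. r \<in> carrier R \<Longrightarrow> t \<in> carrier T \<Longrightarrow> P t \<Longrightarrow> P (r \<odot>\<^bsub>T\<^esub> t)"
  shows "P t"
proof -
  let ?N = "tensor_null R M N"
  have "P (?N +>\<^bsub>F\<^esub> u)" if "u \<in> carrier F" for u
    using that unfolding tensor_free_def
  proof (induction u rule: M.R.free_module_induct)
    case zero
    have "?N +>\<^bsub>F\<^esub> \<zero>\<^bsub>F\<^esub> = \<zero>\<^bsub>T\<^esub>"
      by (simp only: tensor_product_def null.quotient_zero null.N_as_coset)
    then show ?case using assms(2) by (simp add: tensor_free_def)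
  next
    case (gen p)
    then show ?case
      using pure[of "fst p" "snd p"] by (auto simp: pure_tensor_def tensor_free_def)
  next
    case (add u v)
    then show ?case
      using assms(4)[of "?N +>\<^bsub>F\<^esub> u" "?N +>\<^bsub>F\<^esub> v"] null.quotient_add[of u v]
        null.proj_closed[of u] null.proj_closed[of v]
      by (simp add: tensor_product_def tensor_free_def)
  next
    case (smult r u)
    then show ?case
      using assms(5)[of r "?N +>\<^bsub>F\<^esub> u"] null.quotient_smult[of r u] null.proj_closed[of u]
      by (simp add: tensor_product_def tensor_free_def)
  qed
  with assms(1) show ?thesis
    unfolding tensor_product_def by (metis null.quotient_cases)
qed

text \<open>Pure tensors span, so two linear maps that agree on them are equal.\<close>

lemma tensor_hom_eqI:
  assumes "module R Q" "f \<in> module_hom R T Q" "g \<in> module_hom R T Q"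
    and "\<And>x y. x \<in> carrier M \<Longrightarrow> y \<in> carrier N \<Longrightarrow> f (pure x y) = g (pure x y)"
    and "t \<in> carrier T"
  shows "f t = g t"
proof -
  interpret f: linear_map R T Q f
    using assms(1,2) T.module_axioms by (simp add: linear_map_def linear_map_axioms_def)
  interpret g: linear_map R T Q g
    using assms(1,3) T.module_axioms by (simp add: linear_map_def linear_map_axioms_def)
  from assms(5) show ?thesis
    by (induction rule: tensor_induct) (simp_all add: assms(4))
qed

context
  fixes Q :: "('k, 'q, 'z) module_scheme" and B :: "'m \<Rightarrow> 'n \<Rightarrow> 'q"
  assumes Q: "module R Q" and B: "bilinear_map R M N Q B"
begin

interpretation Q: module R Q by (rule Q)

lemma tensor_lift_free:
  "tensor_lift R M N Q B t = free_lift R (carrier M \<times> carrier N) Q (\<lambda>p. B (fst p) (snd p)) (coset_rep t)"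
  by (simp add: tensor_lift_def free_lift_def Let_def)

lemma lift_values: "(\<lambda>p. B (fst p) (snd p)) \<in> carrier M \<times> carrier N \<rightarrow> carrier Q"
  using bilinear_mapD(1)[OF B] by auto

interpretation l: linear_map R F Q "free_lift R (carrier M \<times> carrier N) Q (\<lambda>p. B (fst p) (snd p))"
  using Q.free_lift_linear[OF lift_values]
  by unfold_locales (simp add: tensor_free_def)

lemma lift_gen:
  "x \<in> carrier M \<Longrightarrow> y \<in> carrier N \<Longrightarrow>
    free_lift R (carrier M \<times> carrier N) Q (\<lambda>p. B (fst p) (snd p)) (gen (x, y)) = B x y"
  by (simp add: Q.free_lift_gen[OF _ lift_values])

text \<open>
  The relations express exactly the bilinearity of \<open>B\<close>, so the linear extension of \<open>B\<close>
  vanishes on each of them.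
\<close>

lemma lift_null:
  assumes "v \<in> tensor_null R M N"
  shows "free_lift R (carrier M \<times> carrier N) Q (\<lambda>p. B (fst p) (snd p)) v = \<zero>\<^bsub>Q\<^esub>"
  using tensor_rels_closed _ assms[unfolded tensor_null_def]
proof (rule l.span_killed)
  fix v assume "v \<in> tensor_rels R M N"
  then show "free_lift R (carrier M \<times> carrier N) Q (\<lambda>p. B (fst p) (snd p)) v = \<zero>\<^bsub>Q\<^esub>"
    by (auto simp: tensor_rels_def Let_def lift_gen bilinear_mapD[OF B] Q.M.minus_eq_zero_iff)
qed

lemma tensor_lift_linear: "tensor_lift R M N Q B \<in> module_hom R T Q"
  unfolding tensor_lift_free tensor_product_def
  by (rule null.quotient_lift(2)[OF Q l.linear lift_null])

lemma tensor_lift_pure: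
  "x \<in> carrier M \<Longrightarrow> y \<in> carrier N \<Longrightarrow> tensor_lift R M N Q B (pure x y) = B x y"
  by (simp add: tensor_lift_free pure_tensor_def null.quotient_lift(1)[OF Q l.linear lift_null] lift_gen)

end

end

section \<open>Direct sums and modules of endomorphisms\<close>

lemma module_direct_sum:
  assumes "module R M" "module R N"
  shows "module R (direct_sum_module M N)"
proof -
  interpret M: module R M by fact
  interpret N: module R N by fact
  have "abelian_group (direct_sum_module M N)"
  proof (rule abelian_groupI)
    fix x assume "x \<in> carrier (direct_sum_module M N)"
    then show "\<exists>y\<in>carrier (direct_sum_module M N). y \<oplus>\<^bsub>direct_sum_module M N\<^esub> x = \<zero>\<^bsub>direct_sum_module M N\<^esub>"
      by (intro bexI[of _ "(\<ominus>\<^bsub>M\<^esub> fst x, \<ominus>\<^bsub>N\<^esub> snd x)"])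
        (auto simp: direct_sum_module_def M.M.l_neg N.M.l_neg)
  qed (auto simp: direct_sum_module_def M.M.a_ac N.M.a_ac)
  then show ?thesis
    by (intro moduleI M.R.cring_axioms)
      (auto simp: direct_sum_module_def M.smult_l_distr N.smult_l_distr M.smult_r_distr
        N.smult_r_distr M.smult_assoc1 N.smult_assoc1)
qed

lemma module_gl:
  assumes "module R M"
  shows "module R (gl_module R M)"
proof -
  interpret M: module R M by fact
  note hom = module_hom_def Pi_iff
  note ac = M.M.a_ac M.smult_r_distr M.M.minus_add
  have "abelian_group (gl_module R M)"
  proof (rule abelian_groupI)
    fix f assume f: "f \<in> carrier (gl_module R M)"
    then have "(\<lambda>x\<in>carrier M. \<ominus>\<^bsub>M\<^esub> f x) \<in> carrier (gl_module R M)"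
      by (auto simp: gl_module_def hom M.M.minus_add M.smult_r_minus M.M.a_comm)
    moreover have "(\<lambda>x\<in>carrier M. \<ominus>\<^bsub>M\<^esub> f x) \<oplus>\<^bsub>gl_module R M\<^esub> f = \<zero>\<^bsub>gl_module R M\<^esub>"
      using f by (auto simp: gl_module_def hom M.M.l_neg intro!: restrict_ext)
    ultimately show "\<exists>g\<in>carrier (gl_module R M). g \<oplus>\<^bsub>gl_module R M\<^esub> f = \<zero>\<^bsub>gl_module R M\<^esub>"
      by blast
  qed (auto simp: gl_module_def hom ac extensional_def fun_eq_iff)
  moreover have "r \<odot>\<^bsub>M\<^esub> (s \<odot>\<^bsub>M\<^esub> x) = s \<odot>\<^bsub>M\<^esub> (r \<odot>\<^bsub>M\<^esub> x)"
    if "r \<in> carrier R" "s \<in> carrier R" "x \<in> carrier M" for r s x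
    using that by (metis M.R.m_comm M.smult_assoc1)
  ultimately show ?thesis
    by (intro moduleI M.R.cring_axioms)
      (auto simp: gl_module_def hom M.smult_l_distr M.smult_r_distr M.smult_assoc1
        extensional_def fun_eq_iff)
qed

section \<open>The action on the tensor product and its quotient\<close>

lemma trilinear_mapD:
  assumes "trilinear_map R M N K Q t"
  shows "x \<in> carrier M \<Longrightarrow> y \<in> carrier N \<Longrightarrow> t x y \<in> module_hom R K Q"
    and "x \<in> carrier M \<Longrightarrow> z \<in> carrier K \<Longrightarrow> (\<lambda>y. t x y z) \<in> module_hom R N Q"
    and "y \<in> carrier N \<Longrightarrow> z \<in> carrier K \<Longrightarrow> (\<lambda>x. t x y z) \<in> module_hom R M Q"
  using assms by (auto simp: trilinear_map_def)

text \<open>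
  Two modules with trilinear products of the shape of a Jordan pair. Besides Jordan pairs this covers
  the pair $(J,J)$ of a unital Jordan algebra with 2-torsion, where the commutator identity can fail.
\<close>

locale trilinear_pair =
  fixes R :: "('k, 'r) ring_scheme" and P :: "('k, 'm, 'p, 'x) jordan_pair_scheme"
  assumes neg_module: "module R (neg P)" and pos_module: "module R (pos P)"
    and tri_neg: "trilinear_map R (neg P) (pos P) (neg P) (neg P) (tri_neg P)"
    and tri_pos: "trilinear_map R (pos P) (neg P) (pos P) (pos P) (tri_pos P)"
begin

sublocale tensor R "neg P" "pos P"
  by (intro tensor.intro neg_module pos_module)

abbreviation gl where "gl \<equiv> gl_pair R P"
abbreviation lam where "lam \<equiv> tkk_lambda R P"
abbreviation act where "act \<equiv> tensor_act R P"
abbreviation Z where "Z \<equiv> tkk_zero_part R P"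
abbreviation angle where "angle \<equiv> tkk_angle R P"

lemma pair_tensor_T: "pair_tensor R P = T"
  by (simp add: pair_tensor_def)

sublocale gl: module R gl
  unfolding gl_pair_def by (intro module_direct_sum module_gl neg_module pos_module)

lemma gl_carrier:
  "X \<in> carrier gl \<longleftrightarrow>
     fst X \<in> module_hom R (neg P) (neg P) \<inter> extensional (carrier (neg P)) \<and>
     snd X \<in> module_hom R (pos P) (pos P) \<inter> extensional (carrier (pos P))"
  by (cases X) (simp add: gl_pair_def direct_sum_module_def gl_module_def)

lemma gl_simps:
  "c \<in> carrier (neg P) \<Longrightarrow> fst (X \<oplus>\<^bsub>gl\<^esub> Y) c = fst X c \<oplus>\<^bsub>neg P\<^esub> fst Y c"
  "d \<in> carrier (pos P) \<Longrightarrow> snd (X \<oplus>\<^bsub>gl\<^esub> Y) d = snd X d \<oplus>\<^bsub>pos P\<^esub> snd Y d"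
  "c \<in> carrier (neg P) \<Longrightarrow> fst (r \<odot>\<^bsub>gl\<^esub> X) c = r \<odot>\<^bsub>neg P\<^esub> fst X c"
  "d \<in> carrier (pos P) \<Longrightarrow> snd (r \<odot>\<^bsub>gl\<^esub> X) d = r \<odot>\<^bsub>pos P\<^esub> snd X d"
  "c \<in> carrier (neg P) \<Longrightarrow> fst \<zero>\<^bsub>gl\<^esub> c = \<zero>\<^bsub>neg P\<^esub>"
  "d \<in> carrier (pos P) \<Longrightarrow> snd \<zero>\<^bsub>gl\<^esub> d = \<zero>\<^bsub>pos P\<^esub>"
  by (cases X; cases Y; simp add: gl_pair_def direct_sum_module_def gl_module_def)+

lemma gl_eqI:
  assumes "X \<in> carrier gl" "Y \<in> carrier gl"
    and "\<And>c. c \<in> carrier (neg P) \<Longrightarrow> fst X c = fst Y c"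
    and "\<And>d. d \<in> carrier (pos P) \<Longrightarrow> snd X d = snd Y d"
  shows "X = Y"
  using assms by (intro prod_eqI; auto simp: gl_carrier intro: extensionalityI)

lemma gl_linear:
  assumes "X \<in> carrier gl"
  shows "linear_map R (neg P) (neg P) (fst X)" "linear_map R (pos P) (pos P) (snd X)"
  using assms by (auto simp: gl_carrier linear_map_def linear_map_axioms_def neg_module pos_module)

lemma gl_closed [simp]:
  assumes "X \<in> carrier gl"
  shows "c \<in> carrier (neg P) \<Longrightarrow> fst X c \<in> carrier (neg P)"
    and "d \<in> carrier (pos P) \<Longrightarrow> snd X d \<in> carrier (pos P)"
  using gl_linear[OF assms] linear_map.closed by metis+

lemma tri_neg_hom:
  "b \<in> carrier (pos P) \<Longrightarrow> c \<in> carrier (neg P) \<Longrightarrow> linear_map R (neg P) (neg P) (\<lambda>a. tri_neg P a b c)"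
  "a \<in> carrier (neg P) \<Longrightarrow> c \<in> carrier (neg P) \<Longrightarrow> linear_map R (pos P) (neg P) (\<lambda>b. tri_neg P a b c)"
  "a \<in> carrier (neg P) \<Longrightarrow> b \<in> carrier (pos P) \<Longrightarrow> linear_map R (neg P) (neg P) (tri_neg P a b)"
  using trilinear_mapD[OF tri_neg]
  by (simp_all add: linear_map_def linear_map_axioms_def neg_module pos_module)

lemma tri_pos_hom:
  "a \<in> carrier (neg P) \<Longrightarrow> d \<in> carrier (pos P) \<Longrightarrow> linear_map R (pos P) (pos P) (\<lambda>b. tri_pos P b a d)"
  "b \<in> carrier (pos P) \<Longrightarrow> d \<in> carrier (pos P) \<Longrightarrow> linear_map R (neg P) (pos P) (\<lambda>a. tri_pos P b a d)"
  "b \<in> carrier (pos P) \<Longrightarrow> a \<in> carrier (neg P) \<Longrightarrow> linear_map R (pos P) (pos P) (tri_pos P b a)"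
  using trilinear_mapD[OF tri_pos]
  by (simp_all add: linear_map_def linear_map_axioms_def neg_module pos_module)

lemmas tri_closed [simp] = linear_map.closed[OF tri_neg_hom(3)] linear_map.closed[OF tri_pos_hom(3)]
lemmas tri_simps = tri_neg_hom[THEN linear_map.add] tri_neg_hom[THEN linear_map.smult]
  tri_pos_hom[THEN linear_map.add] tri_pos_hom[THEN linear_map.smult]

lemma nu_closed:
  assumes "a \<in> carrier (neg P)" "b \<in> carrier (pos P)"
  shows "tkk_nu P a b \<in> carrier gl"
  using assms
  by (auto simp: gl_carrier tkk_nu_def intro!: module_homI)
    (simp_all add: tri_simps N.M.minus_add N.smult_r_minus N.M.a_comm)

lemma nu_apply:
  "c \<in> carrier (neg P) \<Longrightarrow> fst (tkk_nu P a b) c = tri_neg P a b c"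
  "d \<in> carrier (pos P) \<Longrightarrow> snd (tkk_nu P a b) d = \<ominus>\<^bsub>pos P\<^esub> tri_pos P b a d"
  by (simp_all add: tkk_nu_def)

lemma nu_bilinear: "bilinear_map R (neg P) (pos P) gl (tkk_nu P)"
proof (rule bilinear_mapI)
  fix a b assume "a \<in> carrier (neg P)" "b \<in> carrier (pos P)"
  then show "tkk_nu P a b \<in> carrier gl" by (rule nu_closed)
qed (rule gl_eqI; simp add: nu_closed nu_apply gl_simps tri_simps N.M.minus_add
      N.smult_r_minus N.M.a_comm)+

lemma lam_linear: "linear_map R T gl lam"
  using tensor_lift_linear[OF gl.module_axioms nu_bilinear] T.module_axioms gl.module_axioms
  by (simp add: linear_map_def linear_map_axioms_def tkk_lambda_def)

sublocale lam: linear_map R T gl lam by (rule lam_linear)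

lemma lam_pure:
  assumes "a \<in> carrier (neg P)" "b \<in> carrier (pos P)"
  shows "c \<in> carrier (neg P) \<Longrightarrow> fst (lam (pure a b)) c = tri_neg P a b c"
    and "d \<in> carrier (pos P) \<Longrightarrow> snd (lam (pure a b)) d = \<ominus>\<^bsub>pos P\<^esub> tri_pos P b a d"
  using tensor_lift_pure[OF gl.module_axioms nu_bilinear assms]
  by (simp_all add: tkk_lambda_def nu_apply)

lemma act_bilinear:
  assumes "X \<in> carrier gl"
  shows "bilinear_map R (neg P) (pos P) T (\<lambda>a b. pure (fst X a) b \<oplus>\<^bsub>T\<^esub> pure a (snd X b))"
proof -
  interpret X1: linear_map R "neg P" "neg P" "fst X" by (rule gl_linear[OF assms])
  interpret X2: linear_map R "pos P" "pos P" "snd X" by (rule gl_linear[OF assms])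
  show ?thesis
    by (rule bilinear_mapI) (simp_all add: pure_simps T.M.a_ac T.smult_r_distr)
qed

lemma act_linear: "X \<in> carrier gl \<Longrightarrow> linear_map R T T (act X)"
  using tensor_lift_linear[OF T.module_axioms act_bilinear] T.module_axioms
  by (simp add: linear_map_def linear_map_axioms_def tensor_act_def pair_tensor_T)

lemma act_pure:
  "X \<in> carrier gl \<Longrightarrow> a \<in> carrier (neg P) \<Longrightarrow> b \<in> carrier (pos P) \<Longrightarrow>
    act X (pure a b) = pure (fst X a) b \<oplus>\<^bsub>T\<^esub> pure a (snd X b)"
  using tensor_lift_pure[OF T.module_axioms act_bilinear]
  by (simp add: tensor_act_def pair_tensor_T)

lemma act_closed [simp]: "X \<in> carrier gl \<Longrightarrow> t \<in> carrier T \<Longrightarrow> act X t \<in> carrier T"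
  by (rule linear_map.closed[OF act_linear])

text \<open>
  The operator $X$ is a parameter of the bilinear map that is lifted, so linearity in $X$ has to be
  read off from the values on pure tensors.
\<close>

lemma act_left_linear:
  assumes "n \<in> carrier T"
  shows "(\<lambda>X. act X n) \<in> module_hom R gl T"
proof (rule module_homI)
  fix X Y assume X: "X \<in> carrier gl" and Y: "Y \<in> carrier gl"
  show "act X n \<in> carrier T" using X assms by simp
  interpret X: linear_map R T T "act X" by (rule act_linear[OF X])
  interpret Y: linear_map R T T "act Y" by (rule act_linear[OF Y])
  interpret XY: linear_map R T T "act (X \<oplus>\<^bsub>gl\<^esub> Y)" using X Y by (intro act_linear) simp
  from assms show "act (X \<oplus>\<^bsub>gl\<^esub> Y) n = act X n \<oplus>\<^bsub>T\<^esub> act Y n"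
    by (induction rule: tensor_induct)
      (simp_all add: X Y act_pure gl_simps pure_simps T.M.a_ac T.smult_r_distr)
next
  fix r X assume r: "r \<in> carrier R" and X: "X \<in> carrier gl"
  interpret X: linear_map R T T "act X" by (rule act_linear[OF X])
  interpret rX: linear_map R T T "act (r \<odot>\<^bsub>gl\<^esub> X)" using r X by (intro act_linear) simp
  have comm: "r \<odot>\<^bsub>T\<^esub> (s \<odot>\<^bsub>T\<^esub> t) = s \<odot>\<^bsub>T\<^esub> (r \<odot>\<^bsub>T\<^esub> t)" if "s \<in> carrier R" "t \<in> carrier T" for s t
    using r that by (metis M.R.m_comm T.smult_assoc1)
  from assms show "act (r \<odot>\<^bsub>gl\<^esub> X) n = r \<odot>\<^bsub>T\<^esub> act X n"
    by (induction rule: tensor_induct)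
      (simp_all add: r X act_pure gl_simps pure_simps T.smult_r_distr comm)
qed

lemma A_gens_closed: "{act (lam m) m | m. m \<in> carrier T} \<subseteq> carrier T"
  by auto

sublocale A: quotient R T "tkk_A R P"
  using submodule_module_span[OF T.module_axioms A_gens_closed]
  by (intro quotient.intro quotient_axioms.intro T.module_axioms) (simp add: tkk_A_def pair_tensor_T)

sublocale Z: module R Z
  unfolding tkk_zero_part_def pair_tensor_T by (rule A.module_quotient)

lemma Z_quotient: "Z = quotient_module T (tkk_A R P)"
  by (simp add: tkk_zero_part_def pair_tensor_T)

abbreviation proj where "proj m \<equiv> tkk_A R P +>\<^bsub>T\<^esub> m"

lemma proj_Z [simp]: "m \<in> carrier T \<Longrightarrow> proj m \<in> carrier Z"
  unfolding Z_quotient by (rule A.proj_closed)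

lemma proj_hom: "linear_map R T Z proj"
  using A.proj_linear T.module_axioms Z.module_axioms
  by (simp add: linear_map_def linear_map_axioms_def Z_quotient)

lemma angle_proj: "angle a b = proj (pure a b)"
  by (simp add: tkk_angle_def pair_tensor_T)

lemma angle_closed [simp]:
  "a \<in> carrier (neg P) \<Longrightarrow> b \<in> carrier (pos P) \<Longrightarrow> angle a b \<in> carrier Z"
  by (simp add: angle_proj)

lemma pure_zero:
  "a \<in> carrier (neg P) \<Longrightarrow> pure a \<zero>\<^bsub>pos P\<^esub> = \<zero>\<^bsub>T\<^esub>"
  "b \<in> carrier (pos P) \<Longrightarrow> pure \<zero>\<^bsub>neg P\<^esub> b = \<zero>\<^bsub>T\<^esub>"
  using pure_simps(4)[of "\<zero>\<^bsub>R\<^esub>" a "\<zero>\<^bsub>pos P\<^esub>"] pure_simps(3)[of "\<zero>\<^bsub>R\<^esub>" "\<zero>\<^bsub>neg P\<^esub>" b]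
  by simp_all

lemma angle_zero:
  "a \<in> carrier (neg P) \<Longrightarrow> angle a \<zero>\<^bsub>pos P\<^esub> = \<zero>\<^bsub>Z\<^esub>"
  "b \<in> carrier (pos P) \<Longrightarrow> angle \<zero>\<^bsub>neg P\<^esub> b = \<zero>\<^bsub>Z\<^esub>"
  by (simp_all add: angle_proj pure_zero linear_map.zero[OF proj_hom])

lemma rep_closed [simp]: "X \<in> carrier Z \<Longrightarrow> coset_rep X \<in> carrier T"
  unfolding Z_quotient by (rule A.coset_rep)

lemma proj_rep [simp]: "X \<in> carrier Z \<Longrightarrow> proj (coset_rep X) = X"
  unfolding Z_quotient by (rule A.coset_rep)

lemma Z_eqI:
  assumes "module R K" "f \<in> module_hom R Z K" "g \<in> module_hom R Z K"
    and "\<And>a b. a \<in> carrier (neg P) \<Longrightarrow> b \<in> carrier (pos P) \<Longrightarrow> f (angle a b) = g (angle a b)"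
    and "X \<in> carrier Z"
  shows "f X = g X"
proof -
  have "f (proj m) = g (proj m)" if "m \<in> carrier T" for m
    using tensor_hom_eqI[OF assms(1) module_hom_compose[OF linear_map.linear[OF proj_hom] assms(2)]
        module_hom_compose[OF linear_map.linear[OF proj_hom] assms(3)] _ that] assms(4)
    by (simp add: angle_proj)
  from this[of "coset_rep X"] show ?thesis using assms(5) by simp
qed

lemma act_neg_linear: "X \<in> carrier Z \<Longrightarrow> linear_map R (neg P) (neg P) (act_neg R P X)"
  unfolding act_neg_def by (intro gl_linear) simp

lemma act_pos_linear: "X \<in> carrier Z \<Longrightarrow> linear_map R (pos P) (pos P) (act_pos R P X)"
  unfolding act_pos_def by (intro gl_linear) simp

lemma zero_bracket_proj:
  "tkk_zero_bracket R P X Y = proj (act (lam (coset_rep X)) (coset_rep Y))"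
  by (simp add: tkk_zero_bracket_def pair_tensor_T)

lemma zero_bracket_closed [simp]:
  "X \<in> carrier Z \<Longrightarrow> Y \<in> carrier Z \<Longrightarrow> tkk_zero_bracket R P X Y \<in> carrier Z"
  by (simp add: zero_bracket_proj)

lemma TKK_simps:
  "carrier (TKK R P) = carrier (neg P) \<times> carrier Z \<times> carrier (pos P)"
  "\<zero>\<^bsub>TKK R P\<^esub> = (\<zero>\<^bsub>neg P\<^esub>, \<zero>\<^bsub>Z\<^esub>, \<zero>\<^bsub>pos P\<^esub>)"
  "(a, X, b) \<oplus>\<^bsub>TKK R P\<^esub> (c, Y, d) = (a \<oplus>\<^bsub>neg P\<^esub> c, X \<oplus>\<^bsub>Z\<^esub> Y, b \<oplus>\<^bsub>pos P\<^esub> d)"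
  "r \<odot>\<^bsub>TKK R P\<^esub> (a, X, b) = (r \<odot>\<^bsub>neg P\<^esub> a, r \<odot>\<^bsub>Z\<^esub> X, r \<odot>\<^bsub>pos P\<^esub> b)"
  "\<lblot>(a, X, b), (c, Y, d)\<rblot>\<^bsub>TKK R P\<^esub> =
        (act_neg R P X c \<ominus>\<^bsub>neg P\<^esub> act_neg R P Y a,
         (tkk_zero_bracket R P X Y \<oplus>\<^bsub>Z\<^esub> angle a d) \<ominus>\<^bsub>Z\<^esub> angle c b,
         act_pos R P X d \<ominus>\<^bsub>pos P\<^esub> act_pos R P Y b)"
  by (simp_all add: TKK_def Let_def direct_sum_module_def)

sublocale TKK: module R "TKK R P"
  by (rule module_cong[OF module_direct_sum[OF neg_module module_direct_sum[OF Z.module_axioms pos_module]]])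
    (simp_all add: TKK_def Let_def)

end

section \<open>Extending a homomorphism of pairs\<close>

locale lie_alg = module R L
  for R :: "('k, 'r) ring_scheme" and L :: "('k, 'l, 'x) lie_algebra_scheme" +
  assumes lie: "lie_algebra R L"
begin

lemma bracket_bilinear: "bilinear_map R L L L (lie_bracket L)"
  using lie by (simp add: lie_algebra_def)

lemma bracket_closed [simp]: "x \<in> carrier L \<Longrightarrow> y \<in> carrier L \<Longrightarrow> \<lblot>x, y\<rblot>\<^bsub>L\<^esub> \<in> carrier L"
  by (rule bilinear_mapD(1)[OF bracket_bilinear])

lemmas bracket_add = bilinear_mapD(2,3)[OF bracket_bilinear]
lemmas bracket_smult = bilinear_mapD(4,5)[OF bracket_bilinear]

lemma bracket_linear:
  "x \<in> carrier L \<Longrightarrow> linear_map R L L (lie_bracket L x)"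
  "y \<in> carrier L \<Longrightarrow> linear_map R L L (\<lambda>x. \<lblot>x, y\<rblot>\<^bsub>L\<^esub>)"
  using bracket_bilinear module_axioms
  by (simp_all add: bilinear_map_def linear_map_def linear_map_axioms_def)

lemmas bracket_zero = bracket_linear[THEN linear_map.zero]
lemmas bracket_neg = bracket_linear[THEN linear_map.neg]
lemmas bracket_minus = bracket_linear[THEN linear_map.minus]
lemmas bracket_simps = bracket_add bracket_smult bracket_zero bracket_neg bracket_minus

lemma bracket_self: "x \<in> carrier L \<Longrightarrow> \<lblot>x, x\<rblot>\<^bsub>L\<^esub> = \<zero>\<^bsub>L\<^esub>"
  using lie by (simp add: lie_algebra_def)

lemma bracket_antisym:
  assumes "x \<in> carrier L" "y \<in> carrier L"
  shows "\<lblot>x, y\<rblot>\<^bsub>L\<^esub> = \<ominus>\<^bsub>L\<^esub> \<lblot>y, x\<rblot>\<^bsub>L\<^esub>"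
proof -
  have "\<lblot>x, y\<rblot>\<^bsub>L\<^esub> \<oplus>\<^bsub>L\<^esub> \<lblot>y, x\<rblot>\<^bsub>L\<^esub> = \<zero>\<^bsub>L\<^esub>"
    using bracket_self[of "y \<oplus>\<^bsub>L\<^esub> x"] assms
    by (simp add: bracket_add bracket_self[of x] bracket_self[of y])
  then show ?thesis using assms by (simp add: M.minus_equality)
qed

lemma bracket_derivation:
  assumes "x \<in> carrier L" "y \<in> carrier L" "z \<in> carrier L"
  shows "\<lblot>z, \<lblot>x, y\<rblot>\<^bsub>L\<^esub>\<rblot>\<^bsub>L\<^esub> = \<lblot>\<lblot>z, x\<rblot>\<^bsub>L\<^esub>, y\<rblot>\<^bsub>L\<^esub> \<oplus>\<^bsub>L\<^esub> \<lblot>x, \<lblot>z, y\<rblot>\<^bsub>L\<^esub>\<rblot>\<^bsub>L\<^esub>"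
proof -
  have "\<lblot>z, \<lblot>x, y\<rblot>\<^bsub>L\<^esub>\<rblot>\<^bsub>L\<^esub> \<oplus>\<^bsub>L\<^esub> \<lblot>x, \<lblot>y, z\<rblot>\<^bsub>L\<^esub>\<rblot>\<^bsub>L\<^esub> \<oplus>\<^bsub>L\<^esub> \<lblot>y, \<lblot>z, x\<rblot>\<^bsub>L\<^esub>\<rblot>\<^bsub>L\<^esub> = \<zero>\<^bsub>L\<^esub>"
    using lie assms by (simp add: lie_algebra_def)
  moreover have "\<lblot>x, \<lblot>y, z\<rblot>\<^bsub>L\<^esub>\<rblot>\<^bsub>L\<^esub> = \<ominus>\<^bsub>L\<^esub> \<lblot>x, \<lblot>z, y\<rblot>\<^bsub>L\<^esub>\<rblot>\<^bsub>L\<^esub>"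
    using bracket_antisym[of y z] assms by (simp add: bracket_neg)
  moreover have "\<lblot>y, \<lblot>z, x\<rblot>\<^bsub>L\<^esub>\<rblot>\<^bsub>L\<^esub> = \<ominus>\<^bsub>L\<^esub> \<lblot>\<lblot>z, x\<rblot>\<^bsub>L\<^esub>, y\<rblot>\<^bsub>L\<^esub>"
    using assms by (intro bracket_antisym) auto
  ultimately have "\<lblot>z, \<lblot>x, y\<rblot>\<^bsub>L\<^esub>\<rblot>\<^bsub>L\<^esub> \<ominus>\<^bsub>L\<^esub> (\<lblot>\<lblot>z, x\<rblot>\<^bsub>L\<^esub>, y\<rblot>\<^bsub>L\<^esub> \<oplus>\<^bsub>L\<^esub> \<lblot>x, \<lblot>z, y\<rblot>\<^bsub>L\<^esub>\<rblot>\<^bsub>L\<^esub>) = \<zero>\<^bsub>L\<^esub>"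
    using assms by (simp add: a_minus_def M.minus_add M.a_ac)
  then show ?thesis using assms by (simp add: M.minus_eq_zero_iff)
qed

end

text \<open>
  A homomorphism of pairs into $L$ without reference to a grading: the last two conditions replace
  $[L_{-1},L_{-1}]=[L_1,L_1]=0$.
\<close>

locale pair_into_lie = trilinear_pair R P + L: lie_alg R L +
    gm: linear_map R "neg P" L gm + gp: linear_map R "pos P" L gp
  for R :: "('k, 'r) ring_scheme" and P :: "('k, 'm, 'p, 'x) jordan_pair_scheme"
    and L :: "('k, 'l, 'y) lie_algebra_scheme" and gm gp +
  assumes gm_triple: "\<lbrakk>a \<in> carrier (neg P); b \<in> carrier (pos P); c \<in> carrier (neg P)\<rbrakk> \<Longrightarrow>
      gm (tri_neg P a b c) = \<lblot>\<lblot>gm a, gp b\<rblot>\<^bsub>L\<^esub>, gm c\<rblot>\<^bsub>L\<^esub>"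
    and gp_triple: "\<lbrakk>b \<in> carrier (pos P); a \<in> carrier (neg P); d \<in> carrier (pos P)\<rbrakk> \<Longrightarrow>
      gp (tri_pos P b a d) = \<lblot>\<lblot>gp b, gm a\<rblot>\<^bsub>L\<^esub>, gp d\<rblot>\<^bsub>L\<^esub>"
    and gm_abelian: "a \<in> carrier (neg P) \<Longrightarrow> c \<in> carrier (neg P) \<Longrightarrow> \<lblot>gm a, gm c\<rblot>\<^bsub>L\<^esub> = \<zero>\<^bsub>L\<^esub>"
    and gp_abelian: "b \<in> carrier (pos P) \<Longrightarrow> d \<in> carrier (pos P) \<Longrightarrow> \<lblot>gp b, gp d\<rblot>\<^bsub>L\<^esub> = \<zero>\<^bsub>L\<^esub>"
begin

definition pairing :: "('m \<times> 'p \<Rightarrow> 'k) set \<Rightarrow> 'l" where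
  "pairing = tensor_lift R (neg P) (pos P) L (\<lambda>a b. \<lblot>gm a, gp b\<rblot>\<^bsub>L\<^esub>)"

lemma pairing_bilinear: "bilinear_map R (neg P) (pos P) L (\<lambda>a b. \<lblot>gm a, gp b\<rblot>\<^bsub>L\<^esub>)"
  by (rule bilinear_mapI) (simp_all add: L.bracket_simps)

sublocale pairing: linear_map R T L pairing
  using tensor_lift_linear[OF L.module_axioms pairing_bilinear] T.module_axioms L.module_axioms
  by (simp add: linear_map_def linear_map_axioms_def pairing_def)

lemma pairing_pure:
  "a \<in> carrier (neg P) \<Longrightarrow> b \<in> carrier (pos P) \<Longrightarrow> pairing (pure a b) = \<lblot>gm a, gp b\<rblot>\<^bsub>L\<^esub>"
  unfolding pairing_def by (rule tensor_lift_pure[OF L.module_axioms pairing_bilinear])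

text \<open>
  On $a\otimes b$ the two claims are the homomorphism properties for the two triple products; the sign
  in the second component of $\nu$ is the antisymmetry of the bracket of $L$.
\<close>

lemma pairing_acts:
  assumes "m \<in> carrier T"
  shows "(\<forall>c\<in>carrier (neg P). gm (fst (lam m) c) = \<lblot>pairing m, gm c\<rblot>\<^bsub>L\<^esub>) \<and>
         (\<forall>d\<in>carrier (pos P). gp (snd (lam m) d) = \<lblot>pairing m, gp d\<rblot>\<^bsub>L\<^esub>)"
  using assms
proof (induction rule: tensor_induct)
  case (pure a b)
  have "\<ominus>\<^bsub>L\<^esub> \<lblot>\<lblot>gp b, gm a\<rblot>\<^bsub>L\<^esub>, gp d\<rblot>\<^bsub>L\<^esub> = \<lblot>\<lblot>gm a, gp b\<rblot>\<^bsub>L\<^esub>, gp d\<rblot>\<^bsub>L\<^esub>" if "d \<in> carrier (pos P)" for d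
    using pure that L.bracket_antisym[of "gm a" "gp b"] by (simp add: L.bracket_neg)
  with pure show ?case
    by (simp add: lam_pure pairing_pure gm_triple gp_triple)
qed (simp_all add: gl_simps L.bracket_simps)

text \<open>
  Both sides are linear in $n$, and for $n=a\otimes b$ the definition of the action on tensors becomes
  the derivation rule for $\mathrm{ad}(\mathrm{pairing}\,m)$.
\<close>

lemma pairing_act:
  assumes m: "m \<in> carrier T" and "n \<in> carrier T"
  shows "pairing (act (lam m) n) = \<lblot>pairing m, pairing n\<rblot>\<^bsub>L\<^esub>"
  using L.module_axioms module_hom_compose[OF linear_map.linear[OF act_linear] pairing.linear]
    module_hom_compose[OF pairing.linear linear_map.linear[OF L.bracket_linear(1)]] _ assms(2)
proof (rule tensor_hom_eqI)
  fix a b assume ab: "a \<in> carrier (neg P)" "b \<in> carrier (pos P)"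
  then show "pairing (act (lam m) (pure a b)) = \<lblot>pairing m, pairing (pure a b)\<rblot>\<^bsub>L\<^esub>"
    using pairing_acts[OF m] m L.bracket_derivation[of "gm a" "gp b" "pairing m"]
    by (simp add: act_pure pairing_pure)
qed (use m in simp_all)

lemma pairing_A:
  assumes "n \<in> tkk_A R P"
  shows "pairing n = \<zero>\<^bsub>L\<^esub>"
  using A_gens_closed _ assms[unfolded tkk_A_def pair_tensor_T]
  by (rule pairing.span_killed) (auto simp: pairing_act L.bracket_self)

lemma pairing_rep: "m \<in> carrier T \<Longrightarrow> pairing (coset_rep (proj m)) = pairing m"
  by (rule A.quotient_lift(1)[OF L.module_axioms pairing.linear pairing_A])

definition extension :: "'m \<times> ('m \<times> 'p \<Rightarrow> 'k) set set \<times> 'p \<Rightarrow> 'l" where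
  "extension = (\<lambda>(a, X, b)\<in>carrier (TKK R P). gm a \<oplus>\<^bsub>L\<^esub> pairing (coset_rep X) \<oplus>\<^bsub>L\<^esub> gp b)"

lemma extension_apply:
  "a \<in> carrier (neg P) \<Longrightarrow> X \<in> carrier Z \<Longrightarrow> b \<in> carrier (pos P) \<Longrightarrow>
    extension (a, X, b) = gm a \<oplus>\<^bsub>L\<^esub> pairing (coset_rep X) \<oplus>\<^bsub>L\<^esub> gp b"
  by (simp add: extension_def TKK_simps)

sublocale pairing_Z: linear_map R Z L "\<lambda>X. pairing (coset_rep X)"
  using A.quotient_lift(2)[OF L.module_axioms pairing.linear pairing_A] Z.module_axioms L.module_axioms
  by (simp add: linear_map_def linear_map_axioms_def Z_quotient)

lemma extension_linear: "extension \<in> module_hom R (TKK R P) L"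
  by (rule module_homI)
    (auto simp: TKK_simps extension_apply L.M.a_ac L.smult_r_distr)

text \<open>
  Of the nine brackets between components of $x$ and $y$ in $L$, those in degrees $\pm2$ vanish; the
  other seven correspond to the seven terms of the bracket in TKK.
\<close>

lemma extension_bracket:
  assumes "x \<in> carrier (TKK R P)" "y \<in> carrier (TKK R P)"
  shows "extension \<lblot>x, y\<rblot>\<^bsub>TKK R P\<^esub> = \<lblot>extension x, extension y\<rblot>\<^bsub>L\<^esub>"
proof -
  obtain a X b where x: "x = (a, X, b)" "a \<in> carrier (neg P)" "X \<in> carrier Z" "b \<in> carrier (pos P)"
    using assms(1) by (auto simp: TKK_simps)
  obtain c Y d where y: "y = (c, Y, d)" "c \<in> carrier (neg P)" "Y \<in> carrier Z" "d \<in> carrier (pos P)"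
    using assms(2) by (auto simp: TKK_simps)
  define u v where "u = pairing (coset_rep X)" "v = pairing (coset_rep Y)"
  have uv: "u \<in> carrier L" "v \<in> carrier L" using x y by (simp_all add: u_v_def)
  have cl: "act_neg R P X c \<in> carrier (neg P)" "act_neg R P Y a \<in> carrier (neg P)"
      "act_pos R P X d \<in> carrier (pos P)" "act_pos R P Y b \<in> carrier (pos P)"
    using x y by (simp_all add: act_neg_def act_pos_def)
  have angles: "pairing (coset_rep (angle s t)) = \<lblot>gm s, gp t\<rblot>\<^bsub>L\<^esub>"
    if "s \<in> carrier (neg P)" "t \<in> carrier (pos P)" for s t
    using that by (simp add: angle_proj pairing_rep pairing_pure)
  have acts: "gm (act_neg R P X c) = \<lblot>u, gm c\<rblot>\<^bsub>L\<^esub>" "gp (act_pos R P X d) = \<lblot>u, gp d\<rblot>\<^bsub>L\<^esub>"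
      "gm (act_neg R P Y a) = \<ominus>\<^bsub>L\<^esub> \<lblot>gm a, v\<rblot>\<^bsub>L\<^esub>" "gp (act_pos R P Y b) = \<ominus>\<^bsub>L\<^esub> \<lblot>gp b, v\<rblot>\<^bsub>L\<^esub>"
    using x y pairing_acts[of "coset_rep X"] pairing_acts[of "coset_rep Y"] uv
      L.bracket_antisym[of v "gm a"] L.bracket_antisym[of v "gp b"]
    by (simp_all add: act_neg_def act_pos_def u_v_def)
  have zero: "pairing (coset_rep (tkk_zero_bracket R P X Y)) = \<lblot>u, v\<rblot>\<^bsub>L\<^esub>"
    using x y by (simp add: zero_bracket_proj pairing_rep pairing_act u_v_def)
  have "extension \<lblot>x, y\<rblot>\<^bsub>TKK R P\<^esub> =
      (\<lblot>u, gm c\<rblot>\<^bsub>L\<^esub> \<oplus>\<^bsub>L\<^esub> \<lblot>gm a, v\<rblot>\<^bsub>L\<^esub>) \<oplus>\<^bsub>L\<^esub>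
      (\<lblot>u, v\<rblot>\<^bsub>L\<^esub> \<oplus>\<^bsub>L\<^esub> \<lblot>gm a, gp d\<rblot>\<^bsub>L\<^esub> \<oplus>\<^bsub>L\<^esub> \<lblot>gp b, gm c\<rblot>\<^bsub>L\<^esub>) \<oplus>\<^bsub>L\<^esub>
      (\<lblot>u, gp d\<rblot>\<^bsub>L\<^esub> \<oplus>\<^bsub>L\<^esub> \<lblot>gp b, v\<rblot>\<^bsub>L\<^esub>)"
    using x y cl uv L.bracket_antisym[of "gp b" "gm c"]
    by (simp add: TKK_simps extension_apply acts zero angles a_minus_def)
  also have "\<dots> = \<lblot>gm a \<oplus>\<^bsub>L\<^esub> u \<oplus>\<^bsub>L\<^esub> gp b, gm c \<oplus>\<^bsub>L\<^esub> v \<oplus>\<^bsub>L\<^esub> gp d\<rblot>\<^bsub>L\<^esub>"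
    using x y uv by (simp add: L.bracket_simps gm_abelian gp_abelian L.M.a_ac)
  finally show ?thesis using x y by (simp add: extension_apply u_v_def)
qed

lemma extension_lie_hom: "extension \<in> lie_hom R (TKK R P) L"
  by (simp add: lie_hom_def extension_linear extension_bracket)

end

section \<open>Homomorphisms out of the TKK algebra\<close>

locale tkk_hom = trilinear_pair R P + L: lie_alg R L
  for R :: "('k, 'r) ring_scheme" and P :: "('k, 'm, 'p, 'x) jordan_pair_scheme"
    and L :: "('k, 'l, 'y) lie_algebra_scheme" +
  fixes g
  assumes lie_hom: "g \<in> lie_hom R (TKK R P) L"
begin

sublocale g: linear_map R "TKK R P" L g
  using lie_hom TKK.module_axioms L.module_axioms
  by (simp add: linear_map_def linear_map_axioms_def lie_hom_def)

lemma g_bracket: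
  "x \<in> carrier (TKK R P) \<Longrightarrow> y \<in> carrier (TKK R P) \<Longrightarrow> g \<lblot>x, y\<rblot>\<^bsub>TKK R P\<^esub> = \<lblot>g x, g y\<rblot>\<^bsub>L\<^esub>"
  using lie_hom by (simp add: lie_hom_def)

lemma in_closed [simp]:
  "a \<in> carrier (neg P) \<Longrightarrow> in_neg R P a \<in> carrier (TKK R P)"
  "X \<in> carrier Z \<Longrightarrow> in_zero P X \<in> carrier (TKK R P)"
  "b \<in> carrier (pos P) \<Longrightarrow> in_pos R P b \<in> carrier (TKK R P)"
  by (simp_all add: in_neg_def in_zero_def in_pos_def TKK_simps)

lemma g_neg_linear: "linear_map R (neg P) L (\<lambda>a. g (in_neg R P a))"
proof -
  have "in_neg R P \<in> module_hom R (neg P) (TKK R P)"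
    by (rule module_homI) (simp_all add: in_neg_def TKK_simps)
  from module_hom_compose[OF this g.linear] show ?thesis
    by (simp add: linear_map_def linear_map_axioms_def neg_module L.module_axioms)
qed

lemma g_zero_linear: "linear_map R Z L (\<lambda>X. g (in_zero P X))"
proof -
  have "in_zero P \<in> module_hom R Z (TKK R P)"
    by (rule module_homI) (simp_all add: in_zero_def TKK_simps)
  from module_hom_compose[OF this g.linear] show ?thesis
    by (simp add: linear_map_def linear_map_axioms_def Z.module_axioms L.module_axioms)
qed

lemma g_pos_linear: "linear_map R (pos P) L (\<lambda>b. g (in_pos R P b))"
proof -
  have "in_pos R P \<in> module_hom R (pos P) (TKK R P)"
    by (rule module_homI) (simp_all add: in_pos_def TKK_simps)
  from module_hom_compose[OF this g.linear] show ?thesis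
    by (simp add: linear_map_def linear_map_axioms_def pos_module L.module_axioms)
qed

sublocale g_neg: linear_map R "neg P" L "\<lambda>a. g (in_neg R P a)" by (rule g_neg_linear)
sublocale g_zero: linear_map R Z L "\<lambda>X. g (in_zero P X)" by (rule g_zero_linear)
sublocale g_pos: linear_map R "pos P" L "\<lambda>b. g (in_pos R P b)" by (rule g_pos_linear)

lemma g_split:
  assumes "a \<in> carrier (neg P)" "X \<in> carrier Z" "b \<in> carrier (pos P)"
  shows "g (a, X, b) = g (in_neg R P a) \<oplus>\<^bsub>L\<^esub> g (in_zero P X) \<oplus>\<^bsub>L\<^esub> g (in_pos R P b)"
proof -
  have "(a, X, b) = in_neg R P a \<oplus>\<^bsub>TKK R P\<^esub> in_zero P X \<oplus>\<^bsub>TKK R P\<^esub> in_pos R P b"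
    using assms by (simp add: in_neg_def in_zero_def in_pos_def TKK_simps)
  then show ?thesis using assms by simp
qed

text \<open>
  The operators that occur in a bracket of TKK are those of chosen representatives, and the
  representative of the zero coset is some element of $A$ whose operator need not be zero. Hence
  $[a_-,d_+]$ is $\langle a,d\rangle$ plus terms that arise from the zero coset. Each of these terms is
  itself a bracket with $0$, so a homomorphism sends it to $0$, and in $L$ the expected formulas hold.
  The next four lemmas remove such terms one degree at a time.
\<close>

lemma g_zero_bracket:
  assumes "X \<in> carrier Z" "Y \<in> carrier Z"
  shows "g (in_zero P (tkk_zero_bracket R P X Y)) = \<lblot>g (in_zero P X), g (in_zero P Y)\<rblot>\<^bsub>L\<^esub>"
proof -
  have "\<lblot>in_zero P X, in_zero P Y\<rblot>\<^bsub>TKK R P\<^esub> = in_zero P (tkk_zero_bracket R P X Y)"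
    using assms act_neg_linear[THEN linear_map.zero] act_pos_linear[THEN linear_map.zero]
    by (simp add: in_zero_def TKK_simps a_minus_def angle_zero)
  then show ?thesis using g_bracket[of "in_zero P X" "in_zero P Y"] assms by simp
qed

lemma g_act_neg:
  assumes "X \<in> carrier Z" "c \<in> carrier (neg P)"
  shows "g (in_neg R P (act_neg R P X c)) = \<lblot>g (in_zero P X), g (in_neg R P c)\<rblot>\<^bsub>L\<^esub>"
proof -
  have cl: "act_neg R P X c \<in> carrier (neg P)" using assms by (simp add: act_neg_def)
  have "\<lblot>in_zero P X, in_neg R P c\<rblot>\<^bsub>TKK R P\<^esub> =
      (act_neg R P X c, tkk_zero_bracket R P X \<zero>\<^bsub>Z\<^esub>, \<zero>\<^bsub>pos P\<^esub>)"
    using assms cl act_neg_linear[THEN linear_map.zero] act_pos_linear[THEN linear_map.zero]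
    by (simp add: in_zero_def in_neg_def TKK_simps a_minus_def angle_zero)
  then show ?thesis
    using g_bracket[of "in_zero P X" "in_neg R P c"] assms cl
    by (simp add: g_split g_zero_bracket L.bracket_zero)
qed

lemma g_act_pos:
  assumes "X \<in> carrier Z" "d \<in> carrier (pos P)"
  shows "g (in_pos R P (act_pos R P X d)) = \<lblot>g (in_zero P X), g (in_pos R P d)\<rblot>\<^bsub>L\<^esub>"
proof -
  have cl: "act_pos R P X d \<in> carrier (pos P)" using assms by (simp add: act_pos_def)
  have "\<lblot>in_zero P X, in_pos R P d\<rblot>\<^bsub>TKK R P\<^esub> =
      (\<zero>\<^bsub>neg P\<^esub>, tkk_zero_bracket R P X \<zero>\<^bsub>Z\<^esub>, act_pos R P X d)"
    using assms cl act_neg_linear[THEN linear_map.zero] act_pos_linear[THEN linear_map.zero]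
    by (simp add: in_zero_def in_pos_def TKK_simps a_minus_def angle_zero)
  then show ?thesis
    using g_bracket[of "in_zero P X" "in_pos R P d"] assms cl
    by (simp add: g_split g_zero_bracket L.bracket_zero)
qed

lemma g_angle:
  assumes a: "a \<in> carrier (neg P)" and d: "d \<in> carrier (pos P)"
  shows "g (in_zero P (angle a d)) = \<lblot>g (in_neg R P a), g (in_pos R P d)\<rblot>\<^bsub>L\<^esub>"
proof -
  have cl: "act_neg R P \<zero>\<^bsub>Z\<^esub> a \<in> carrier (neg P)" "act_pos R P \<zero>\<^bsub>Z\<^esub> d \<in> carrier (pos P)"
    using assms by (simp_all add: act_neg_def act_pos_def)
  have "\<lblot>in_neg R P a, in_pos R P d\<rblot>\<^bsub>TKK R P\<^esub> =
      (\<ominus>\<^bsub>neg P\<^esub> act_neg R P \<zero>\<^bsub>Z\<^esub> a, tkk_zero_bracket R P \<zero>\<^bsub>Z\<^esub> \<zero>\<^bsub>Z\<^esub> \<oplus>\<^bsub>Z\<^esub> angle a d, act_pos R P \<zero>\<^bsub>Z\<^esub> d)"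
    using assms cl act_neg_linear[THEN linear_map.zero] act_pos_linear[THEN linear_map.zero]
    by (simp add: in_neg_def in_pos_def TKK_simps a_minus_def angle_zero)
  then show ?thesis
    using g_bracket[of "in_neg R P a" "in_pos R P d"] assms cl
    by (simp add: g_split g_zero_bracket g_act_neg g_act_pos L.bracket_zero L.M.minus_equality[of "\<zero>\<^bsub>L\<^esub>" "\<zero>\<^bsub>L\<^esub>"])
qed

text \<open>
  The elements $\langle a,d\rangle$ span the part of degree zero and are mapped to brackets of
  elements of degree $\pm1$.
\<close>

lemma g_unique:
  assumes "g' \<in> lie_hom R (TKK R P) L"
    and "\<And>a. a \<in> carrier (neg P) \<Longrightarrow> g (in_neg R P a) = g' (in_neg R P a)"
    and "\<And>b. b \<in> carrier (pos P) \<Longrightarrow> g (in_pos R P b) = g' (in_pos R P b)"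
    and "x \<in> carrier (TKK R P)"
  shows "g x = g' x"
proof -
  interpret g': tkk_hom R P L g'
    using assms(1) trilinear_pair_axioms L.lie_alg_axioms
    by (simp add: tkk_hom_def tkk_hom_axioms_def)
  have "g (in_zero P X) = g' (in_zero P X)" if "X \<in> carrier Z" for X
    using Z_eqI[OF L.module_axioms g_zero.linear g'.g_zero.linear _ that]
    by (simp add: g_angle g'.g_angle assms)
  with assms show ?thesis by (auto simp: TKK_simps g_split g'.g_split)
qed

end

context pair_into_lie
begin

lemma extension_in_neg: "a \<in> carrier (neg P) \<Longrightarrow> extension (in_neg R P a) = gm a"
  and extension_in_pos: "b \<in> carrier (pos P) \<Longrightarrow> extension (in_pos R P b) = gp b"
  and extension_in_zero: "X \<in> carrier Z \<Longrightarrow> extension (in_zero P X) = pairing (coset_rep X)"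
  by (simp_all add: in_neg_def in_pos_def in_zero_def extension_apply)

lemma extension_unique:
  assumes "g \<in> lie_hom R (TKK R P) L" "g \<in> extensional (carrier (TKK R P))"
    and "\<And>a. a \<in> carrier (neg P) \<Longrightarrow> g (in_neg R P a) = gm a"
    and "\<And>b. b \<in> carrier (pos P) \<Longrightarrow> g (in_pos R P b) = gp b"
  shows "g = extension"
proof (rule extensionalityI[OF assms(2)])
  interpret g: tkk_hom R P L g
    using assms(1) trilinear_pair_axioms L.lie_alg_axioms
    by (simp add: tkk_hom_def tkk_hom_axioms_def)
  show "extension \<in> extensional (carrier (TKK R P))" by (simp add: extension_def)
  fix x assume "x \<in> carrier (TKK R P)"
  then show "g x = extension x"
    using g.g_unique[OF extension_lie_hom] by (simp add: assms extension_in_neg extension_in_pos)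
qed

lemma extension_finsum:
  assumes "a \<in> carrier (neg P)" "b \<in> carrier (pos P)" "finite I"
    and "\<And>i. i \<in> I \<Longrightarrow> c i \<in> carrier (neg P) \<and> d i \<in> carrier (pos P)"
  shows "extension (a, \<Oplus>\<^bsub>Z\<^esub>i\<in>I. angle (c i) (d i), b) =
    gm a \<oplus>\<^bsub>L\<^esub> (\<Oplus>\<^bsub>L\<^esub>i\<in>I. \<lblot>gm (c i), gp (d i)\<rblot>\<^bsub>L\<^esub>) \<oplus>\<^bsub>L\<^esub> gp b"
proof -
  have cl: "(\<lambda>i. angle (c i) (d i)) \<in> I \<rightarrow> carrier Z" using assms by auto
  have "pairing (coset_rep (\<Oplus>\<^bsub>Z\<^esub>i\<in>I. angle (c i) (d i))) = (\<Oplus>\<^bsub>L\<^esub>i\<in>I. pairing (coset_rep (angle (c i) (d i))))"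
    by (rule pairing_Z.finsum[OF assms(3) cl])
  also have "\<dots> = (\<Oplus>\<^bsub>L\<^esub>i\<in>I. \<lblot>gm (c i), gp (d i)\<rblot>\<^bsub>L\<^esub>)"
    using assms by (intro L.M.add.finprod_cong') (auto simp: angle_proj pairing_rep pairing_pure)
  finally show ?thesis using assms Z.M.finsum_closed[OF cl] by (simp add: extension_apply)
qed

lemma extension_graded:
  assumes "\<And>i. submodule (G i) R L"
    and "\<And>a. a \<in> carrier (neg P) \<Longrightarrow> gm a \<in> G (-1)" "\<And>b. b \<in> carrier (pos P) \<Longrightarrow> gp b \<in> G 1"
    and "\<And>x y. x \<in> G (-1) \<Longrightarrow> y \<in> G 1 \<Longrightarrow> \<lblot>x, y\<rblot>\<^bsub>L\<^esub> \<in> G 0"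
  shows "extension ` TKK_grading R P i \<subseteq> G i"
proof -
  have "pairing m \<in> G 0" if "m \<in> carrier T" for m
    using that
    by (induction rule: tensor_induct)
      (simp_all add: pairing_pure assms L.submoduleE[OF assms(1)] submodule.smult_closed[OF assms(1)]
        subgroup.one_closed[OF submodule.axioms(1)[OF assms(1)], simplified])
  moreover have "extension \<zero>\<^bsub>TKK R P\<^esub> = \<zero>\<^bsub>L\<^esub>" "\<zero>\<^bsub>L\<^esub> \<in> G i"
    using extension_apply[of "\<zero>\<^bsub>neg P\<^esub>" "\<zero>\<^bsub>Z\<^esub>" "\<zero>\<^bsub>pos P\<^esub>"] pairing_Z.zero
      subgroup.one_closed[OF submodule.axioms(1)[OF assms(1)]]
    by (simp_all add: TKK_simps)
  ultimately show ?thesis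
    using assms(2,3)
    by (auto simp: TKK_grading_def extension_in_neg extension_in_pos extension_in_zero)
qed

end

section \<open>Jordan pairs and triple systems\<close>

lemma three_gradedD:
  assumes "three_graded R L G"
  shows "lie_alg R L" and "\<And>i. submodule (G i) R L"
    and "\<And>i. 1 < \<bar>i\<bar> \<Longrightarrow> G i = {\<zero>\<^bsub>L\<^esub>}"
    and "\<And>i j x y. x \<in> G i \<Longrightarrow> y \<in> G j \<Longrightarrow> \<lblot>x, y\<rblot>\<^bsub>L\<^esub> \<in> G (i + j)"
    and "\<And>i x. x \<in> G i \<Longrightarrow> x \<in> carrier L"
proof -
  show "lie_alg R L"
    using assms by (simp add: three_graded_def lie_alg_def lie_alg_axioms_def lie_algebra_def)
  then interpret lie_alg R L .
  show sub: "submodule (G i) R L" for i using assms by (simp add: three_graded_def)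
  show "x \<in> carrier L" if "x \<in> G i" for i x using submoduleE(1)[OF sub] that by blast
qed (use assms in \<open>simp_all add: three_graded_def\<close>)

lemma lie_jordan_pair_simps:
  "carrier (neg (lie_jordan_pair L G)) = G (-1)" "carrier (pos (lie_jordan_pair L G)) = G 1"
  "add (neg (lie_jordan_pair L G)) = add L" "add (pos (lie_jordan_pair L G)) = add L"
  "smult (neg (lie_jordan_pair L G)) = smult L" "smult (pos (lie_jordan_pair L G)) = smult L"
  "tri_neg (lie_jordan_pair L G) a b c = \<lblot>\<lblot>a, b\<rblot>\<^bsub>L\<^esub>, c\<rblot>\<^bsub>L\<^esub>"
  "tri_pos (lie_jordan_pair L G) a b c = \<lblot>\<lblot>a, b\<rblot>\<^bsub>L\<^esub>, c\<rblot>\<^bsub>L\<^esub>"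
  by (simp_all add: lie_jordan_pair_def restrict_module_def module.truncate_def)

lemma (in trilinear_pair) pair_into_lieI:
  assumes grad: "three_graded R L G" and hom: "(gm, gp) \<in> jordan_pair_hom R P (lie_jordan_pair L G)"
  shows "pair_into_lie R P L gm gp"
    and "\<And>a. a \<in> carrier (neg P) \<Longrightarrow> gm a \<in> G (-1)"
    and "\<And>b. b \<in> carrier (pos P) \<Longrightarrow> gp b \<in> G 1"
proof -
  note gradD = three_gradedD[OF grad]
  interpret L: lie_alg R L by (rule gradD)
  have homs: "gm \<in> module_hom R (neg P) L" "gp \<in> module_hom R (pos P) L"
    and mem: "\<And>a. a \<in> carrier (neg P) \<Longrightarrow> gm a \<in> G (-1)" "\<And>b. b \<in> carrier (pos P) \<Longrightarrow> gp b \<in> G 1"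
    using hom gradD(5) by (auto simp: jordan_pair_hom_def module_hom_def lie_jordan_pair_simps Pi_iff)
  show "gm a \<in> G (-1)" if "a \<in> carrier (neg P)" for a by (rule mem(1)[OF that])
  show "gp b \<in> G 1" if "b \<in> carrier (pos P)" for b by (rule mem(2)[OF that])
  interpret gm: linear_map R "neg P" L gm
    using homs by unfold_locales
  interpret gp: linear_map R "pos P" L gp
    using homs by unfold_locales
  have ab: "\<lblot>x, y\<rblot>\<^bsub>L\<^esub> = \<zero>\<^bsub>L\<^esub>" if "x \<in> G i" "y \<in> G i" "i = 1 \<or> i = -1" for x y i
    using gradD(4)[OF that(1,2)] gradD(3)[of "i + i"] that(3) by auto
  show "pair_into_lie R P L gm gp"
  proof unfold_locales
    show "\<lblot>gm a, gm c\<rblot>\<^bsub>L\<^esub> = \<zero>\<^bsub>L\<^esub>" if "a \<in> carrier (neg P)" "c \<in> carrier (neg P)" for a c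
      using ab[OF mem(1)[OF that(1)] mem(1)[OF that(2)]] by simp
    show "\<lblot>gp a, gp c\<rblot>\<^bsub>L\<^esub> = \<zero>\<^bsub>L\<^esub>" if "a \<in> carrier (pos P)" "c \<in> carrier (pos P)" for a c
      using ab[OF mem(2)[OF that(1)] mem(2)[OF that(2)]] by simp
  qed (use hom in \<open>auto simp: jordan_pair_hom_def lie_jordan_pair_simps\<close>)
qed

lemma jordan_pair_trilinear: "jordan_pair R P \<Longrightarrow> trilinear_pair R P"
  by (simp add: jordan_pair_def jordan_axioms_def trilinear_pair_def)

text \<open>
  The formula for the extension holds for its definition because \<open>pairing\<close> sends
  $\langle c,d\rangle$ to $[\gamma_-c,\gamma_+d]$; by uniqueness it holds for every extension.
\<close>

theorem graded_extension:
  assumes grad: "three_graded R L G" and jp: "jordan_pair R P"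
    and hom: "(gm, gp) \<in> jordan_pair_hom R P (lie_jordan_pair L G)"
  defines "E \<equiv> {g. g \<in> extensional (carrier (TKK R P)) \<and>
                     g \<in> graded_lie_hom R (TKK R P) (TKK_grading R P) L G \<and>
                     (\<forall>a\<in>carrier (neg P). g (in_neg R P a) = gm a) \<and>
                     (\<forall>b\<in>carrier (pos P). g (in_pos R P b) = gp b)}"
  shows "(\<exists>!g. g \<in> E) \<and>
         (\<forall>g\<in>E. \<forall>a\<in>carrier (neg P). \<forall>b\<in>carrier (pos P). \<forall>(n::nat) c d.
            (\<forall>i<n. c i \<in> carrier (neg P) \<and> d i \<in> carrier (pos P)) \<longrightarrow>
            g (a, \<Oplus>\<^bsub>tkk_zero_part R P\<^esub>i\<in>{..<n}. tkk_angle R P (c i) (d i), b) =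
              gm a \<oplus>\<^bsub>L\<^esub> (\<Oplus>\<^bsub>L\<^esub>i\<in>{..<n}. \<lblot>gm (c i), gp (d i)\<rblot>\<^bsub>L\<^esub>) \<oplus>\<^bsub>L\<^esub> gp b)"
proof -
  note gradD = three_gradedD[OF grad]
  interpret trilinear_pair R P by (rule jordan_pair_trilinear[OF jp])
  note into = pair_into_lieI[OF grad hom]
  interpret pair_into_lie R P L gm gp by (rule into)
  have "extension ` TKK_grading R P i \<subseteq> G i" for i
    using extension_graded[of G i, OF gradD(2) into(2,3)] gradD(4)[of _ "-1" _ 1] by simp
  then have "extension \<in> E"
    by (simp add: E_def graded_lie_hom_def extension_lie_hom extension_in_neg extension_in_pos)
      (simp add: extension_def)
  moreover have "g = extension" if "g \<in> E" for g
    using that by (intro extension_unique) (auto simp: E_def graded_lie_hom_def)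
  ultimately have "E = {extension}" by blast
  then show ?thesis by (auto intro!: extension_finsum)
qed

lemma truncate_simps:
  "carrier (module.truncate S) = carrier S" "add (module.truncate S) = add S"
  "smult (module.truncate S) = smult S" "zero (module.truncate S) = zero S"
  by (simp_all add: module.truncate_def)

locale trilinear_triple =
  fixes R :: "('k, 'r) ring_scheme" and S :: "('k, 's, 'x) jordan_triple_scheme"
  assumes triple_module: "module R S" and triple_trilinear: "trilinear_map R S S S S (triple S)"
begin

abbreviation P where "P \<equiv> pair_of_triple S"

lemma P_simps:
  "neg P = module.truncate S" "pos P = module.truncate S" "tri_neg P = triple S" "tri_pos P = triple S"
  by (simp_all add: pair_of_triple_def)

sublocale trilinear_pair R P
proof -
  have "module R (module.truncate S)"
    by (rule module_cong[OF triple_module]) (simp_all add: truncate_simps)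
  moreover have "trilinear_map R (module.truncate S) (module.truncate S) (module.truncate S)
      (module.truncate S) (triple S)"
    using triple_trilinear by (simp add: trilinear_map_def module_hom_def truncate_simps)
  ultimately show "trilinear_pair R P" by (simp add: trilinear_pair_def P_simps)
qed

lemma pos_eq_neg: "pos P = neg P"
  by (simp add: P_simps)

lemma pos_simps:
  "carrier (pos P) = carrier (neg P)" "add (pos P) = add (neg P)" "smult (pos P) = smult (neg P)"
  by (simp_all add: P_simps)

lemma pure_flip_closed: "a \<in> carrier (neg P) \<Longrightarrow> b \<in> carrier (neg P) \<Longrightarrow> pure a b \<in> carrier T"
  by (rule pure_closed) (simp_all add: pos_simps)

definition tensor_flip where "tensor_flip = tensor_lift R (neg P) (pos P) T (\<lambda>c d. \<ominus>\<^bsub>T\<^esub> pure d c)"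

lemma tensor_flip_bilinear: "bilinear_map R (neg P) (pos P) T (\<lambda>c d. \<ominus>\<^bsub>T\<^esub> pure d c)"
  using pure_simps
  by (intro bilinear_mapI)
    (simp_all add: pos_simps pure_flip_closed T.M.minus_add T.M.a_comm T.smult_r_minus)

sublocale tensor_flip: linear_map R T T tensor_flip
  using tensor_lift_linear[OF T.module_axioms tensor_flip_bilinear] T.module_axioms
  by (simp add: linear_map_def linear_map_axioms_def tensor_flip_def)

lemma tensor_flip_pure:
  "c \<in> carrier (neg P) \<Longrightarrow> d \<in> carrier (pos P) \<Longrightarrow> tensor_flip (pure c d) = \<ominus>\<^bsub>T\<^esub> pure d c"
  unfolding tensor_flip_def by (rule tensor_lift_pure[OF T.module_axioms tensor_flip_bilinear])

lemma swap_closed: "X \<in> carrier gl \<Longrightarrow> prod.swap X \<in> carrier gl"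
  by (cases X) (simp add: gl_carrier pos_eq_neg)

lemma swap_linear: "prod.swap \<in> module_hom R gl gl"
  by (rule module_homI, erule swap_closed)
    (auto simp: gl_pair_def direct_sum_module_def pos_eq_neg)

text \<open>
  The flip exchanges the tensor factors, so it intertwines an operator pair with the exchanged pair.
\<close>

lemma tensor_flip_act:
  assumes X: "X \<in> carrier gl" and "n \<in> carrier T"
  shows "tensor_flip (act X n) = act (prod.swap X) (tensor_flip n)"
  using T.module_axioms module_hom_compose[OF linear_map.linear[OF act_linear[OF X]] tensor_flip.linear]
    module_hom_compose[OF tensor_flip.linear linear_map.linear[OF act_linear[OF swap_closed[OF X]]]] _ assms(2)
proof (rule tensor_hom_eqI)
  interpret sX: linear_map R T T "act (prod.swap X)" by (rule act_linear[OF swap_closed[OF X]])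
  fix c d assume cd: "c \<in> carrier (neg P)" "d \<in> carrier (pos P)"
  then have dc: "d \<in> carrier (neg P)" "c \<in> carrier (pos P)" by (simp_all add: pos_eq_neg)
  have cl: "fst X c \<in> carrier (neg P)" "fst X c \<in> carrier (pos P)" "snd X d \<in> carrier (pos P)"
      "snd X d \<in> carrier (neg P)"
    using gl_closed[OF X] cd by (simp_all add: pos_eq_neg)
  show "tensor_flip (act X (pure c d)) = act (prod.swap X) (tensor_flip (pure c d))"
    using cd dc cl X by (simp add: act_pure swap_closed tensor_flip_pure T.M.minus_add T.M.a_comm)
qed

text \<open>
  The two components of $\nu(c,d)$ are $V_{c,d}$ and $-V_{d,c}$; exchanging them gives $-\nu(d,c)$.
  This is why the flip carries a sign.
\<close>

lemma lam_tensor_flip: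
  assumes "m \<in> carrier T"
  shows "lam (tensor_flip m) = prod.swap (lam m)"
  using gl.module_axioms module_hom_compose[OF tensor_flip.linear lam.linear]
    module_hom_compose[OF lam.linear swap_linear] _ assms
proof (rule tensor_hom_eqI)
  fix c d assume cd: "c \<in> carrier (neg P)" "d \<in> carrier (pos P)"
  then have dc: "d \<in> carrier (neg P)" "c \<in> carrier (pos P)" by (simp_all add: pos_eq_neg)
  have m: "\<ominus>\<^bsub>R\<^esub> \<one>\<^bsub>R\<^esub> \<in> carrier R" by simp
  \<comment> \<open>the values of a negative in gl are obtained from those of a scalar multiple\<close>
  have neg: "\<ominus>\<^bsub>gl\<^esub> X = (\<ominus>\<^bsub>R\<^esub> \<one>\<^bsub>R\<^esub>) \<odot>\<^bsub>gl\<^esub> X" if "X \<in> carrier gl" for X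
    using that by (simp add: gl.smult_l_minus)
  show "lam (tensor_flip (pure c d)) = prod.swap (lam (pure c d))"
  proof (rule gl_eqI)
    fix x assume "x \<in> carrier (neg P)"
    moreover from this have "x \<in> carrier (pos P)" by (simp add: pos_eq_neg)
    ultimately show "fst (lam (tensor_flip (pure c d))) x = fst (prod.swap (lam (pure c d))) x"
      using cd dc
      by (simp add: tensor_flip_pure neg gl_simps lam_pure M.smult_l_minus)
        (simp add: P_simps)
  next
    fix x assume "x \<in> carrier (pos P)"
    moreover from this have "x \<in> carrier (neg P)" by (simp add: pos_eq_neg)
    ultimately show "snd (lam (tensor_flip (pure c d))) x = snd (prod.swap (lam (pure c d))) x"
      using cd dc
      by (simp add: tensor_flip_pure neg gl_simps lam_pure N.smult_l_minus N.smult_r_minus)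
        (simp add: P_simps)
  qed (use cd in \<open>simp_all add: swap_closed\<close>)
qed

text \<open>
  By the two preceding lemmas $\lambda(m)m$ is flipped to $\lambda(m')m'$, where $m'$ is the flip of
  $m$.
\<close>

lemma tensor_flip_A:
  assumes "n \<in> tkk_A R P"
  shows "tensor_flip n \<in> tkk_A R P"
proof -
  have "module_span R T {act (lam m) m | m. m \<in> carrier T} \<subseteq> {n \<in> carrier T. tensor_flip n \<in> tkk_A R P}"
  proof (rule module_span_minimal[OF tensor_flip.submodule_vimage[OF A.sub]], safe)
    fix m assume m: "m \<in> carrier T"
    then show "act (lam m) m \<in> carrier T" by simp
    have "tensor_flip (act (lam m) m) = act (lam (tensor_flip m)) (tensor_flip m)" using m by (simp add: tensor_flip_act lam_tensor_flip)
    also have "\<dots> \<in> tkk_A R P"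
      unfolding tkk_A_def pair_tensor_T using m by (intro subsetD[OF module_span_superset]) auto
    finally show "tensor_flip (act (lam m) m) \<in> tkk_A R P" .
  qed
  with assms show ?thesis by (auto simp: tkk_A_def pair_tensor_T)
qed

text \<open>
  The degree zero component of the canonical involution.
\<close>

definition flip where
  "flip X = tensor_lift R S S Z (\<lambda>c d. \<ominus>\<^bsub>Z\<^esub> angle d c) (coset_rep X)"

lemma proj_tensor_flip_linear: "(\<lambda>m. proj (tensor_flip m)) \<in> module_hom R T Z"
  by (rule module_hom_compose[OF tensor_flip.linear linear_map.linear[OF proj_hom]])

lemma flip_proj_tensor_flip:
  assumes "X \<in> carrier Z"
  shows "flip X = proj (tensor_flip (coset_rep X))"
proof -
  have bil: "bilinear_map R (neg P) (pos P) Z (\<lambda>c d. \<ominus>\<^bsub>Z\<^esub> angle d c)"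
    using pure_simps
    by (intro bilinear_mapI)
      (simp_all add: pos_simps pure_flip_closed angle_proj Z.M.minus_add Z.M.a_comm Z.smult_r_minus
        linear_map.add[OF proj_hom] linear_map.smult[OF proj_hom])
  have "flip X = tensor_lift R (neg P) (pos P) Z (\<lambda>c d. \<ominus>\<^bsub>Z\<^esub> angle d c) (coset_rep X)"
    by (simp add: flip_def tensor_lift_def P_simps truncate_simps)
  also have "\<dots> = proj (tensor_flip (coset_rep X))"
  proof (rule tensor_hom_eqI[OF Z.module_axioms tensor_lift_linear[OF Z.module_axioms bil] proj_tensor_flip_linear])
    fix c d assume cd: "c \<in> carrier (neg P)" "d \<in> carrier (pos P)"
    then have "pure d c \<in> carrier T" by (intro pure_closed) (simp_all add: pos_eq_neg)
    with cd show "tensor_lift R (neg P) (pos P) Z (\<lambda>c d. \<ominus>\<^bsub>Z\<^esub> angle d c) (pure c d) = proj (tensor_flip (pure c d))"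
      by (simp add: tensor_lift_pure[OF Z.module_axioms bil] tensor_flip_pure linear_map.neg[OF proj_hom])
        (simp add: angle_proj)
  qed (use assms in simp)
  finally show ?thesis .
qed

lemma proj_tensor_flip_A: "n \<in> tkk_A R P \<Longrightarrow> proj (tensor_flip n) = \<zero>\<^bsub>Z\<^esub>"
  using tensor_flip_A A.a_rcos_const by (simp add: Z_quotient A.quotient_zero)

lemma flip_linear: "flip \<in> module_hom R Z Z"
proof -
  have "(\<lambda>X. proj (tensor_flip (coset_rep X))) \<in> module_hom R Z Z"
    using A.quotient_lift(2)[OF Z.module_axioms proj_tensor_flip_linear proj_tensor_flip_A] by (simp add: Z_quotient)
  then show ?thesis
    by (simp add: module_hom_def flip_proj_tensor_flip Pi_iff)
qed

sublocale flip: linear_map R Z Z flip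
  using flip_linear Z.module_axioms by (simp add: linear_map_def linear_map_axioms_def)

lemma flip_angle:
  assumes "c \<in> carrier S" "d \<in> carrier S"
  shows "flip (angle c d) = \<ominus>\<^bsub>Z\<^esub> angle d c"
proof -
  have cd: "c \<in> carrier (neg P)" "d \<in> carrier (pos P)" "d \<in> carrier (neg P)" "c \<in> carrier (pos P)"
    using assms by (simp_all add: P_simps truncate_simps)
  have "flip (angle c d) = proj (tensor_flip (coset_rep (proj (pure c d))))"
    using cd by (simp add: flip_proj_tensor_flip angle_proj)
  also have "\<dots> = proj (tensor_flip (pure c d))"
    using cd by (intro A.quotient_lift(1)[OF Z.module_axioms proj_tensor_flip_linear proj_tensor_flip_A]) simp_all
  also have "\<dots> = \<ominus>\<^bsub>Z\<^esub> angle d c"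
    using cd by (simp add: tensor_flip_pure linear_map.neg[OF proj_hom] angle_proj)
  finally show ?thesis .
qed

lemma involution_apply: "TKK_involution R S (a, X, b) = (b, flip X, a)"
  by (simp add: TKK_involution_def Let_def flip_def)

end

lemma anti_graded_involutionD:
  assumes "anti_graded_involution R L G \<epsilon>"
  shows "\<epsilon> \<in> module_hom R L L"
    and "x \<in> carrier L \<Longrightarrow> y \<in> carrier L \<Longrightarrow> \<epsilon> \<lblot>x, y\<rblot>\<^bsub>L\<^esub> = \<lblot>\<epsilon> x, \<epsilon> y\<rblot>\<^bsub>L\<^esub>"
    and "x \<in> carrier L \<Longrightarrow> \<epsilon> (\<epsilon> x) = x" and "x \<in> G i \<Longrightarrow> \<epsilon> x \<in> G (- i)"
  using assms unfolding anti_graded_involution_def lie_hom_def by blast+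

text \<open>
  An involutary extension agrees with $\varepsilon\gamma$ on $T_-$ because $\widehat\kappa$ maps
  $a_+$ to $a_-$. Conversely, the extension of $(\varepsilon\gamma,\gamma)$ is involutary: on
  $\langle a,b\rangle$ this is $-[\varepsilon\gamma b,\gamma a]=[\gamma a,\varepsilon\gamma b]
  =\varepsilon[\varepsilon\gamma a,\gamma b]$.
\<close>

theorem involutary_extension:
  assumes grad: "three_graded R L G" and inv: "anti_graded_involution R L G \<epsilon>"
    and trip: "jordan_triple_system R S" and hom: "g0 \<in> jordan_triple_hom R S (lie_triple L G \<epsilon>)"
  shows "\<exists>!g. g \<in> extensional (carrier (TKK R (pair_of_triple S))) \<and>
              g \<in> involutary_hom R (TKK R (pair_of_triple S)) (TKK_grading R (pair_of_triple S))
                    (TKK_involution R S) L G \<epsilon> \<and>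
              (\<forall>a\<in>carrier S. g (in_pos R (pair_of_triple S) a) = g0 a)"
proof -
  note gradD = three_gradedD[OF grad] and invD = anti_graded_involutionD[OF inv]
  interpret trilinear_triple R S
    using trip by (simp add: jordan_triple_system_def jordan_axioms_def trilinear_triple_def)
  interpret L: lie_alg R L by (rule gradD)
  interpret e: linear_map R L L \<epsilon> using invD(1) by unfold_locales
  have g0: "g0 a \<in> G 1" "g0 a \<in> carrier L" if "a \<in> carrier S" for a
    using hom that gradD(5) by (auto simp: jordan_triple_hom_def module_hom_def lie_triple_def)
  have carr: "carrier (neg P) = carrier S" "carrier (pos P) = carrier S"
    by (simp_all add: P_simps truncate_simps)
  have pair_hom: "(\<lambda>a. \<epsilon> (g0 a), g0) \<in> jordan_pair_hom R P (lie_jordan_pair L G)"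
    using hom g0 invD
    by (auto simp: jordan_triple_hom_def jordan_pair_hom_def module_hom_def lie_jordan_pair_simps
        lie_triple_def P_simps truncate_simps)
  note into = pair_into_lieI[OF grad pair_hom]
  interpret pair_into_lie R P L "\<lambda>a. \<epsilon> (g0 a)" g0 by (rule into)
  have flip_pairing: "pairing (coset_rep (flip X)) = \<epsilon> (pairing (coset_rep X))" if "X \<in> carrier Z" for X
  proof (rule Z_eqI[OF L.module_axioms module_hom_compose[OF flip_linear pairing_Z.linear]
          module_hom_compose[OF pairing_Z.linear e.linear] _ that])
    fix a b assume "a \<in> carrier (neg P)" "b \<in> carrier (pos P)"
    then have ab: "a \<in> carrier S" "b \<in> carrier S" by (simp_all add: carr)
    then have "pairing (coset_rep (flip (angle a b))) = \<ominus>\<^bsub>L\<^esub> \<lblot>\<epsilon> (g0 b), g0 a\<rblot>\<^bsub>L\<^esub>"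
      by (simp add: flip_angle carr pairing_Z.neg) (simp add: angle_proj carr pairing_rep pairing_pure)
    also have "\<dots> = \<lblot>g0 a, \<epsilon> (g0 b)\<rblot>\<^bsub>L\<^esub>"
      using ab g0 by (intro L.bracket_antisym[symmetric]) auto
    also have "\<dots> = \<epsilon> (pairing (coset_rep (angle a b)))"
      using ab g0 by (simp add: angle_proj carr pairing_rep pairing_pure invD)
    finally show "pairing (coset_rep (flip (angle a b))) = \<epsilon> (pairing (coset_rep (angle a b)))" .
  qed
  show ?thesis
  proof (rule ex1I[of _ extension], intro conjI)
    have "extension (TKK_involution R S x) = \<epsilon> (extension x)" if "x \<in> carrier (TKK R P)" for x
    proof -
      obtain a X b where "x = (a, X, b)" by (cases x)
      moreover from this have "a \<in> carrier S" "X \<in> carrier Z" "b \<in> carrier S"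
        using that by (simp_all add: TKK_simps carr)
      ultimately show ?thesis
        using g0 by (simp add: involution_apply extension_apply carr flip_pairing invD L.M.a_ac)
    qed
    moreover have "extension ` TKK_grading R P i \<subseteq> G i" for i
      using extension_graded[of G i, OF gradD(2) into(2,3)] gradD(4)[of _ "-1" _ 1] by simp
    ultimately show "extension \<in> involutary_hom R (TKK R P) (TKK_grading R P) (TKK_involution R S) L G \<epsilon>"
      by (simp add: involutary_hom_def graded_lie_hom_def extension_lie_hom)
    show "\<forall>a\<in>carrier S. extension (in_pos R P a) = g0 a" by (simp add: extension_in_pos carr)
  next
    fix g assume g: "g \<in> extensional (carrier (TKK R P)) \<and>
        g \<in> involutary_hom R (TKK R P) (TKK_grading R P) (TKK_involution R S) L G \<epsilon> \<and>
        (\<forall>a\<in>carrier S. g (in_pos R P a) = g0 a)"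
    have "g (in_neg R P a) = \<epsilon> (g0 a)" if "a \<in> carrier S" for a
    proof -
      have "in_neg R P a = TKK_involution R S (in_pos R P a)"
        by (simp add: in_neg_def in_pos_def involution_apply P_simps truncate_simps)
      moreover have "in_pos R P a \<in> carrier (TKK R P)" using that by (simp add: in_pos_def TKK_simps carr(2))
      ultimately show ?thesis using g that by (simp add: involutary_hom_def)
    qed
    with g show "g = extension"
      by (intro extension_unique) (auto simp: carr involutary_hom_def graded_lie_hom_def)
  qed (simp add: extension_def)
qed

section \<open>Lie algebras graded by A1\<close>

lemma (in abelian_group) double_cancel:
  assumes no2: "\<And>x. x \<in> carrier G \<Longrightarrow> x \<oplus> x = \<zero> \<Longrightarrow> x = \<zero>"
    and "x \<in> carrier G" "y \<in> carrier G" "x \<oplus> x = y \<oplus> y"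
  shows "x = y"
proof -
  have "(x \<ominus> y) \<oplus> (x \<ominus> y) = (x \<oplus> x) \<ominus> (y \<oplus> y)"
    using assms(2,3) by (simp add: a_minus_def minus_add a_ac)
  also have "\<dots> = \<zero>" using assms(2-4) by (simp add: minus_eq_zero_iff)
  finally show ?thesis using no2[of "x \<ominus> y"] assms(2,3) by (simp add: minus_eq_zero_iff)
qed

locale A1_lie = lie_alg R L
  for R :: "('k, 'r) ring_scheme" and L :: "('k, 'l, 'x) lie_algebra_scheme" +
  fixes h e f
  assumes A1: "A1_graded R L (h, e, f)"
begin

abbreviation G where "G \<equiv> A1_grading L (h, e, f)"
abbreviation br (\<open>\<lbrakk>_, _\<rbrakk>\<close>) where "\<lbrakk>x, y\<rbrakk> \<equiv> \<lblot>x, y\<rblot>\<^bsub>L\<^esub>"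
abbreviation plus (infixl \<open>\<^bold>+\<close> 65) where "x \<^bold>+ y \<equiv> x \<oplus>\<^bsub>L\<^esub> y"
abbreviation neg' (\<open>\<^bold>- _\<close> [81] 80) where "\<^bold>- x \<equiv> \<ominus>\<^bsub>L\<^esub> x"
abbreviation zero' (\<open>\<^bold>0\<close>) where "\<^bold>0 \<equiv> \<zero>\<^bsub>L\<^esub>"

lemma graded: "three_graded R L G"
  using A1 by (simp add: A1_graded_def)

lemmas G_sub = three_gradedD(2)[OF graded]
lemmas G_bracket = three_gradedD(4)[OF graded]
lemmas G_closed = three_gradedD(5)[OF graded]

lemma two_mult: "x \<in> carrier L \<Longrightarrow> [(2::int)] \<cdot>\<^bsub>L\<^esub> x = x \<^bold>+ x"
  and minus_two_mult: "x \<in> carrier L \<Longrightarrow> [(-2::int)] \<cdot>\<^bsub>L\<^esub> x = \<^bold>- (x \<^bold>+ x)"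
  and zero_mult: "[(0::int)] \<cdot>\<^bsub>L\<^esub> x = \<^bold>0"
  by (simp_all add: add_pow_int_ge add_pow_int_lt numeral_2_eq_2)

lemma triple_closed: "h \<in> carrier L" "e \<in> carrier L" "f \<in> carrier L"
  and ef: "\<lbrakk>e, f\<rbrakk> = h" and he: "\<lbrakk>h, e\<rbrakk> = e \<^bold>+ e" and hf: "\<lbrakk>h, f\<rbrakk> = \<^bold>- (f \<^bold>+ f)"
  using A1 by (auto simp: A1_graded_def sl2_triple_def two_mult minus_two_mult)

lemma G_iff:
  "x \<in> G 1 \<longleftrightarrow> x \<in> carrier L \<and> \<lbrakk>h, x\<rbrakk> = x \<^bold>+ x"
  "x \<in> G 0 \<longleftrightarrow> x \<in> carrier L \<and> \<lbrakk>h, x\<rbrakk> = \<^bold>0"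
  "x \<in> G (-1) \<longleftrightarrow> x \<in> carrier L \<and> \<lbrakk>h, x\<rbrakk> = \<^bold>- (x \<^bold>+ x)"
  by (auto simp: A1_grading_def two_mult minus_two_mult zero_mult)

lemma G_zero: "\<^bold>0 \<in> G i"
  using subgroup.one_closed[OF submodule.axioms(1)[OF G_sub]] by simp

lemma split_zero:
  assumes "a \<in> G (-1)" "x \<in> G 0" "b \<in> G 1" "a \<^bold>+ x \<^bold>+ b = \<^bold>0"
  shows "a = \<^bold>0" "x = \<^bold>0" "b = \<^bold>0"
proof -
  have inj: "inj_on (\<lambda>(a, x, b). a \<^bold>+ x \<^bold>+ b) (G (-1) \<times> G 0 \<times> G 1)"
    using graded by (auto simp: three_graded_def bij_betw_def)
  have "(a, x, b) = (\<^bold>0, \<^bold>0, \<^bold>0)"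
    using assms by (intro inj_onD[OF inj]) (simp_all add: G_zero)
  then show "a = \<^bold>0" "x = \<^bold>0" "b = \<^bold>0" by simp_all
qed

text \<open>
  The components of a 2-torsion element are 2-torsion. If $2a=0$ with $a\in L_{\pm1}$, then
  $[h,a]=\pm2a=0$ and $a\in L_0$; if $2y=0$ with $y\in L_0$, then $[h,y]=0=2y$ and $y\in L_1$. As the
  sum of the components is direct, all of them are zero.
\<close>

lemma no_two_torsion:
  assumes "x \<in> carrier L" "x \<^bold>+ x = \<^bold>0"
  shows "x = \<^bold>0"
proof -
  have "(\<lambda>(a, x, b). a \<^bold>+ x \<^bold>+ b) ` (G (-1) \<times> G 0 \<times> G 1) = carrier L"
    using graded by (auto simp: three_graded_def bij_betw_def)
  then obtain a y b where *: "a \<in> G (-1)" "y \<in> G 0" "b \<in> G 1" "x = a \<^bold>+ y \<^bold>+ b"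
    using assms(1) by (force simp: image_iff)
  note cl = *(1-3)[THEN G_closed]
  have "(a \<^bold>+ a) \<^bold>+ (y \<^bold>+ y) \<^bold>+ (b \<^bold>+ b) = \<^bold>0"
    using assms(2) cl by (simp add: *(4) M.a_ac)
  then have tw: "a \<^bold>+ a = \<^bold>0" "y \<^bold>+ y = \<^bold>0" "b \<^bold>+ b = \<^bold>0"
    using split_zero[of "a \<^bold>+ a" "y \<^bold>+ y" "b \<^bold>+ b"] *(1-3) submoduleE(5)[OF G_sub] by blast+
  have neg0: "\<^bold>- \<^bold>0 = \<^bold>0" by (rule M.minus_equality) simp_all
  have "a \<in> G 0" "y \<in> G 1" "b \<in> G 0"
    using *(1-3) tw by (simp_all add: G_iff neg0)
  note mem = this
  have "a = \<^bold>0"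
    using *(1) mem(1) cl(1) by (intro split_zero(1)[of a "\<^bold>- a" "\<^bold>0"] submoduleE(3)[OF G_sub] G_zero)
      (simp_all add: M.r_neg)
  moreover have "y = \<^bold>0"
    using *(2) mem(2) cl(2) by (intro split_zero(2)[of "\<^bold>0" y "\<^bold>- y"] submoduleE(3)[OF G_sub] G_zero)
      (simp_all add: M.r_neg)
  moreover have "b = \<^bold>0"
    using *(3) mem(3) cl(3) by (intro split_zero(3)[of "\<^bold>0" "\<^bold>- b" b] submoduleE(3)[OF G_sub] G_zero)
      (simp_all add: M.l_neg)
  ultimately show ?thesis by (simp add: *(4))
qed

lemma double_cancel_L: "x \<in> carrier L \<Longrightarrow> y \<in> carrier L \<Longrightarrow> x \<^bold>+ x = y \<^bold>+ y \<Longrightarrow> x = y"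
  by (rule M.double_cancel) (auto intro: no_two_torsion)

lemma ef_mem: "e \<in> G 1" "f \<in> G (-1)"
  by (simp_all add: G_iff triple_closed he hf)

lemma fe: "\<lbrakk>f, e\<rbrakk> = \<^bold>- h"
  using bracket_antisym[of f e] by (simp add: triple_closed ef)

lemma G_bracket_1: "x \<in> G 1 \<Longrightarrow> y \<in> G 1 \<Longrightarrow> \<lbrakk>x, y\<rbrakk> = \<^bold>0"
  using G_bracket[of x 1 y 1] three_gradedD(3)[OF graded, of 2] by simp

lemma G_bracket_m1: "x \<in> G (-1) \<Longrightarrow> y \<in> G (-1) \<Longrightarrow> \<lbrakk>x, y\<rbrakk> = \<^bold>0"
  using G_bracket[of x "-1" y "-1"] three_gradedD(3)[OF graded, of "-2"] by simp

lemma F_mem: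
  assumes "x \<in> G 1"
  shows "\<lbrakk>f, x\<rbrakk> \<in> G 0" "\<lbrakk>f, \<lbrakk>f, x\<rbrakk>\<rbrakk> \<in> G (-1)"
  using G_bracket[OF ef_mem(2) assms] G_bracket[OF ef_mem(2) G_bracket[OF ef_mem(2) assms]] by simp_all

lemma EF:
  assumes "x \<in> G 1"
  shows "\<lbrakk>e, \<lbrakk>f, x\<rbrakk>\<rbrakk> = x \<^bold>+ x" "\<lbrakk>e, \<lbrakk>f, \<lbrakk>f, x\<rbrakk>\<rbrakk>\<rbrakk> = \<lbrakk>f, x\<rbrakk> \<^bold>+ \<lbrakk>f, x\<rbrakk>"
proof -
  note cl = G_closed[OF assms] triple_closed
  have hx: "\<lbrakk>h, x\<rbrakk> = x \<^bold>+ x" and hFx: "\<lbrakk>h, \<lbrakk>f, x\<rbrakk>\<rbrakk> = \<^bold>0"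
    using assms F_mem(1)[OF assms] G_iff by blast+
  have ex: "\<lbrakk>e, x\<rbrakk> = \<^bold>0" by (rule G_bracket_1[OF ef_mem(1) assms])
  have "\<lbrakk>e, \<lbrakk>f, x\<rbrakk>\<rbrakk> = \<lbrakk>\<lbrakk>e, f\<rbrakk>, x\<rbrakk> \<^bold>+ \<lbrakk>f, \<lbrakk>e, x\<rbrakk>\<rbrakk>" using cl by (intro bracket_derivation) auto
  with cl show 1: "\<lbrakk>e, \<lbrakk>f, x\<rbrakk>\<rbrakk> = x \<^bold>+ x" by (simp add: ef hx ex bracket_zero)
  have "\<lbrakk>e, \<lbrakk>f, \<lbrakk>f, x\<rbrakk>\<rbrakk>\<rbrakk> = \<lbrakk>\<lbrakk>e, f\<rbrakk>, \<lbrakk>f, x\<rbrakk>\<rbrakk> \<^bold>+ \<lbrakk>f, \<lbrakk>e, \<lbrakk>f, x\<rbrakk>\<rbrakk>\<rbrakk>"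
    using cl by (intro bracket_derivation) auto
  with cl show "\<lbrakk>e, \<lbrakk>f, \<lbrakk>f, x\<rbrakk>\<rbrakk>\<rbrakk> = \<lbrakk>f, x\<rbrakk> \<^bold>+ \<lbrakk>f, x\<rbrakk>"
    by (simp add: ef 1 hFx bracket_add)
qed

lemma FE:
  assumes "z \<in> G (-1)"
  shows "\<lbrakk>f, \<lbrakk>e, z\<rbrakk>\<rbrakk> = z \<^bold>+ z"
proof -
  note cl = G_closed[OF assms] triple_closed
  have hz: "\<lbrakk>h, z\<rbrakk> = \<^bold>- (z \<^bold>+ z)" using assms G_iff by blast
  have fz: "\<lbrakk>f, z\<rbrakk> = \<^bold>0" by (rule G_bracket_m1[OF ef_mem(2) assms])
  have "\<lbrakk>f, \<lbrakk>e, z\<rbrakk>\<rbrakk> = \<lbrakk>\<lbrakk>f, e\<rbrakk>, z\<rbrakk> \<^bold>+ \<lbrakk>e, \<lbrakk>f, z\<rbrakk>\<rbrakk>" using cl by (intro bracket_derivation) auto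
  with cl show ?thesis by (simp add: fe hz fz bracket_zero bracket_neg)
qed

text \<open>
  Write $F=\mathrm{ad}\,f$ and let $z\in L_{-1}$ be the sum of the two brackets. From
  $[e,F^2x]=2Fx$ and $[e,Fx]=2x$ one gets
  $[e,z]=2([F^2x,y]+2[Fx,Fy]+[x,F^2y])=2F^2[x,y]=0$. On the other hand $[f,[e,z]]=2z$ for
  $z\in L_{-1}$, so $z$ is a 2-torsion element.
\<close>

lemma F2_alternating:
  assumes x: "x \<in> G 1" and y: "y \<in> G 1"
  shows "\<lbrakk>\<lbrakk>f, \<lbrakk>f, x\<rbrakk>\<rbrakk>, \<lbrakk>f, y\<rbrakk>\<rbrakk> = \<^bold>- \<lbrakk>\<lbrakk>f, x\<rbrakk>, \<lbrakk>f, \<lbrakk>f, y\<rbrakk>\<rbrakk>\<rbrakk>"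
proof -
  define x1 x2 y1 y2 where "x1 = \<lbrakk>f, x\<rbrakk>" "x2 = \<lbrakk>f, \<lbrakk>f, x\<rbrakk>\<rbrakk>" "y1 = \<lbrakk>f, y\<rbrakk>" "y2 = \<lbrakk>f, \<lbrakk>f, y\<rbrakk>\<rbrakk>"
  note d = x1_x2_y1_y2_def
  have mem: "x1 \<in> G 0" "x2 \<in> G (-1)" "y1 \<in> G 0" "y2 \<in> G (-1)"
    using F_mem[OF x] F_mem[OF y] by (simp_all add: d)
  note cl = mem[THEN G_closed] G_closed[OF x] G_closed[OF y] triple_closed
  have E: "\<lbrakk>e, x1\<rbrakk> = x \<^bold>+ x" "\<lbrakk>e, x2\<rbrakk> = x1 \<^bold>+ x1" "\<lbrakk>e, y1\<rbrakk> = y \<^bold>+ y" "\<lbrakk>e, y2\<rbrakk> = y1 \<^bold>+ y1"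
    using EF[OF x] EF[OF y] by (simp_all add: d)
  have F: "\<lbrakk>f, x\<rbrakk> = x1" "\<lbrakk>f, x1\<rbrakk> = x2" "\<lbrakk>f, y\<rbrakk> = y1" "\<lbrakk>f, y1\<rbrakk> = y2"
    by (simp_all add: d)
  define z where "z = \<lbrakk>x2, y1\<rbrakk> \<^bold>+ \<lbrakk>x1, y2\<rbrakk>"
  have "z \<in> G (-1)"
    unfolding z_def using G_bracket[OF mem(2,3)] G_bracket[OF mem(1,4)]
    by (simp add: submoduleE(5)[OF G_sub])
  \<comment> \<open>this is F applied twice to the bracket of x and y, which is zero in degree 2\<close>
  have s: "\<lbrakk>x2, y\<rbrakk> \<^bold>+ (\<lbrakk>x1, y1\<rbrakk> \<^bold>+ \<lbrakk>x1, y1\<rbrakk>) \<^bold>+ \<lbrakk>x, y2\<rbrakk> = \<^bold>0"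
  proof -
    have "\<lbrakk>x1, y\<rbrakk> \<^bold>+ \<lbrakk>x, y1\<rbrakk> = \<^bold>0"
      using bracket_derivation[of x y f] G_bracket_1[OF x y] cl by (simp add: F bracket_zero)
    then have "\<lbrakk>f, \<lbrakk>x1, y\<rbrakk> \<^bold>+ \<lbrakk>x, y1\<rbrakk>\<rbrakk> = \<^bold>0" using cl by (simp add: bracket_zero)
    then show ?thesis
      using bracket_derivation[of x1 y f] bracket_derivation[of x y1 f] cl
      by (simp add: F bracket_add M.a_ac)
  qed
  have "\<lbrakk>e, z\<rbrakk> = (\<lbrakk>x2, y\<rbrakk> \<^bold>+ (\<lbrakk>x1, y1\<rbrakk> \<^bold>+ \<lbrakk>x1, y1\<rbrakk>) \<^bold>+ \<lbrakk>x, y2\<rbrakk>) \<^bold>+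
      (\<lbrakk>x2, y\<rbrakk> \<^bold>+ (\<lbrakk>x1, y1\<rbrakk> \<^bold>+ \<lbrakk>x1, y1\<rbrakk>) \<^bold>+ \<lbrakk>x, y2\<rbrakk>)"
    using bracket_derivation[of x2 y1 e] bracket_derivation[of x1 y2 e] cl
    by (simp add: z_def E bracket_add M.a_ac)
  then have "\<lbrakk>e, z\<rbrakk> = \<^bold>0" by (simp add: s)
  then have "z \<^bold>+ z = \<^bold>0" using FE[OF \<open>z \<in> G (-1)\<close>] triple_closed by (simp add: bracket_zero)
  then have "z = \<^bold>0" by (rule no_two_torsion[OF G_closed[OF \<open>z \<in> G (-1)\<close>]])
  then have "\<^bold>- \<lbrakk>x1, y2\<rbrakk> = \<lbrakk>x2, y1\<rbrakk>"
    using cl unfolding z_def by (intro M.minus_equality) auto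
  then show ?thesis by (simp add: d)
qed

definition jprod (infixl \<open>\<bullet>\<close> 70) where "a \<bullet> b = \<lbrakk>\<lbrakk>a, f\<rbrakk>, b\<rbrakk>"

text \<open>
  The value on $a_-$ that is forced by $a=\{1,a,1\}$ when $1_-$ is sent to $f$.
\<close>

definition lower where "lower a = \<lbrakk>\<lbrakk>f, a\<rbrakk>, f\<rbrakk>"

lemma jprod_mem: "a \<in> G 1 \<Longrightarrow> b \<in> G 1 \<Longrightarrow> a \<bullet> b \<in> G 1"
  using G_bracket[OF G_bracket[OF _ ef_mem(2)], of a 1 b 1] by (simp add: jprod_def)

lemma lower_mem: "a \<in> G 1 \<Longrightarrow> lower a \<in> G (-1)"
  using G_bracket[OF F_mem(1) ef_mem(2)] by (simp add: lower_def)

lemma lower_linear: "lower \<in> module_hom R L L"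
  unfolding lower_def
  using module_hom_compose[OF linear_map.linear[OF bracket_linear(1)] linear_map.linear[OF bracket_linear(2)]]
  by (simp add: triple_closed)

sublocale lower: linear_map R L L lower using lower_linear by unfold_locales

lemma lower_F2: "a \<in> G 1 \<Longrightarrow> lower a = \<^bold>- \<lbrakk>f, \<lbrakk>f, a\<rbrakk>\<rbrakk>"
  unfolding lower_def using G_closed triple_closed by (intro bracket_antisym) auto

lemma lower_H: "a \<in> G 1 \<Longrightarrow> lower a = \<^bold>- \<lbrakk>\<lbrakk>a, f\<rbrakk>, f\<rbrakk>"
  using bracket_antisym[of f a] G_closed triple_closed by (simp add: lower_def bracket_neg)

text \<open>
  With $H_a=[a,f]$ this reads $[a,b']=H_{ba}-[H_b,H_a]$, and $H_a$ acts on $L_1$ as multiplication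
  by $a$. So $[a,b']$ acts on $L_1$ as $V_{a,b}$ of the Jordan algebra.
\<close>

lemma bracket_lower:
  assumes a: "a \<in> G 1" and b: "b \<in> G 1"
  shows "\<lbrakk>a, lower b\<rbrakk> = \<lbrakk>b \<bullet> a, f\<rbrakk> \<^bold>+ \<^bold>- \<lbrakk>\<lbrakk>b, f\<rbrakk>, \<lbrakk>a, f\<rbrakk>\<rbrakk>"
proof -
  note cl = G_closed[OF a] G_closed[OF b] triple_closed
  have "\<lbrakk>a, \<lbrakk>\<lbrakk>b, f\<rbrakk>, f\<rbrakk>\<rbrakk> = \<lbrakk>\<lbrakk>a, \<lbrakk>b, f\<rbrakk>\<rbrakk>, f\<rbrakk> \<^bold>+ \<lbrakk>\<lbrakk>b, f\<rbrakk>, \<lbrakk>a, f\<rbrakk>\<rbrakk>"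
    using cl by (intro bracket_derivation) auto
  moreover have "\<lbrakk>a, \<lbrakk>b, f\<rbrakk>\<rbrakk> = \<^bold>- (b \<bullet> a)"
    unfolding jprod_def using cl by (intro bracket_antisym) auto
  ultimately show ?thesis
    using cl by (simp add: lower_H[OF b] bracket_neg M.minus_add jprod_def)
qed

lemma H_commutator:
  assumes "a \<in> G 1" "b \<in> G 1" "x \<in> carrier L"
  shows "\<lbrakk>\<lbrakk>\<lbrakk>a, f\<rbrakk>, \<lbrakk>b, f\<rbrakk>\<rbrakk>, x\<rbrakk> = \<lbrakk>\<lbrakk>a, f\<rbrakk>, \<lbrakk>\<lbrakk>b, f\<rbrakk>, x\<rbrakk>\<rbrakk> \<^bold>+ \<^bold>- \<lbrakk>\<lbrakk>b, f\<rbrakk>, \<lbrakk>\<lbrakk>a, f\<rbrakk>, x\<rbrakk>\<rbrakk>"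
  using bracket_derivation[of "\<lbrakk>b, f\<rbrakk>" x "\<lbrakk>a, f\<rbrakk>"] G_closed[OF assms(1)] G_closed[OF assms(2)]
    assms(3) triple_closed
  by (simp add: M.a_assoc M.r_neg)

lemma triple_pos:
  assumes "a \<in> G 1" "b \<in> G 1" "c \<in> G 1"
  shows "\<lbrakk>\<lbrakk>a, lower b\<rbrakk>, c\<rbrakk> = (b \<bullet> a) \<bullet> c \<^bold>+ a \<bullet> (b \<bullet> c) \<^bold>+ \<^bold>- (b \<bullet> (a \<bullet> c))"
proof -
  note cl = assms[THEN G_closed] triple_closed jprod_mem[OF assms(2,1), THEN G_closed]
  show ?thesis
    using cl H_commutator[OF assms(2,1) cl(3)]
    by (simp add: bracket_lower assms bracket_add bracket_neg M.minus_add)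
      (simp add: jprod_def M.a_ac)
qed

text \<open>
  Applying $F^2$ to $-xy=[Fx,y]$ gives $2[F^2x,Fy]+[Fx,F^2y]$, as $F^3x=0$. By
  \<open>F2_alternating\<close> this is $-[Fx,F^2y]$, which up to signs is the left side.
\<close>

lemma H_lower:
  assumes x: "x \<in> G 1" and y: "y \<in> G 1"
  shows "\<lbrakk>\<lbrakk>x, f\<rbrakk>, lower y\<rbrakk> = \<^bold>- lower (x \<bullet> y)"
proof -
  note cl = G_closed[OF x] G_closed[OF y] triple_closed
  have mem: "\<lbrakk>f, \<lbrakk>f, x\<rbrakk>\<rbrakk> \<in> G (-1)" by (rule F_mem[OF x])
  have H: "\<lbrakk>x, f\<rbrakk> = \<^bold>- \<lbrakk>f, x\<rbrakk>" using cl by (intro bracket_antisym) auto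
  have xy: "x \<bullet> y = \<^bold>- \<lbrakk>\<lbrakk>f, x\<rbrakk>, y\<rbrakk>" using cl by (simp add: jprod_def H bracket_neg)
  have "\<lbrakk>f, \<lbrakk>f, \<lbrakk>\<lbrakk>f, x\<rbrakk>, y\<rbrakk>\<rbrakk>\<rbrakk> = \<lbrakk>\<lbrakk>f, \<lbrakk>f, x\<rbrakk>\<rbrakk>, \<lbrakk>f, y\<rbrakk>\<rbrakk> \<^bold>+ \<lbrakk>\<lbrakk>f, \<lbrakk>f, x\<rbrakk>\<rbrakk>, \<lbrakk>f, y\<rbrakk>\<rbrakk> \<^bold>+ \<lbrakk>\<lbrakk>f, x\<rbrakk>, \<lbrakk>f, \<lbrakk>f, y\<rbrakk>\<rbrakk>\<rbrakk>"
    using bracket_derivation[of "\<lbrakk>f, x\<rbrakk>" y f] bracket_derivation[of "\<lbrakk>f, \<lbrakk>f, x\<rbrakk>\<rbrakk>" y f]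
      bracket_derivation[of "\<lbrakk>f, x\<rbrakk>" "\<lbrakk>f, y\<rbrakk>" f] G_bracket_m1[OF ef_mem(2) mem] cl
    by (simp add: bracket_add bracket_zero M.a_ac)
  also have "\<dots> = \<^bold>- \<lbrakk>\<lbrakk>f, x\<rbrakk>, \<lbrakk>f, \<lbrakk>f, y\<rbrakk>\<rbrakk>\<rbrakk>"
    using F2_alternating[OF x y] cl by (simp add: M.a_assoc M.l_neg)
  finally have "\<lbrakk>f, \<lbrakk>f, x \<bullet> y\<rbrakk>\<rbrakk> = \<lbrakk>\<lbrakk>f, x\<rbrakk>, \<lbrakk>f, \<lbrakk>f, y\<rbrakk>\<rbrakk>\<rbrakk>"
    using cl by (simp add: xy bracket_neg)
  then show ?thesis
    using cl by (simp add: lower_F2[OF y] lower_F2[OF jprod_mem[OF x y]] H bracket_neg)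
qed

text \<open>
  The element $[a',b]=-[b,a']$ is given by \<open>bracket_lower\<close>, and by \<open>H_lower\<close> each
  $H_x$ sends $y'$ to $-(xy)'$.
\<close>

lemma triple_neg:
  assumes "a \<in> G 1" "b \<in> G 1" "c \<in> G 1"
  shows "\<lbrakk>\<lbrakk>lower a, b\<rbrakk>, lower c\<rbrakk> =
    lower ((a \<bullet> b) \<bullet> c \<^bold>+ a \<bullet> (b \<bullet> c) \<^bold>+ \<^bold>- (b \<bullet> (a \<bullet> c)))"
proof -
  note cl = assms[THEN G_closed] triple_closed lower_mem[OF assms(1), THEN G_closed]
    lower_mem[OF assms(3), THEN G_closed]
  note mem = jprod_mem[OF assms(1,2)] jprod_mem[OF assms(2,3)] jprod_mem[OF assms(1,3)]
  note cl' = mem[THEN G_closed] jprod_mem[OF mem(1) assms(3), THEN G_closed]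
    jprod_mem[OF assms(1) mem(2), THEN G_closed] jprod_mem[OF assms(2) mem(3), THEN G_closed]
  have H: "\<lbrakk>\<lbrakk>x, f\<rbrakk>, \<lbrakk>\<lbrakk>y, f\<rbrakk>, lower c\<rbrakk>\<rbrakk> = lower (x \<bullet> (y \<bullet> c))"
    if xy: "x \<in> G 1" "y \<in> G 1" for x y
    using xy assms(3) G_closed[OF xy(1)] triple_closed lower_mem[OF jprod_mem[OF xy(2) assms(3)], THEN G_closed]
      lower_mem[OF jprod_mem[OF xy(1) jprod_mem[OF xy(2) assms(3)]], THEN G_closed]
    by (simp add: H_lower jprod_mem bracket_neg)
  have "\<lbrakk>lower a, b\<rbrakk> = \<^bold>- \<lbrakk>b, lower a\<rbrakk>" using cl by (intro bracket_antisym) auto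
  then have "\<lbrakk>lower a, b\<rbrakk> = \<^bold>- \<lbrakk>a \<bullet> b, f\<rbrakk> \<^bold>+ \<lbrakk>\<lbrakk>a, f\<rbrakk>, \<lbrakk>b, f\<rbrakk>\<rbrakk>"
    using cl cl' by (simp add: bracket_lower assms M.minus_add)
  then show ?thesis
    using cl cl' H_commutator[OF assms(1,2) cl(8)]
    by (simp add: bracket_add bracket_neg H_lower mem assms H M.a_ac)
qed

text \<open>
  Doubling $[[f,u],f]$ gives $[[f,e],f]=-[h,f]=2f$, and 2 can be cancelled in $L$.
\<close>

lemma half_e:
  assumes "u \<in> carrier L" "u \<^bold>+ u = e"
  shows "half L e = u" "lower u = f"
proof -
  show "half L e = u"
    unfolding half_def
  proof (rule the_equality)
    show "v = u" if "v \<in> carrier L \<and> v \<^bold>+ v = e" for v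
      by (rule double_cancel_L) (use that assms in simp_all)
  qed (simp add: assms)
  have "lower u \<^bold>+ lower u = lower e" using assms lower.add[of u u] by simp
  also have "\<dots> = f \<^bold>+ f"
    using triple_closed by (simp add: lower_def fe bracket_neg hf)
  finally show "lower u = f"
    by (rule double_cancel_L[rotated 2]) (use assms(1) triple_closed(3) in auto)
qed

end

section \<open>Jordan algebras\<close>

text \<open>
  Two polarizations of $q(x,x,x)=0$ without division. Substituting $u+v$ leaves
  $S(u,v)+S(v,u)=0$, where $S(u,v)$ collects the terms of degree two in $u$. Since $S$ is additive in
  its second argument and quadratic in the first, substituting $y+z$ for one variable here leaves the
  sum over the six permutations.
\<close>

lemma (in abelian_group) polarization:
  assumes closed: "\<And>x y z. x \<in> carrier G \<Longrightarrow> y \<in> carrier G \<Longrightarrow> z \<in> carrier G \<Longrightarrow> q x y z \<in> carrier G"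
    and add1: "\<And>x x' y z. x \<in> carrier G \<Longrightarrow> x' \<in> carrier G \<Longrightarrow> y \<in> carrier G \<Longrightarrow> z \<in> carrier G \<Longrightarrow>
        q (x \<oplus> x') y z = q x y z \<oplus> q x' y z"
    and add2: "\<And>x y y' z. x \<in> carrier G \<Longrightarrow> y \<in> carrier G \<Longrightarrow> y' \<in> carrier G \<Longrightarrow> z \<in> carrier G \<Longrightarrow>
        q x (y \<oplus> y') z = q x y z \<oplus> q x y' z"
    and add3: "\<And>x y z z'. x \<in> carrier G \<Longrightarrow> y \<in> carrier G \<Longrightarrow> z \<in> carrier G \<Longrightarrow> z' \<in> carrier G \<Longrightarrow>
        q x y (z \<oplus> z') = q x y z \<oplus> q x y z'"
    and cube: "\<And>x. x \<in> carrier G \<Longrightarrow> q x x x = \<zero>"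
    and xyz: "x \<in> carrier G" "y \<in> carrier G" "z \<in> carrier G"
  shows "q x y z \<oplus> q x z y \<oplus> q y x z \<oplus> q y z x \<oplus> q z x y \<oplus> q z y x = \<zero>"
proof -
  define S where "S u v = q u u v \<oplus> q u v u \<oplus> q v u u" for u v
  have S_closed: "S u v \<in> carrier G" if "u \<in> carrier G" "v \<in> carrier G" for u v
    using that by (simp add: S_def closed)
  have SS: "S u v \<oplus> S v u = \<zero>" if uv: "u \<in> carrier G" "v \<in> carrier G" for u v
  proof -
    have "q (u \<oplus> v) (u \<oplus> v) (u \<oplus> v) = q u u u \<oplus> (S u v \<oplus> S v u) \<oplus> q v v v"
      using uv by (simp add: S_def closed add1 add2 add3 a_ac)
    then show ?thesis using cube[of "u \<oplus> v"] uv by (simp add: cube[of u] cube[of v] S_closed)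
  qed
  let ?six = "q x y z \<oplus> q x z y \<oplus> q y x z \<oplus> q y z x \<oplus> q z x y \<oplus> q z y x"
  have six: "?six \<in> carrier G" using xyz by (simp add: closed)
  have "S x (y \<oplus> z) = S x y \<oplus> S x z" using xyz by (simp add: S_def closed add1 add2 add3 a_ac)
  moreover have "S (y \<oplus> z) x = S y x \<oplus> S z x \<oplus> ?six"
    using xyz by (simp add: S_def closed add1 add2 add3 a_ac)
  ultimately have "\<zero> = (S x y \<oplus> S y x) \<oplus> (S x z \<oplus> S z x) \<oplus> ?six"
    using SS[of x "y \<oplus> z"] xyz six S_closed by (simp add: a_ac)
  then show ?thesis using xyz six by (simp add: SS)
qed

text \<open>
  The bookkeeping for \<open>symmetrized_jordan\<close>: the twelve terms of \<open>D\<close> form four groups of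
  three, with signs $+,+,-,-$, and each group has the same double \<open>s\<close>.
\<close>

lemma (in abelian_group) linearized_combination:
  assumes "a1 \<in> carrier G" "a2 \<in> carrier G" "a3 \<in> carrier G" "b1 \<in> carrier G" "b2 \<in> carrier G"
      "b3 \<in> carrier G" "c1 \<in> carrier G" "c2 \<in> carrier G" "c3 \<in> carrier G" "d1 \<in> carrier G"
      "d2 \<in> carrier G" "d3 \<in> carrier G" "s \<in> carrier G"
    and "(a1 \<oplus> a2 \<oplus> a3) \<oplus> (a1 \<oplus> a2 \<oplus> a3) = s" "(b1 \<oplus> b2 \<oplus> b3) \<oplus> (b1 \<oplus> b2 \<oplus> b3) = s"
      "(c1 \<oplus> c2 \<oplus> c3) \<oplus> (c1 \<oplus> c2 \<oplus> c3) = s" "(d1 \<oplus> d2 \<oplus> d3) \<oplus> (d1 \<oplus> d2 \<oplus> d3) = s"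
    and D: "D = ((c1 \<oplus> a1 \<ominus> b1) \<ominus> (d1 \<oplus> b2 \<ominus> a2)) \<oplus> ((a3 \<oplus> c2 \<ominus> d2) \<ominus> (b3 \<oplus> d3 \<ominus> c3))"
  shows "D \<oplus> D = \<zero>"
proof -
  define A B C E where "A = a1 \<oplus> a2 \<oplus> a3" "B = b1 \<oplus> b2 \<oplus> b3" "C = c1 \<oplus> c2 \<oplus> c3" "E = d1 \<oplus> d2 \<oplus> d3"
  note defs = this
  have cl: "A \<in> carrier G" "B \<in> carrier G" "C \<in> carrier G" "E \<in> carrier G"
    using assms by (simp_all add: defs)
  have "D = (C \<oplus> A) \<ominus> (B \<oplus> E)"
    unfolding D defs using assms(1-13) by (simp add: a_minus_def minus_add a_ac)
  then have "D \<oplus> D = ((C \<oplus> C) \<oplus> (A \<oplus> A)) \<ominus> ((B \<oplus> B) \<oplus> (E \<oplus> E))"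
    using cl by (simp add: a_minus_def minus_add a_ac)
  also have "\<dots> = (s \<oplus> s) \<ominus> (s \<oplus> s)"
    using assms(14-17) by (simp add: defs)
  finally show ?thesis using assms(13) by (simp add: a_minus_def r_neg)
qed

locale jordan_algebra =
  fixes R :: "('k, 'r) ring_scheme" and J :: "('k, 'j, 'x) module_scheme"
  assumes jordan: "unital_jordan_algebra R J"
begin

sublocale J: module R J
  using jordan by (simp add: unital_jordan_algebra_def)

abbreviation jmult (infixl \<open>\<cdot>\<close> 70) where "a \<cdot> b \<equiv> a \<otimes>\<^bsub>J\<^esub> b"

lemma mult_bilinear: "bilinear_map R J J J (mult J)"
  using jordan by (simp add: unital_jordan_algebra_def)

lemmas mult_closed [simp] = bilinear_mapD(1)[OF mult_bilinear]
lemmas mult_simps = bilinear_mapD(2-5)[OF mult_bilinear]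

lemma mult_linear:
  "x \<in> carrier J \<Longrightarrow> linear_map R J J (\<lambda>y. x \<cdot> y)"
  "y \<in> carrier J \<Longrightarrow> linear_map R J J (\<lambda>x. x \<cdot> y)"
  using mult_bilinear J.module_axioms
  by (simp_all add: bilinear_map_def linear_map_def linear_map_axioms_def)

lemmas mult_minus = mult_linear[THEN linear_map.minus]
lemmas mult_neg = mult_linear[THEN linear_map.neg]

lemma mult_comm: "a \<in> carrier J \<Longrightarrow> b \<in> carrier J \<Longrightarrow> a \<cdot> b = b \<cdot> a"
  using jordan by (simp add: unital_jordan_algebra_def)

lemma jordan_identity:
  "a \<in> carrier J \<Longrightarrow> b \<in> carrier J \<Longrightarrow> ((a \<cdot> a) \<cdot> b) \<cdot> a = (a \<cdot> a) \<cdot> (b \<cdot> a)"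
  using jordan unfolding unital_jordan_algebra_def by blast

lemma one_closed [simp]: "\<one>\<^bsub>J\<^esub> \<in> carrier J"
  using jordan by (simp add: unital_jordan_algebra_def)

lemma one_mult:
  assumes "a \<in> carrier J"
  shows "\<one>\<^bsub>J\<^esub> \<cdot> a = a" "a \<cdot> \<one>\<^bsub>J\<^esub> = a"
proof -
  show "\<one>\<^bsub>J\<^esub> \<cdot> a = a" using jordan assms unfolding unital_jordan_algebra_def by blast
  then show "a \<cdot> \<one>\<^bsub>J\<^esub> = a" using mult_comm[OF assms one_closed] by simp
qed

text \<open>
  The polarization of $q(x,y,z)=((xy)b)z-(xy)(bz)$. As $q$ is symmetric in $x$ and $y$, the six
  permutations coincide in pairs; the resulting factor 2 cannot be removed because \<open>J\<close> may have
  2-torsion.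
\<close>

lemma linearized_jordan:
  assumes a: "a \<in> carrier J" and c: "c \<in> carrier J" and d: "d \<in> carrier J" and b: "b \<in> carrier J"
  defines "s \<equiv> (a \<cdot> b) \<cdot> (c \<cdot> d) \<oplus>\<^bsub>J\<^esub> (a \<cdot> c) \<cdot> (b \<cdot> d) \<oplus>\<^bsub>J\<^esub> (a \<cdot> d) \<cdot> (b \<cdot> c)"
  shows "(((a \<cdot> c) \<cdot> b) \<cdot> d \<oplus>\<^bsub>J\<^esub> ((a \<cdot> d) \<cdot> b) \<cdot> c \<oplus>\<^bsub>J\<^esub> ((c \<cdot> d) \<cdot> b) \<cdot> a) \<oplus>\<^bsub>J\<^esub>
    (((a \<cdot> c) \<cdot> b) \<cdot> d \<oplus>\<^bsub>J\<^esub> ((a \<cdot> d) \<cdot> b) \<cdot> c \<oplus>\<^bsub>J\<^esub> ((c \<cdot> d) \<cdot> b) \<cdot> a) = s \<oplus>\<^bsub>J\<^esub> s"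
    (is "?K \<oplus>\<^bsub>J\<^esub> ?K = _")
proof -
  define q where "q x y z = ((x \<cdot> y) \<cdot> b) \<cdot> z \<ominus>\<^bsub>J\<^esub> (x \<cdot> y) \<cdot> (b \<cdot> z)" for x y z
  have sc: "s \<in> carrier J" "?K \<in> carrier J" using a b c d by (simp_all add: s_def)
  have "q a c d \<oplus>\<^bsub>J\<^esub> q a d c \<oplus>\<^bsub>J\<^esub> q c a d \<oplus>\<^bsub>J\<^esub> q c d a \<oplus>\<^bsub>J\<^esub> q d a c \<oplus>\<^bsub>J\<^esub> q d c a = \<zero>\<^bsub>J\<^esub>"
  proof (rule J.M.polarization[where q = q])
    show "q x x x = \<zero>\<^bsub>J\<^esub>" if "x \<in> carrier J" for x
      using that b jordan_identity[of x b] by (simp add: q_def J.M.minus_eq_zero_iff)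
  qed (use a b c d in \<open>simp_all add: q_def mult_simps a_minus_def J.M.minus_add J.M.a_ac\<close>)
  moreover have "q c a d = q a c d" "q d a c = q a d c" "q d c a = q c d a"
    using mult_comm a c d by (simp_all add: q_def)
  moreover have cl: "q a c d \<in> carrier J" "q a d c \<in> carrier J" "q c d a \<in> carrier J"
    using a b c d by (simp_all add: q_def)
  ultimately have "(q a c d \<oplus>\<^bsub>J\<^esub> q a d c \<oplus>\<^bsub>J\<^esub> q c d a) \<oplus>\<^bsub>J\<^esub> (q a c d \<oplus>\<^bsub>J\<^esub> q a d c \<oplus>\<^bsub>J\<^esub> q c d a) = \<zero>\<^bsub>J\<^esub>"
    by (simp add: J.M.a_ac)
  moreover have "q a c d \<oplus>\<^bsub>J\<^esub> q a d c \<oplus>\<^bsub>J\<^esub> q c d a = ?K \<ominus>\<^bsub>J\<^esub> s"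
  proof -
    have "(c \<cdot> d) \<cdot> (b \<cdot> a) = (a \<cdot> b) \<cdot> (c \<cdot> d)" using a b c d mult_comm by simp
    then show ?thesis
      using a b c d by (simp add: q_def s_def a_minus_def J.M.minus_add J.M.a_ac)
  qed
  ultimately have "(?K \<ominus>\<^bsub>J\<^esub> s) \<oplus>\<^bsub>J\<^esub> (?K \<ominus>\<^bsub>J\<^esub> s) = \<zero>\<^bsub>J\<^esub>" by simp
  moreover have "(?K \<ominus>\<^bsub>J\<^esub> s) \<oplus>\<^bsub>J\<^esub> (?K \<ominus>\<^bsub>J\<^esub> s) = (?K \<oplus>\<^bsub>J\<^esub> ?K) \<ominus>\<^bsub>J\<^esub> (s \<oplus>\<^bsub>J\<^esub> s)"
    using sc by (simp only: a_minus_def J.M.minus_add J.M.a_ac J.M.a_closed J.M.a_inv_closed)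
  ultimately show ?thesis using sc by (simp only: J.M.minus_eq_zero_iff J.M.a_closed)
qed

abbreviation Tr where "Tr \<equiv> triple_of_algebra J"

lemma Tr_simps:
  "carrier Tr = carrier J" "add Tr = add J" "smult Tr = smult J" "zero Tr = zero J"
  "triple Tr a b c = ((a \<cdot> b) \<cdot> c \<oplus>\<^bsub>J\<^esub> a \<cdot> (b \<cdot> c)) \<ominus>\<^bsub>J\<^esub> b \<cdot> (c \<cdot> a)"
  by (simp_all add: triple_of_algebra_def)

sublocale trilinear_triple R Tr
proof (rule trilinear_triple.intro)
  show "module R Tr" by (rule module_cong[OF J.module_axioms]) (simp_all add: Tr_simps)
  have comm: "r \<odot>\<^bsub>J\<^esub> x \<ominus>\<^bsub>J\<^esub> r \<odot>\<^bsub>J\<^esub> y = r \<odot>\<^bsub>J\<^esub> (x \<ominus>\<^bsub>J\<^esub> y)"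
    if "r \<in> carrier R" "x \<in> carrier J" "y \<in> carrier J" for r x y
    using that by (simp add: a_minus_def J.smult_r_distr J.smult_r_minus)
  show "trilinear_map R Tr Tr Tr Tr (triple Tr)"
    unfolding trilinear_map_def
    by (intro conjI ballI module_homI)
      (simp_all add: Tr_simps mult_simps comm J.smult_r_distr[symmetric],
       simp_all add: a_minus_def J.M.minus_add J.M.a_ac)
qed

lemma pair_of_algebra_P: "pair_of_algebra J = P"
  by (simp add: pair_of_algebra_def)

lemma pair_simps:
  "carrier (neg P) = carrier J" "carrier (pos P) = carrier J"
  "tri_neg P a b c = ((a \<cdot> b) \<cdot> c \<oplus>\<^bsub>J\<^esub> a \<cdot> (b \<cdot> c)) \<ominus>\<^bsub>J\<^esub> b \<cdot> (c \<cdot> a)"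
  "tri_pos P a b c = ((a \<cdot> b) \<cdot> c \<oplus>\<^bsub>J\<^esub> a \<cdot> (b \<cdot> c)) \<ominus>\<^bsub>J\<^esub> b \<cdot> (c \<cdot> a)"
  by (simp_all add: P_simps truncate_simps Tr_simps)

text \<open>
  The element \<open>D\<close> is what the commutator identity for $V_{a,b}$, $V_{c,d}$, evaluated at 1, leaves
  after adding the same expression with the pairs $(a,b)$ and $(c,d)$ exchanged. It vanishes after
  doubling: in the linearized Jordan identity the right side is symmetric in all four variables, so
  the four choices of the distinguished variable have a common value.
\<close>

lemma symmetrized_jordan:
  assumes abcd: "a \<in> carrier J" "b \<in> carrier J" "c \<in> carrier J" "d \<in> carrier J"
  defines "D \<equiv> (tri_neg P a b c \<cdot> d \<ominus>\<^bsub>J\<^esub> c \<cdot> tri_pos P b a d) \<oplus>\<^bsub>J\<^esub>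
    (tri_neg P c d a \<cdot> b \<ominus>\<^bsub>J\<^esub> a \<cdot> tri_pos P d c b)"
  shows "D \<oplus>\<^bsub>J\<^esub> D = \<zero>\<^bsub>J\<^esub>"
proof -
  let ?s = "(a \<cdot> b) \<cdot> (c \<cdot> d) \<oplus>\<^bsub>J\<^esub> (a \<cdot> c) \<cdot> (b \<cdot> d) \<oplus>\<^bsub>J\<^esub> (a \<cdot> d) \<cdot> (b \<cdot> c)"
  have s: "?s \<oplus>\<^bsub>J\<^esub> ?s \<in> carrier J" using abcd by simp
  note comm = mult_comm[OF abcd(1,2)] mult_comm[OF abcd(1,3)] mult_comm[OF abcd(1,4)]
    mult_comm[OF abcd(2,3)] mult_comm[OF abcd(2,4)] mult_comm[OF abcd(3,4)]
  have sB: "(((a \<cdot> c) \<cdot> b) \<cdot> d \<oplus>\<^bsub>J\<^esub> ((a \<cdot> d) \<cdot> b) \<cdot> c \<oplus>\<^bsub>J\<^esub> ((c \<cdot> d) \<cdot> b) \<cdot> a) \<oplus>\<^bsub>J\<^esub>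
      (((a \<cdot> c) \<cdot> b) \<cdot> d \<oplus>\<^bsub>J\<^esub> ((a \<cdot> d) \<cdot> b) \<cdot> c \<oplus>\<^bsub>J\<^esub> ((c \<cdot> d) \<cdot> b) \<cdot> a) = ?s \<oplus>\<^bsub>J\<^esub> ?s"
    using linearized_jordan[OF abcd(1,3,4,2)] by simp
  have sA: "(((b \<cdot> c) \<cdot> a) \<cdot> d \<oplus>\<^bsub>J\<^esub> ((b \<cdot> d) \<cdot> a) \<cdot> c \<oplus>\<^bsub>J\<^esub> ((c \<cdot> d) \<cdot> a) \<cdot> b) \<oplus>\<^bsub>J\<^esub>
      (((b \<cdot> c) \<cdot> a) \<cdot> d \<oplus>\<^bsub>J\<^esub> ((b \<cdot> d) \<cdot> a) \<cdot> c \<oplus>\<^bsub>J\<^esub> ((c \<cdot> d) \<cdot> a) \<cdot> b) = ?s \<oplus>\<^bsub>J\<^esub> ?s"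
  proof -
    have "(b \<cdot> a) \<cdot> (c \<cdot> d) \<oplus>\<^bsub>J\<^esub> (b \<cdot> c) \<cdot> (a \<cdot> d) \<oplus>\<^bsub>J\<^esub> (b \<cdot> d) \<cdot> (a \<cdot> c) = ?s"
      using abcd comm mult_comm[of "b \<cdot> c" "a \<cdot> d"] mult_comm[of "b \<cdot> d" "a \<cdot> c"] by (simp add: J.M.a_ac)
    then show ?thesis using linearized_jordan[OF abcd(2,3,4,1)] by simp
  qed
  have sC: "(((a \<cdot> b) \<cdot> c) \<cdot> d \<oplus>\<^bsub>J\<^esub> ((a \<cdot> d) \<cdot> c) \<cdot> b \<oplus>\<^bsub>J\<^esub> ((b \<cdot> d) \<cdot> c) \<cdot> a) \<oplus>\<^bsub>J\<^esub>
      (((a \<cdot> b) \<cdot> c) \<cdot> d \<oplus>\<^bsub>J\<^esub> ((a \<cdot> d) \<cdot> c) \<cdot> b \<oplus>\<^bsub>J\<^esub> ((b \<cdot> d) \<cdot> c) \<cdot> a) = ?s \<oplus>\<^bsub>J\<^esub> ?s"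
  proof -
    have "(a \<cdot> c) \<cdot> (b \<cdot> d) \<oplus>\<^bsub>J\<^esub> (a \<cdot> b) \<cdot> (c \<cdot> d) \<oplus>\<^bsub>J\<^esub> (a \<cdot> d) \<cdot> (c \<cdot> b) = ?s"
      using abcd mult_comm[of c b] by (simp add: J.M.a_ac)
    then show ?thesis using linearized_jordan[OF abcd(1,2,4,3)] by simp
  qed
  have sD: "(((a \<cdot> b) \<cdot> d) \<cdot> c \<oplus>\<^bsub>J\<^esub> ((a \<cdot> c) \<cdot> d) \<cdot> b \<oplus>\<^bsub>J\<^esub> ((b \<cdot> c) \<cdot> d) \<cdot> a) \<oplus>\<^bsub>J\<^esub>
      (((a \<cdot> b) \<cdot> d) \<cdot> c \<oplus>\<^bsub>J\<^esub> ((a \<cdot> c) \<cdot> d) \<cdot> b \<oplus>\<^bsub>J\<^esub> ((b \<cdot> c) \<cdot> d) \<cdot> a) = ?s \<oplus>\<^bsub>J\<^esub> ?s"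
  proof -
    have "(a \<cdot> d) \<cdot> (b \<cdot> c) \<oplus>\<^bsub>J\<^esub> (a \<cdot> b) \<cdot> (d \<cdot> c) \<oplus>\<^bsub>J\<^esub> (a \<cdot> c) \<cdot> (d \<cdot> b) = ?s"
      using abcd mult_comm[of d c] mult_comm[of d b] by (simp add: J.M.a_ac)
    then show ?thesis using linearized_jordan[OF abcd(1,2,3,4)] by simp
  qed
  have t1: "tri_neg P a b c \<cdot> d = ((a \<cdot> b) \<cdot> c) \<cdot> d \<oplus>\<^bsub>J\<^esub> ((b \<cdot> c) \<cdot> a) \<cdot> d \<ominus>\<^bsub>J\<^esub> ((a \<cdot> c) \<cdot> b) \<cdot> d"
    using abcd mult_comm[of a "b \<cdot> c"] mult_comm[of b "c \<cdot> a"] mult_comm[of c a]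
    by (simp add: pair_simps mult_simps mult_minus)
  have t2: "c \<cdot> tri_pos P b a d = ((a \<cdot> b) \<cdot> d) \<cdot> c \<oplus>\<^bsub>J\<^esub> ((a \<cdot> d) \<cdot> b) \<cdot> c \<ominus>\<^bsub>J\<^esub> ((b \<cdot> d) \<cdot> a) \<cdot> c"
    using abcd mult_comm[of c "tri_pos P b a d"] mult_comm[of b a] mult_comm[of b "a \<cdot> d"] mult_comm[of a "d \<cdot> b"]
      mult_comm[of d b]
    by (simp add: pair_simps mult_simps mult_minus)
  have t3: "tri_neg P c d a \<cdot> b = ((c \<cdot> d) \<cdot> a) \<cdot> b \<oplus>\<^bsub>J\<^esub> ((a \<cdot> d) \<cdot> c) \<cdot> b \<ominus>\<^bsub>J\<^esub> ((a \<cdot> c) \<cdot> d) \<cdot> b"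
    using abcd mult_comm[of c "d \<cdot> a"] mult_comm[of d "a \<cdot> c"] mult_comm[of d a]
    by (simp add: pair_simps mult_simps mult_minus)
  have t4: "a \<cdot> tri_pos P d c b = ((c \<cdot> d) \<cdot> b) \<cdot> a \<oplus>\<^bsub>J\<^esub> ((b \<cdot> c) \<cdot> d) \<cdot> a \<ominus>\<^bsub>J\<^esub> ((b \<cdot> d) \<cdot> c) \<cdot> a"
    using abcd mult_comm[of a "tri_pos P d c b"] mult_comm[of d c] mult_comm[of d "c \<cdot> b"] mult_comm[of c "b \<cdot> d"]
      mult_comm[of c b]
    by (simp add: pair_simps mult_simps mult_minus)
  show ?thesis
    by (rule J.M.linearized_combination[OF _ _ _ _ _ _ _ _ _ _ _ _ s sA sB sC sD])
      (use abcd in \<open>simp_all add: D_def t1 t2 t3 t4\<close>)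
qed

end

text \<open>
  A homomorphism from the TKK algebra of a Jordan algebra into a Lie algebra without 2-torsion is
  determined by its values on $1_-$ and on $J_+$.
\<close>

locale jordan_tkk_hom = jordan_algebra R J + L: lie_alg R L
  for R :: "('k, 'r) ring_scheme" and J :: "('k, 'j, 'x) module_scheme"
    and L :: "('k, 'l, 'y) lie_algebra_scheme" +
  fixes g
  assumes hom: "g \<in> lie_hom R (TKK R (pair_of_triple (triple_of_algebra J))) L"
    and no_two_torsion: "\<And>x. x \<in> carrier L \<Longrightarrow> x \<oplus>\<^bsub>L\<^esub> x = \<zero>\<^bsub>L\<^esub> \<Longrightarrow> x = \<zero>\<^bsub>L\<^esub>"
begin

sublocale g: tkk_hom R P L g
  using hom by unfold_locales

lemma g_neg_linear_J: "linear_map R J L (\<lambda>a. g (in_neg R P a))"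
  using g.g_neg.linear J.module_axioms L.module_axioms
  by (simp add: linear_map_def linear_map_axioms_def module_hom_def pair_simps P_simps truncate_simps Tr_simps)

interpretation gn: linear_map R J L "\<lambda>a. g (in_neg R P a)" by (rule g_neg_linear_J)

text \<open>
  The image in $L$ of $(\lambda(m)1)_-$. On $a\otimes b$ it is the image of $\{a,b,1\}=ab$.
\<close>

definition at_one where "at_one m = g (in_neg R P (fst (lam m) \<one>\<^bsub>J\<^esub>))"

lemma at_one_linear: "at_one \<in> module_hom R T L"
proof -
  have "\<one>\<^bsub>J\<^esub> \<in> carrier (neg P)" by (simp add: pair_simps)
  then show ?thesis by (intro module_homI) (simp_all add: at_one_def gl_simps)
qed

lemma at_one_pure:
  assumes "a \<in> carrier J" "b \<in> carrier J"
  shows "at_one (pure a b) = g (in_neg R P (a \<cdot> b))"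
proof -
  have "tri_neg P a b \<one>\<^bsub>J\<^esub> = a \<cdot> b"
    using assms mult_comm[of b a]
    by (simp add: pair_simps one_mult a_minus_def J.M.a_assoc J.M.r_neg)
  then show ?thesis using assms by (simp add: at_one_def lam_pure pair_simps)
qed

interpretation at_one: linear_map R T L at_one using at_one_linear by unfold_locales

text \<open>
  The bilinear map whose diagonal consists of the values of \<open>at_one\<close> on the generators of $A$.
\<close>

definition form where "form m n = at_one (act (lam m) n)"

lemma form_right: "m \<in> carrier T \<Longrightarrow> form m \<in> module_hom R T L"
  unfolding form_def
  by (intro module_hom_compose[OF linear_map.linear[OF act_linear] at_one_linear]) simp

lemma form_left: "n \<in> carrier T \<Longrightarrow> (\<lambda>m. form m n) \<in> module_hom R T L"
  unfolding form_def
  by (rule module_hom_compose[OF module_hom_compose[OF lam.linear act_left_linear] at_one_linear])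

lemma tri_mem:
  "x \<in> carrier J \<Longrightarrow> y \<in> carrier J \<Longrightarrow> z \<in> carrier J \<Longrightarrow> tri_neg P x y z \<in> carrier J"
  "x \<in> carrier J \<Longrightarrow> y \<in> carrier J \<Longrightarrow> z \<in> carrier J \<Longrightarrow> tri_pos P x y z \<in> carrier J"
  by (simp_all add: pair_simps)

lemma form_pure:
  assumes "x \<in> carrier J" "y \<in> carrier J" "z \<in> carrier J" "w \<in> carrier J"
  shows "form (pure x y) (pure z w) =
    g (in_neg R P (tri_neg P x y z \<cdot> w \<ominus>\<^bsub>J\<^esub> z \<cdot> tri_pos P y x w))"
proof -
  have ng: "\<ominus>\<^bsub>pos P\<^esub> t = \<ominus>\<^bsub>J\<^esub> t" for t
    by (simp add: P_simps a_inv_def m_inv_def truncate_simps Tr_simps)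
  have "act (lam (pure x y)) (pure z w) =
      pure (tri_neg P x y z) w \<oplus>\<^bsub>T\<^esub> pure z (\<ominus>\<^bsub>J\<^esub> tri_pos P y x w)"
    using assms lam_pure[of x y] by (simp add: act_pure pair_simps(1,2) ng)
  then show ?thesis
    using assms tri_mem[of x y z] tri_mem[of y x w] pure_closed[of "tri_neg P x y z" w]
      pure_closed[of z "\<ominus>\<^bsub>J\<^esub> tri_pos P y x w"]
    by (simp add: form_def at_one_pure pair_simps(1,2) mult_neg a_minus_def)
qed

text \<open>
  The sum of the two values is the image of the element of \<open>symmetrized_jordan\<close>; its double is
  zero, and 2 can be cancelled in $L$.
\<close>

lemma form_pure_antisym:
  assumes abcd: "a \<in> carrier J" "b \<in> carrier J" "c \<in> carrier J" "d \<in> carrier J"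
  shows "form (pure a b) (pure c d) = \<ominus>\<^bsub>L\<^esub> form (pure c d) (pure a b)"
proof -
  define s where "s = g (in_neg R P ((tri_neg P a b c \<cdot> d \<ominus>\<^bsub>J\<^esub> c \<cdot> tri_pos P b a d) \<oplus>\<^bsub>J\<^esub>
      (tri_neg P c d a \<cdot> b \<ominus>\<^bsub>J\<^esub> a \<cdot> tri_pos P d c b)))"
  have sL: "s \<in> carrier L" unfolding s_def using abcd tri_mem by (intro gn.closed) simp
  have "s \<oplus>\<^bsub>L\<^esub> s = \<zero>\<^bsub>L\<^esub>"
    unfolding s_def using abcd tri_mem symmetrized_jordan[OF abcd] gn.zero
    by (subst gn.add[symmetric]) simp_all
  then have "s = \<zero>\<^bsub>L\<^esub>" by (rule no_two_torsion[OF sL])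
  then have "form (pure a b) (pure c d) \<oplus>\<^bsub>L\<^esub> form (pure c d) (pure a b) = \<zero>\<^bsub>L\<^esub>"
    unfolding s_def using abcd tri_mem by (simp add: form_pure)
  moreover have "form (pure c d) (pure a b) \<in> carrier L" "form (pure a b) (pure c d) \<in> carrier L"
    using abcd pure_closed by (simp_all add: form_def pair_simps(1,2))
  ultimately show ?thesis by (rule L.M.minus_equality[symmetric])
qed

lemma form_antisym:
  assumes m: "m \<in> carrier T" and n: "n \<in> carrier T"
  shows "form m n = \<ominus>\<^bsub>L\<^esub> form n m"
proof -
  have neg_hom: "(\<lambda>m. \<ominus>\<^bsub>L\<^esub> b m) \<in> module_hom R T L" if "b \<in> module_hom R T L" for b
    using that by (auto simp: module_hom_def Pi_iff L.M.minus_add L.smult_r_minus L.M.a_comm)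
  show ?thesis
  proof (rule tensor_hom_eqI[OF L.module_axioms form_right[OF m] neg_hom[OF form_left[OF m]] _ n])
    fix c d assume cd: "c \<in> carrier (neg P)" "d \<in> carrier (pos P)"
    then have p: "pure c d \<in> carrier T" by simp
    show "form m (pure c d) = \<ominus>\<^bsub>L\<^esub> form (pure c d) m"
    proof (rule tensor_hom_eqI[OF L.module_axioms form_left[OF p] neg_hom[OF form_right[OF p]] _ m])
      fix a b assume "a \<in> carrier (neg P)" "b \<in> carrier (pos P)"
      with cd show "form (pure a b) (pure c d) = \<ominus>\<^bsub>L\<^esub> form (pure c d) (pure a b)"
        by (intro form_pure_antisym) (simp_all add: pair_simps(1,2))
    qed
  qed
qed

text \<open>
  An antisymmetric bilinear map into a module without 2-torsion is alternating.
\<close>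

lemma at_one_A:
  assumes "n \<in> tkk_A R P"
  shows "at_one n = \<zero>\<^bsub>L\<^esub>"
  using A_gens_closed _ assms[unfolded tkk_A_def pair_tensor_T]
proof (rule at_one.span_killed)
  fix x assume "x \<in> {act (lam m) m |m. m \<in> carrier T}"
  then obtain m where m: "m \<in> carrier T" "x = act (lam m) m" by blast
  have mL: "form m m \<in> carrier L" using m by (simp add: form_def)
  have "form m m \<oplus>\<^bsub>L\<^esub> form m m = \<zero>\<^bsub>L\<^esub>"
    using form_antisym[OF m(1) m(1)] L.M.r_neg[OF mL] by metis
  from no_two_torsion[OF mL this] show "at_one x = \<zero>\<^bsub>L\<^esub>" by (simp add: form_def m)
qed

text \<open>
  In TKK one has $b_-=\{1,b,1\}_-=\langle1,b\rangle1_-$ up to the choice of the representative of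
  $\langle1,b\rangle$. That choice changes $\langle1,b\rangle1_-$ by some $\lambda(n)1$ with $n\in A$,
  which the homomorphism kills by \<open>at_one_A\<close>.
\<close>

lemma neg_from_one:
  assumes b: "b \<in> carrier J"
  shows "g (in_neg R P b) = \<lblot>\<lblot>g (in_neg R P \<one>\<^bsub>J\<^esub>), g (in_pos R P b)\<rblot>\<^bsub>L\<^esub>, g (in_neg R P \<one>\<^bsub>J\<^esub>)\<rblot>\<^bsub>L\<^esub>"
proof -
  have pb: "pure \<one>\<^bsub>J\<^esub> b \<in> carrier T" "angle \<one>\<^bsub>J\<^esub> b \<in> carrier Z"
    using pure_closed angle_closed b by (simp_all add: pair_simps(1,2))
  have "g (in_neg R P b) = at_one (pure \<one>\<^bsub>J\<^esub> b)" using b by (simp add: at_one_pure one_mult)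
  also have "\<dots> = at_one (coset_rep (angle \<one>\<^bsub>J\<^esub> b))"
    unfolding angle_proj using A.quotient_lift(1)[OF L.module_axioms at_one_linear at_one_A pb(1)] by simp
  also have "\<dots> = g (in_neg R P (act_neg R P (angle \<one>\<^bsub>J\<^esub> b) \<one>\<^bsub>J\<^esub>))"
    by (simp add: at_one_def act_neg_def)
  also have "\<dots> = \<lblot>g (in_zero P (angle \<one>\<^bsub>J\<^esub> b)), g (in_neg R P \<one>\<^bsub>J\<^esub>)\<rblot>\<^bsub>L\<^esub>"
    using g.g_act_neg[OF pb(2), of "\<one>\<^bsub>J\<^esub>"] by (simp add: pair_simps(1))
  also have "\<dots> = \<lblot>\<lblot>g (in_neg R P \<one>\<^bsub>J\<^esub>), g (in_pos R P b)\<rblot>\<^bsub>L\<^esub>, g (in_neg R P \<one>\<^bsub>J\<^esub>)\<rblot>\<^bsub>L\<^esub>"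
    using g.g_angle[of "\<one>\<^bsub>J\<^esub>" b] b by (simp add: pair_simps(1,2))
  finally show ?thesis .
qed

end

section \<open>The universal property for Jordan algebras\<close>

text \<open>
  An extension sends $1_-$ to $f$ and so is given by \<open>lower\<close> on $J_-$. Conversely \<open>lower\<close>
  together with $\gamma$ is a homomorphism of pairs by \<open>triple_pos\<close> and \<open>triple_neg\<close>. It
  maps $1_-$ to $f$ and $2_+$ to $2\cdot\frac12e=e$, hence $-\langle1,2\rangle$ to $-[f,e]=h$.
\<close>

theorem A1_extension:
  assumes A1: "A1_graded R L (h, e, f)" and half: "\<exists>u\<in>carrier L. u \<oplus>\<^bsub>L\<^esub> u = e"
    and jord: "unital_jordan_algebra R J"
    and hom: "g0 \<in> unital_jordan_algebra_hom R J (lie_jordan_algebra L (h, e, f))"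
  shows "\<exists>!g. g \<in> extensional (carrier (TKK R (pair_of_algebra J))) \<and>
              g \<in> A1_morphism R (TKK R (pair_of_algebra J)) (TKK_sl2 R J) L (h, e, f) \<and>
              (\<forall>a\<in>carrier J. g (in_pos R (pair_of_algebra J) a) = g0 a)"
proof -
  interpret jordan_algebra R J by (rule jordan_algebra.intro[OF jord])
  have "lie_algebra R L" using A1 by (simp add: A1_graded_def three_graded_def)
  then interpret L: A1_lie R L h e f
    using A1 by (simp add: A1_lie_def A1_lie_axioms_def lie_alg_def lie_alg_axioms_def lie_algebra_def)
  let ?G = "A1_grading L (h, e, f)"
  note homD = hom[unfolded unital_jordan_algebra_hom_def lie_jordan_algebra_def, simplified]
  have g0_mem: "g0 a \<in> ?G 1" if "a \<in> carrier J" for a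
    using homD that by (auto simp: module_hom_def)
  note g0_closed = L.G_closed[OF g0_mem]
  interpret g0: linear_map R J L g0
  proof unfold_locales
    show "g0 \<in> module_hom R J L"
      using homD g0_closed by (auto simp: module_hom_def)
  qed
  have g0_mult: "g0 (a \<otimes>\<^bsub>J\<^esub> b) = L.jprod (g0 a) (g0 b)" if "a \<in> carrier J" "b \<in> carrier J" for a b
    using homD that by (simp add: L.jprod_def)
  obtain u where u: "u \<in> carrier L" "u \<oplus>\<^bsub>L\<^esub> u = e" using half by blast
  have g0_one: "g0 \<one>\<^bsub>J\<^esub> = u"
    using homD L.half_e(1)[OF u] by simp
  let ?two = "\<one>\<^bsub>J\<^esub> \<oplus>\<^bsub>J\<^esub> \<one>\<^bsub>J\<^esub>"
  let ?gm = "\<lambda>a. L.lower (g0 a)"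
  have g0_two: "g0 ?two = e" using u by (simp add: g0_one)
  have gm_one: "?gm \<one>\<^bsub>J\<^esub> = f" using L.half_e(2)[OF u] by (simp add: g0_one)
  have sl2: "TKK_sl2 R J = (\<ominus>\<^bsub>TKK R P\<^esub> in_zero P (angle \<one>\<^bsub>J\<^esub> ?two), in_pos R P ?two, in_neg R P \<one>\<^bsub>J\<^esub>)"
    by (simp add: TKK_sl2_def Let_def pair_of_algebra_P)
  have pair_hom: "(?gm, g0) \<in> jordan_pair_hom R P (lie_jordan_pair L ?G)"
  proof -
    have trip: "L.jprod (L.jprod (g0 a) (g0 b)) (g0 c) \<oplus>\<^bsub>L\<^esub> L.jprod (g0 a) (L.jprod (g0 b) (g0 c))
        \<oplus>\<^bsub>L\<^esub> \<ominus>\<^bsub>L\<^esub> L.jprod (g0 b) (L.jprod (g0 a) (g0 c)) = g0 (tri_pos P a b c)"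
      if "a \<in> carrier J" "b \<in> carrier J" "c \<in> carrier J" for a b c
      using that mult_comm[of c a] by (simp add: pair_simps g0_mult[symmetric] a_minus_def)
    have "g0 (tri_pos P a b c) = \<lblot>\<lblot>g0 a, ?gm b\<rblot>\<^bsub>L\<^esub>, g0 c\<rblot>\<^bsub>L\<^esub>"
      if "a \<in> carrier J" "b \<in> carrier J" "c \<in> carrier J" for a b c
      using L.triple_pos[of "g0 a" "g0 b" "g0 c"] trip[of a b c] that g0_mem g0_mult mult_comm[of b a]
      by (metis mult_closed)
    moreover have "?gm (tri_neg P a b c) = \<lblot>\<lblot>?gm a, g0 b\<rblot>\<^bsub>L\<^esub>, ?gm c\<rblot>\<^bsub>L\<^esub>"
      if "a \<in> carrier J" "b \<in> carrier J" "c \<in> carrier J" for a b c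
      using L.triple_neg[of "g0 a" "g0 b" "g0 c"] trip[of a b c] that g0_mem
      by (simp add: pair_simps)
    moreover have "?gm \<in> module_hom R J (neg (lie_jordan_pair L ?G))"
      using module_hom_compose[OF g0.linear L.lower_linear] L.lower_mem g0_mem
      by (simp add: module_hom_def lie_jordan_pair_simps Pi_iff)
    moreover have "g0 \<in> module_hom R J (pos (lie_jordan_pair L ?G))"
      using g0.linear g0_mem by (simp add: module_hom_def lie_jordan_pair_simps Pi_iff)
    ultimately show ?thesis
      by (simp add: jordan_pair_hom_def lie_jordan_pair_simps pair_simps module_hom_def
        P_simps truncate_simps Tr_simps)
  qed
  interpret pair_into_lie R P L ?gm g0 by (rule pair_into_lieI(1)[OF L.graded pair_hom])
  interpret ext: linear_map R "TKK R P" L extension using extension_linear by unfold_locales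
  show ?thesis
    unfolding pair_of_algebra_P
  proof (rule ex1I[of _ extension], intro conjI)
    have "in_zero P (angle \<one>\<^bsub>J\<^esub> ?two) \<in> carrier (TKK R P)"
      using angle_closed[of "\<one>\<^bsub>J\<^esub>" ?two] M.M.zero_closed N.M.zero_closed
      by (simp add: in_zero_def TKK_simps pair_simps)
    then have "extension (\<ominus>\<^bsub>TKK R P\<^esub> in_zero P (angle \<one>\<^bsub>J\<^esub> ?two)) = \<ominus>\<^bsub>L\<^esub> \<lblot>f, e\<rblot>\<^bsub>L\<^esub>"
      using angle_closed[of "\<one>\<^bsub>J\<^esub>" ?two]
      by (simp add: extension_in_zero angle_proj pairing_rep pairing_pure pair_simps gm_one g0_two)
    also have "\<dots> = h" using L.triple_closed by (simp add: L.fe)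
    finally show "extension \<in> A1_morphism R (TKK R P) (TKK_sl2 R J) L (h, e, f)"
      by (simp add: A1_morphism_def extension_lie_hom sl2 extension_in_neg extension_in_pos
          pair_simps gm_one g0_two)
    show "\<forall>a\<in>carrier J. extension (in_pos R P a) = g0 a" by (simp add: extension_in_pos pair_simps)
  next
    fix g assume g: "g \<in> extensional (carrier (TKK R P)) \<and>
        g \<in> A1_morphism R (TKK R P) (TKK_sl2 R J) L (h, e, f) \<and>
        (\<forall>a\<in>carrier J. g (in_pos R P a) = g0 a)"
    interpret g: jordan_tkk_hom R J L g
    proof unfold_locales
      show "g \<in> lie_hom R (TKK R P) L" using g by (simp add: A1_morphism_def)
    qed (rule L.no_two_torsion)
    have g_one: "g (in_neg R P \<one>\<^bsub>J\<^esub>) = f" using g by (simp add: A1_morphism_def sl2)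
    have "g (in_neg R P b) = ?gm b" if "b \<in> carrier J" for b
      using g.neg_from_one[OF that] g that by (simp add: g_one L.lower_def)
    with g show "g = extension"
      by (intro extension_unique) (auto simp: pair_simps(1,2) A1_morphism_def)
  qed (simp add: extension_def)
qed

theorem theorem5p7:
  fixes R :: "('k, 'r) ring_scheme"
    and L :: "('k, 'l, 'x) lie_algebra_scheme"
    and G :: "int \<Rightarrow> 'l set"
  assumes "cring R"
    and "\<forall>r\<in>carrier R. [(2::nat)] \<cdot>\<^bsub>R\<^esub> r = \<zero>\<^bsub>R\<^esub> \<longrightarrow> r = \<zero>\<^bsub>R\<^esub>"
    and "\<forall>r\<in>carrier R. [(3::nat)] \<cdot>\<^bsub>R\<^esub> r = \<zero>\<^bsub>R\<^esub> \<longrightarrow> r = \<zero>\<^bsub>R\<^esub>"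
    and "three_graded R L G"
  shows
    "(\<forall>(P :: ('k, 'm, 'p) jordan_pair) gm gp.
        jordan_pair R P \<longrightarrow> (gm, gp) \<in> jordan_pair_hom R P (lie_jordan_pair L G) \<longrightarrow>
        (let E = {g. g \<in> extensional (carrier (TKK R P)) \<and>
                     g \<in> graded_lie_hom R (TKK R P) (TKK_grading R P) L G \<and>
                     (\<forall>a\<in>carrier (neg P). g (in_neg R P a) = gm a) \<and>
                     (\<forall>b\<in>carrier (pos P). g (in_pos R P b) = gp b)} in
         (\<exists>!g. g \<in> E) \<and>
         (\<forall>g\<in>E. \<forall>a\<in>carrier (neg P). \<forall>b\<in>carrier (pos P). \<forall>(n::nat) c d.
            (\<forall>i<n. c i \<in> carrier (neg P) \<and> d i \<in> carrier (pos P)) \<longrightarrow>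
            g (a, \<Oplus>\<^bsub>tkk_zero_part R P\<^esub>i\<in>{..<n}. tkk_angle R P (c i) (d i), b) =
              gm a \<oplus>\<^bsub>L\<^esub> (\<Oplus>\<^bsub>L\<^esub>i\<in>{..<n}. \<lblot>gm (c i), gp (d i)\<rblot>\<^bsub>L\<^esub>) \<oplus>\<^bsub>L\<^esub> gp b))) \<and>
     (\<forall>\<epsilon> (T :: ('k, 't) jordan_triple) g0.
        anti_graded_involution R L G \<epsilon> \<longrightarrow>
        jordan_triple_system R T \<longrightarrow> g0 \<in> jordan_triple_hom R T (lie_triple L G \<epsilon>) \<longrightarrow>
        (\<exists>!g. g \<in> extensional (carrier (TKK R (pair_of_triple T))) \<and>
              g \<in> involutary_hom R (TKK R (pair_of_triple T)) (TKK_grading R (pair_of_triple T))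
                    (TKK_involution R T) L G \<epsilon> \<and>
              (\<forall>a\<in>carrier T. g (in_pos R (pair_of_triple T) a) = g0 a))) \<and>
     (\<forall>h e f (J :: ('k, 'j) module) g0.
        A1_graded R L (h, e, f) \<longrightarrow> (\<exists>u\<in>carrier L. u \<oplus>\<^bsub>L\<^esub> u = e) \<longrightarrow>
        unital_jordan_algebra R J \<longrightarrow>
        g0 \<in> unital_jordan_algebra_hom R J (lie_jordan_algebra L (h, e, f)) \<longrightarrow>
        (\<exists>!g. g \<in> extensional (carrier (TKK R (pair_of_algebra J))) \<and>
              g \<in> A1_morphism R (TKK R (pair_of_algebra J)) (TKK_sl2 R J) L (h, e, f) \<and>
              (\<forall>a\<in>carrier J. g (in_pos R (pair_of_algebra J) a) = g0 a)))"
proof (intro conjI allI impI)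
  fix P :: "('k, 'm, 'p) jordan_pair" and gm gp
  assume "jordan_pair R P" "(gm, gp) \<in> jordan_pair_hom R P (lie_jordan_pair L G)"
  from graded_extension[OF assms(4) this]
  show "let E = {g. g \<in> extensional (carrier (TKK R P)) \<and>
                     g \<in> graded_lie_hom R (TKK R P) (TKK_grading R P) L G \<and>
                     (\<forall>a\<in>carrier (neg P). g (in_neg R P a) = gm a) \<and>
                     (\<forall>b\<in>carrier (pos P). g (in_pos R P b) = gp b)} in
         (\<exists>!g. g \<in> E) \<and>
         (\<forall>g\<in>E. \<forall>a\<in>carrier (neg P). \<forall>b\<in>carrier (pos P). \<forall>(n::nat) c d.
            (\<forall>i<n. c i \<in> carrier (neg P) \<and> d i \<in> carrier (pos P)) \<longrightarrow>
            g (a, \<Oplus>\<^bsub>tkk_zero_part R P\<^esub>i\<in>{..<n}. tkk_angle R P (c i) (d i), b) =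
              gm a \<oplus>\<^bsub>L\<^esub> (\<Oplus>\<^bsub>L\<^esub>i\<in>{..<n}. \<lblot>gm (c i), gp (d i)\<rblot>\<^bsub>L\<^esub>) \<oplus>\<^bsub>L\<^esub> gp b)"
    unfolding Let_def .
next
  fix \<epsilon> and T :: "('k, 't) jordan_triple" and g0
  assume "anti_graded_involution R L G \<epsilon>" "jordan_triple_system R T"
    "g0 \<in> jordan_triple_hom R T (lie_triple L G \<epsilon>)"
  then show "\<exists>!g. g \<in> extensional (carrier (TKK R (pair_of_triple T))) \<and>
              g \<in> involutary_hom R (TKK R (pair_of_triple T)) (TKK_grading R (pair_of_triple T))
                    (TKK_involution R T) L G \<epsilon> \<and>
              (\<forall>a\<in>carrier T. g (in_pos R (pair_of_triple T) a) = g0 a)"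
    by (rule involutary_extension[OF assms(4)])
next
  fix h e f and J :: "('k, 'j) module" and g0
  assume "A1_graded R L (h, e, f)" "\<exists>u\<in>carrier L. u \<oplus>\<^bsub>L\<^esub> u = e"
    "unital_jordan_algebra R J" "g0 \<in> unital_jordan_algebra_hom R J (lie_jordan_algebra L (h, e, f))"
  then show "\<exists>!g. g \<in> extensional (carrier (TKK R (pair_of_algebra J))) \<and>
              g \<in> A1_morphism R (TKK R (pair_of_algebra J)) (TKK_sl2 R J) L (h, e, f) \<and>
              (\<forall>a\<in>carrier J. g (in_pos R (pair_of_algebra J) a) = g0 a)"
    by (rule A1_extension)
qed

end
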